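(* Let $f:\mathbb R^d\to\mathbb R$ be continuous, scaling-invariant with respect to some $x^*\in\mathbb R^d$, and with Lebesgue-negligible level sets. Let $(m_k,C_k)_{k\in\mathbb N}$ be the sequence produced by the (simplified) CMA-ES algorithm applied to $f$, and let $\theta_k=(z_k,\Sigma_k)$ with $z_k=(m_k-x^* )/\sqrt{R(C_k)}$ and $\Sigma_k=C_k/R(C_k)$, where $R=\det(\cdot)^{1/d}$. Then $\{\theta_k\}_{k\in\mathbb N}$ is a time-homogeneous $\varphi$-irreducible aperiodic T-chain on $X=\mathbb R^d\times\{\Sigma\in\mathcal S^d_{++}:\det\Sigma=1\}$, for which every compact subset of $X$ is small.
   Context: $\mathcal S^d_{++}$ is the set of real symmetric positive definite $d\times d$ matrices and $\sqrt{C}$ is the symmetric positive definite square root. $f$ is scaling-invariant w.r.t. $x^*$ if for all $x,y\in\mathbb R^d$, $\rho>0$: $f(x+x^* )\le f(y+x^* )\iff f(\rho x+x^* )\le f(\rho y+x^* )$. $f$ has Lebesgue-negligible level sets if $\mathrm{Leb}(\{x:f(x)=t\})=0$ for all $t\in\mathbb R$. **Simplified CMA-ES.** Fix integers $\lambda\ge2$, $\mu\in\{1,\dots,\lambda\}$, weights $w_1\ge\dots\ge w_\mu>0$ with $\sum_iw_i=1$, and $c\in(0,1)$. Given $m_k\in\mathbb R^d$, $C_k\in\mathcal S^d_{++}$: sample $U_{k+1}^1,\dots,U_{k+1}^\lambda\sim\mathcal N(0,I_d)$ i.i.d. and independent of $(m_k,C_k)$ (and of the past); let $s_{k+1}$ be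 a permutation of $\{1,\dots,\lambda\}$ with $f(m_k+\sqrt{C_k}U_{k+1}^{s_{k+1}(1)})\le\dots\le f(m_k+\sqrt{C_k}U_{k+1}^{s_{k+1}(\lambda)})$ (ties broken by index order); set $m_{k+1}=m_k+\sqrt{C_k}\sum_{i=1}^\mu w_iU_{k+1}^{s_{k+1}(i)}$ and $C_{k+1}=(1-c)C_k+c\sqrt{C_k}\big(\sum_{i=1}^\mu w_iU_{k+1}^{s_{k+1}(i)}(U_{k+1}^{s_{k+1}(i)})^\top\big)\sqrt{C_k}$. **Markov chain notions** (for a kernel $P$ on $X$ with iterates $P^k$). $P$ is $\varphi$-irreducible if there is a nontrivial measure $\varphi$ on $\mathcal B(X)$ such that $\varphi(A)>0$ implies $\sum_{k\ge1}P^k(x,A)>0$ for all $x\in X$ (such $\varphi$ is called an irreducibility measure). For a probability $b$ on $\mathbb N=\{0,1,\dots\}$, $K_b=\sum_{k\ge0}b(k)P^k$. $P$ is a T-chain if for some $b$ there is a substochastic kernel $T\le K_b$ with $T(\cdot,A)$ lower semicontinuous for every $A\in\mathcal B(X)$ and $T(x,X)>0$ for all $x$. $C\in\mathcal B(X)$ is small if there are $a\in\mathbb N$ and a nontrivial measure $\nu$ with $P^a(x,A)\ge\nu(A)$ for all $x\in C$, $A\in\mathcal B(X)$. For $P$ $\varphi$-irreducible, a $d$-cycle is a family of disjoint Borel sets $(D_i)_{i\in\mathbb Z/d\mathbb Z}$ with $P(x,D_{i+1})=1$ for $x\in D_i$ and $\varphi((\bigcup_iD_i)^c)=0$ for every irreducibility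 measure $\varphi$; $P$ is aperiodic if the largest $d$ for which a $d$-cycle exists is $1$. *)

theory Defs
  imports "HOL-Probability.Probability"
begin

section \<open>Markov kernels on a subset of a topological space\<close>

text \<open>
  The state space is a subset \<open>S\<close> of a topological type, carrying the subspace topology and its
  Borel sets. Kernels are functions into measures, as in the Giry monad of the library.
\<close>

abbreviation borel_on :: "'a::topological_space set \<Rightarrow> 'a measure" where
  "borel_on S \<equiv> restrict_space borel S"

definition markov_kernel :: "'a::topological_space set \<Rightarrow> ('a \<Rightarrow> 'a measure) \<Rightarrow> bool" where
  "markov_kernel S P \<longleftrightarrow> P \<in> borel_on S \<rightarrow>\<^sub>M prob_algebra (borel_on S)"

definition substochastic_kernel :: "'a::topological_space set \<Rightarrow> ('a \<Rightarrow> 'a measure) \<Rightarrow> bool" where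
  "substochastic_kernel S T \<longleftrightarrow> T \<in> borel_on S \<rightarrow>\<^sub>M subprob_algebra (borel_on S)"

primrec kernel_pow ::
  "'a::topological_space set \<Rightarrow> ('a \<Rightarrow> 'a measure) \<Rightarrow> nat \<Rightarrow> 'a \<Rightarrow> 'a measure" where
  "kernel_pow S P 0 x = return (borel_on S) x"
| "kernel_pow S P (Suc k) x = bind (kernel_pow S P k x) P"

definition sampled_kernel ::
  "'a::topological_space set \<Rightarrow> ('a \<Rightarrow> 'a measure) \<Rightarrow> nat pmf \<Rightarrow> 'a \<Rightarrow> 'a set \<Rightarrow> ennreal" where
  "sampled_kernel S P b x A = (\<Sum>k. ennreal (pmf b k) * emeasure (kernel_pow S P k x) A)"

definition nontrivial_measure_on :: "'a::topological_space set \<Rightarrow> 'a measure \<Rightarrow> bool" where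
  "nontrivial_measure_on S \<phi> \<longleftrightarrow> sets \<phi> = sets (borel_on S) \<and> emeasure \<phi> S > 0"

definition irreducibility_measure ::
  "'a::topological_space set \<Rightarrow> ('a \<Rightarrow> 'a measure) \<Rightarrow> 'a measure \<Rightarrow> bool" where
  "irreducibility_measure S P \<phi> \<longleftrightarrow>
     nontrivial_measure_on S \<phi> \<and>
     (\<forall>A\<in>sets (borel_on S). emeasure \<phi> A > 0 \<longrightarrow>
        (\<forall>x\<in>S. (\<Sum>k. emeasure (kernel_pow S P (Suc k) x) A) > 0))"

definition phi_irreducible :: "'a::topological_space set \<Rightarrow> ('a \<Rightarrow> 'a measure) \<Rightarrow> bool" where
  "phi_irreducible S P \<longleftrightarrow> (\<exists>\<phi>. irreducibility_measure S P \<phi>)"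

definition lsc_on :: "'a::topological_space set \<Rightarrow> ('a \<Rightarrow> ennreal) \<Rightarrow> bool" where
  "lsc_on S g \<longleftrightarrow> (\<forall>t. openin (top_of_set S) {x\<in>S. t < g x})"

definition T_chain :: "'a::topological_space set \<Rightarrow> ('a \<Rightarrow> 'a measure) \<Rightarrow> bool" where
  "T_chain S P \<longleftrightarrow>
     (\<exists>b T. substochastic_kernel S T \<and>
        (\<forall>x\<in>S. \<forall>A\<in>sets (borel_on S). emeasure (T x) A \<le> sampled_kernel S P b x A) \<and>
        (\<forall>A\<in>sets (borel_on S). lsc_on S (\<lambda>x. emeasure (T x) A)) \<and>
        (\<forall>x\<in>S. emeasure (T x) S > 0))"

definition small_set :: "'a::topological_space set \<Rightarrow> ('a \<Rightarrow> 'a measure) \<Rightarrow> 'a set \<Rightarrow> bool" where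
  "small_set S P K \<longleftrightarrow>
     K \<in> sets (borel_on S) \<and>
     (\<exists>a \<nu>. nontrivial_measure_on S \<nu> \<and>
        (\<forall>x\<in>K. \<forall>A\<in>sets (borel_on S). emeasure \<nu> A \<le> emeasure (kernel_pow S P a x) A))"

text \<open>The cyclic index set of a cycle of length \<open>n\<close> is \<open>{..<n}\<close> with addition modulo \<open>n\<close>.\<close>

definition cycle ::
  "'a::topological_space set \<Rightarrow> ('a \<Rightarrow> 'a measure) \<Rightarrow> nat \<Rightarrow> (nat \<Rightarrow> 'a set) \<Rightarrow> bool" where
  "cycle S P n D \<longleftrightarrow>
     n \<ge> 1 \<and>
     (\<forall>i<n. D i \<in> sets (borel_on S)) \<and>
     disjoint_family_on D {..<n} \<and>
     (\<forall>i<n. \<forall>x\<in>D i. emeasure (P x) (D ((i + 1) mod n)) = 1) \<and>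
     (\<forall>\<phi>. irreducibility_measure S P \<phi> \<longrightarrow> emeasure \<phi> (S - (\<Union>i<n. D i)) = 0)"

definition aperiodic :: "'a::topological_space set \<Rightarrow> ('a \<Rightarrow> 'a measure) \<Rightarrow> bool" where
  "aperiodic S P \<longleftrightarrow> (\<exists>D. cycle S P 1 D) \<and> (\<forall>n D. cycle S P n D \<longrightarrow> n \<le> 1)"

text \<open>
  The conditional expectation is with respect to the \<open>\<sigma>\<close>-algebra generated by
  \<open>\<theta> 0, \<dots>, \<theta> k\<close>, written as a pullback of the product \<open>\<sigma>\<close>-algebra.
\<close>

definition homogeneous_markov_chain ::
  "'w measure \<Rightarrow> 'a::topological_space set \<Rightarrow> ('a \<Rightarrow> 'a measure) \<Rightarrow> (nat \<Rightarrow> 'w \<Rightarrow> 'a) \<Rightarrow> bool" where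
  "homogeneous_markov_chain M S P \<theta> \<longleftrightarrow>
     prob_space M \<and>
     markov_kernel S P \<and>
     (\<forall>k. \<theta> k \<in> M \<rightarrow>\<^sub>M borel_on S) \<and>
     (\<forall>k. \<forall>A\<in>sets (borel_on S).
        AE \<omega> in M.
          real_cond_exp M
            (vimage_algebra (space M) (\<lambda>\<omega>. \<lambda>i\<in>{..k}. \<theta> i \<omega>) (PiM {..k} (\<lambda>_. borel_on S)))
            (\<lambda>\<omega>. indicator A (\<theta> (Suc k) \<omega>)) \<omega>
          = measure (P (\<theta> k \<omega>)) A)"


section \<open>Objective functions\<close>

definition scaling_invariant :: "(real^'d \<Rightarrow> real) \<Rightarrow> real^'d \<Rightarrow> bool" where
  "scaling_invariant f xstar \<longleftrightarrow>
     (\<forall>x y. \<forall>\<rho>>0. f (x + xstar) \<le> f (y + xstar) \<longleftrightarrow> f (\<rho> *\<^sub>R x + xstar) \<le> f (\<rho> *\<^sub>R y + xstar))"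

definition negligible_level_sets :: "(real^'d \<Rightarrow> real) \<Rightarrow> bool" where
  "negligible_level_sets f \<longleftrightarrow> (\<forall>t. {x. f x = t} \<in> null_sets lborel)"


section \<open>The simplified CMA-ES\<close>

definition sym_pos_def :: "real^'d^'d \<Rightarrow> bool" where
  "sym_pos_def A \<longleftrightarrow> transpose A = A \<and> (\<forall>x. x \<noteq> 0 \<longrightarrow> x \<bullet> (A *v x) > 0)"

definition mat_sqrt :: "real^'d^'d \<Rightarrow> real^'d^'d" where
  "mat_sqrt C = (THE S. sym_pos_def S \<and> S ** S = C)"

definition std_gaussian :: "(real^'d) measure" where
  "std_gaussian = density lborel (\<lambda>x. ennreal (\<Prod>i\<in>UNIV. std_normal_density (x $ i)))"

text \<open>
  Candidate solutions are indexed by \<open>{1..lam}\<close>; \<open>v\<close> gives their objective values. The ranking is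
  the unique sorting permutation that resolves ties by index order.
\<close>

definition ranking :: "nat \<Rightarrow> (nat \<Rightarrow> real) \<Rightarrow> nat \<Rightarrow> nat" where
  "ranking lam v =
     (THE s. s permutes {1..lam} \<and>
        (\<forall>i\<in>{1..lam}. \<forall>j\<in>{1..lam}. i < j \<longrightarrow>
           v (s i) < v (s j) \<or> v (s i) = v (s j) \<and> s i < s j))"

text \<open>
  The types of \<^const>\<open>columnvector\<close> and \<^const>\<open>rowvector\<close> leave the inner dimension
  open; the constraint makes it one.
\<close>

definition outer_square :: "real^'d \<Rightarrow> real^'d^'d" where
  "outer_square v = (columnvector v :: real^1^'d) ** (rowvector v :: real^'d^1)"

definition cma_ranking ::
  "(real^'d \<Rightarrow> real) \<Rightarrow> nat \<Rightarrow> real^'d \<Rightarrow> real^'d^'d \<Rightarrow> (nat \<Rightarrow> real^'d) \<Rightarrow> nat \<Rightarrow> nat" where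
  "cma_ranking f lam m C u = ranking lam (\<lambda>i. f (m + mat_sqrt C *v u i))"

definition cma_mean ::
  "(real^'d \<Rightarrow> real) \<Rightarrow> nat \<Rightarrow> nat \<Rightarrow> (nat \<Rightarrow> real) \<Rightarrow>
   real^'d \<Rightarrow> real^'d^'d \<Rightarrow> (nat \<Rightarrow> real^'d) \<Rightarrow> real^'d" where
  "cma_mean f lam mu w m C u =
     (let s = cma_ranking f lam m C u
      in m + mat_sqrt C *v (\<Sum>i=1..mu. w i *\<^sub>R u (s i)))"

definition cma_cov ::
  "(real^'d \<Rightarrow> real) \<Rightarrow> nat \<Rightarrow> nat \<Rightarrow> (nat \<Rightarrow> real) \<Rightarrow> real \<Rightarrow>
   real^'d \<Rightarrow> real^'d^'d \<Rightarrow> (nat \<Rightarrow> real^'d) \<Rightarrow> real^'d^'d" where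
  "cma_cov f lam mu w c m C u =
     (let s = cma_ranking f lam m C u
      in (1 - c) *\<^sub>R C +
         c *\<^sub>R (mat_sqrt C **
                (\<Sum>i=1..mu. w i *\<^sub>R outer_square (u (s i))) **
                mat_sqrt C))"

text \<open>
  \<open>U (Suc k) 1, \<dots>, U (Suc k) lam\<close> are the samples drawn in iteration \<open>k\<close>; \<open>U 0\<close> is unused. The
  past of iteration \<open>k\<close> consists of the states up to time \<open>k\<close> and of the samples up to \<open>U k\<close>.
\<close>

locale cma_es_run = prob_space M
  for M :: "'w measure" +
  fixes f :: "real^'d \<Rightarrow> real"
    and lam mu :: nat
    and w :: "nat \<Rightarrow> real"
    and c :: real
    and m :: "nat \<Rightarrow> 'w \<Rightarrow> real^'d"
    and C :: "nat \<Rightarrow> 'w \<Rightarrow> real^'d^'d"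
    and U :: "nat \<Rightarrow> nat \<Rightarrow> 'w \<Rightarrow> real^'d"
  assumes mean_measurable: "\<And>k. m k \<in> borel_measurable M"
    and cov_measurable: "\<And>k. C k \<in> borel_measurable M"
    and init: "\<And>\<omega>. \<omega> \<in> space M \<Longrightarrow> sym_pos_def (C 0 \<omega>)"
    and sample_law: "\<And>k i. i \<in> {1..lam} \<Longrightarrow> distr M borel (U (Suc k) i) = std_gaussian"
    and sample_indep: "\<And>k. indep_vars (\<lambda>_. borel) (U (Suc k)) {1..lam}"
    and past_indep: "\<And>k. indep_set
        (sets (vimage_algebra (space M)
          (\<lambda>\<omega>. (\<lambda>j\<in>{..k}. (m j \<omega>, C j \<omega>), \<lambda>j\<in>{1..k}. \<lambda>i\<in>{1..lam}. U j i \<omega>))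
          (PiM {..k} (\<lambda>_. borel) \<Otimes>\<^sub>M PiM {1..k} (\<lambda>_. PiM {1..lam} (\<lambda>_. borel)))))
        (sets (vimage_algebra (space M)
          (\<lambda>\<omega>. \<lambda>i\<in>{1..lam}. U (Suc k) i \<omega>)
          (PiM {1..lam} (\<lambda>_. borel))))"
    and mean_step: "\<And>k \<omega>. \<omega> \<in> space M \<Longrightarrow>
        m (Suc k) \<omega> = cma_mean f lam mu w (m k \<omega>) (C k \<omega>) (\<lambda>i. U (Suc k) i \<omega>)"
    and cov_step: "\<And>k \<omega>. \<omega> \<in> space M \<Longrightarrow>
        C (Suc k) \<omega> = cma_cov f lam mu w c (m k \<omega>) (C k \<omega>) (\<lambda>i. U (Suc k) i \<omega>)"


section \<open>The normalized chain\<close>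

definition det_scale :: "real^'d^'d \<Rightarrow> real" where
  "det_scale C = det C powr (1 / real CARD('d))"

definition normalized_state ::
  "real^'d \<Rightarrow> real^'d \<Rightarrow> real^'d^'d \<Rightarrow> (real^'d) \<times> (real^'d^'d)" where
  "normalized_state xstar m C =
     ((1 / sqrt (det_scale C)) *\<^sub>R (m - xstar), (1 / det_scale C) *\<^sub>R C)"

definition normalized_space :: "((real^'d) \<times> (real^'d^'d)) set" where
  "normalized_space = UNIV \<times> {\<Sigma>. sym_pos_def \<Sigma> \<and> det \<Sigma> = 1}"

text \<open>
  The law of the normalized state after one iteration started in the state with mean
  \<open>xstar + z\<close> and covariance \<open>\<Sigma>\<close>, which is the representative of \<open>(z, \<Sigma>)\<close> of determinant one.
\<close>

definition normalized_kernel ::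
  "(real^'d \<Rightarrow> real) \<Rightarrow> real^'d \<Rightarrow> nat \<Rightarrow> nat \<Rightarrow> (nat \<Rightarrow> real) \<Rightarrow> real \<Rightarrow>
   (real^'d) \<times> (real^'d^'d) \<Rightarrow> ((real^'d) \<times> (real^'d^'d)) measure" where
  "normalized_kernel f xstar lam mu w c = (\<lambda>(z, \<Sigma>).
     distr (PiM {1..lam} (\<lambda>_. std_gaussian)) (borel_on normalized_space)
       (\<lambda>u. normalized_state xstar
              (cma_mean f lam mu w (xstar + z) \<Sigma> u)
              (cma_cov f lam mu w c (xstar + z) \<Sigma> u)))"

end

theory Submission
  imports Defs
begin

text \<open>
  In terms of the candidate solutions \<open>y\<^sub>i = m + sqrt C u\<^sub>i\<close> an iteration reads \<open>m' = \<Sum> w\<^sub>i y\<^sub>i\<close> and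
  \<open>C' = (1 - c) C + c \<Sum> w\<^sub>i (y\<^sub>i - m) (y\<^sub>i - m)\<^sup>T\<close>, and the ranking is trivial as long as the \<open>y\<^sub>i\<close> lie
  in small balls on which \<open>f\<close> is strictly ordered; such balls exist near every point because the
  level sets of \<open>f\<close> are negligible. On these balls the law of the \<open>y\<^sub>i\<close> dominates Lebesgue measure,
  locally uniformly in the state, so the kernel can be bounded below by integrals that involve no
  ranking and no square root.

  By scaling invariance, any compact set of normalized states can be replaced by states \<open>(m, C)\<close>
  with \<open>m\<close> and \<open>C\<close> as small as desired. Over two iterations in which one candidate \<open>t\<close> of the
  first iteration varies, the mean does not depend on \<open>t\<close>, and completing the square shows that the
  covariance receives \<open>\<kappa> r r\<^sup>T\<close> with \<open>r = t - t\<^sub>0\<close>. After \<open>d\<close> such double steps with \<open>r\<close> near each of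
  the basis vectors, the covariance is \<open>E + \<Sum> \<omega>\<^sub>j r\<^sub>j r\<^sub>j\<^sup>T\<close> plus terms independent of the initial state,
  where the small positive semidefinite matrix \<open>E\<close> is the only trace of the initial state. An
  explicit Lipschitz change of the \<open>r\<^sub>j\<close> absorbs \<open>E\<close>. Hence with \<open>N = 2 d + 1\<close> there is a nontrivial
  measure \<open>\<nu>\<close> such that \<open>P\<^sup>N\<close> dominates a positive multiple of \<open>\<nu>\<close> locally uniformly on the whole
  state space, and all the claims about \<open>P\<close> follow from that.
\<close>

section \<open>Lipschitz images and Lebesgue measure\<close>

text \<open>The obstacle is that one iteration is too degenerate to be bounded below on the state
  space. It changes \<open>(1 - c) C\<close> by a matrix of rank at most \<open>mu\<close>, and for
  \<open>mu = 1\<close> that matrix is \<open>c (m' - m) (m' - m)\<^sup>T\<close>, a function of the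
  new mean, so mean and covariance cannot be moved independently. Two iterations decouple them: the
  mean is decided by the second one alone, while a candidate of the first still acts on the
  covariance. The odd extra iteration comes at the start and makes the mean independent of the
  initial one. The map from the vectors \<open>r\<^sub>j\<close> to
  \<open>\<Sum> \<omega>\<^sub>j r\<^sub>j r\<^sub>j\<^sup>T\<close> has fibres of positive
  dimension if d > 1, so \<nu> is built as an image of Lebesgue measure on products of balls rather
  than from a density on symmetric matrices. Accordingly every comparison of measures is one-sided:
  a Lipschitz map expands volume by at most a constant factor, and it remains to see that its image
  is large enough. For the map from samples to candidates this follows from invertibility, for the
  absorbing map from Brouwer's theorem.\<close>

lemma lipschitz_emeasure_image_le:
  fixes g :: "'a::euclidean_space \<Rightarrow> 'a"
  assumes lip: "L-lipschitz_on S g" and L: "L > 0"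
    and S: "S \<in> sets borel" "bounded S" and T: "T \<in> sets borel" "T \<subseteq> g ` S"
  shows "emeasure lborel T \<le> ennreal ((2 * L * DIM('a)) ^ DIM('a)) * emeasure lborel S"
proof -
  define c where "c = (2 * L * DIM('a)) ^ DIM('a)"
  have c0: "c > 0" using L by (simp add: c_def)
  obtain a where a: "a > 0" "S \<subseteq> cbox (- (a *\<^sub>R One)) (a *\<^sub>R One)"
  proof -
    obtain b where b: "\<forall>x\<in>S. norm x \<le> b" using S(2) bounded_iff by blast
    have "S \<subseteq> cbox (- ((\<bar>b\<bar>+1) *\<^sub>R One)) ((\<bar>b\<bar>+1) *\<^sub>R One)"
    proof
      fix x assume "x \<in> S"
      then have "norm x \<le> \<bar>b\<bar>+1" using b by force
      then have "\<bar>x \<bullet> i\<bar> \<le> \<bar>b\<bar>+1" if "i \<in> Basis" for i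
        using Basis_le_norm[OF that, of x] by linarith
      then show "x \<in> cbox (- ((\<bar>b\<bar>+1) *\<^sub>R One)) ((\<bar>b\<bar>+1) *\<^sub>R One)"
        by (force simp: mem_box abs_le_iff)
    qed
    then show ?thesis using that[of "\<bar>b\<bar>+1"] by simp
  qed
  have Slm: "S \<in> lmeasurable"
    using S bounded_set_imp_lmeasurable by (metis sets_completionI_sets sets_lborel)
  \<comment> \<open>Cover \<open>S\<close> by dyadic cubes of total volume at most that of
    \<open>S\<close> plus \<open>e\<close>. Points of a cube of side s are at distance at most d s
    by the l1 bound, so the image of its part in \<open>S\<close> lies in a cube of side 2 L d s;
    this is where the factor \<open>(2 * L * DIM('a)) ^ DIM('a)\<close> comes from.\<close>
  have key: "emeasure lborel T \<le> ennreal c * (emeasure lborel S + ennreal e)" if e: "e > 0" for e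
  proof -
    obtain D where D: "countable D"
        "\<And>K. K \<in> D \<Longrightarrow> K \<subseteq> cbox (- (a *\<^sub>R One)) (a *\<^sub>R One) \<and> K \<noteq> {} \<and> (\<exists>c d. K = cbox c d)"
        "pairwise (\<lambda>A B. interior A \<inter> interior B = {}) D"
        "\<And>u v. cbox u v \<in> D \<Longrightarrow> \<exists>n. \<forall>i \<in> Basis. v \<bullet> i - u \<bullet> i = ((a *\<^sub>R One) \<bullet> i - (- (a *\<^sub>R One)) \<bullet> i)/2^n"
        "S \<subseteq> \<Union>D" "\<Union>D \<in> lmeasurable" "measure lebesgue (\<Union>D) \<le> measure lebesgue S + e"
      using measurable_outer_intervals_bounded[OF Slm a(2) e] by metis
    define enum where "enum = to_nat_on D"
    have inj: "inj_on enum D" using D(1) unfolding enum_def by (rule inj_on_to_nat_on)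
    define Q where "Q n = (\<Union>K\<in>{K\<in>D. enum K = n}. K)" for n
    have Q: "(\<exists>K\<in>D. Q n = K \<and> enum K = n) \<or> Q n = {}" for n
    proof (cases "\<exists>K\<in>D. enum K = n")
      case True
      then obtain K where K: "K \<in> D" "enum K = n" by blast
      then have "{K\<in>D. enum K = n} = {K}" using inj by (auto dest: inj_onD)
      then show ?thesis using K by (auto simp: Q_def)
    qed (auto simp: Q_def)
    have UQ: "(\<Union>n. Q n) = \<Union>D" by (auto simp: Q_def)
    have Qbox: "\<exists>u v. Q n = cbox u v" for n
      using Q[of n] D(2) by (metis empty_as_interval)
    have Qs[measurable]: "Q n \<in> sets borel" for n using Qbox[of n] by auto
    have intQ: "emeasure lborel (interior (Q n)) = emeasure lborel (Q n)" for n
      using Qbox[of n] by (auto simp: interior_cbox emeasure_lborel_box_eq emeasure_lborel_cbox_eq)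
    have disj: "disjoint_family (\<lambda>n. interior (Q n))"
      unfolding disjoint_family_on_def
    proof (intro ballI impI)
      fix m n :: nat assume "m \<noteq> n"
      show "interior (Q m) \<inter> interior (Q n) = {}"
      proof (cases "Q m = {} \<or> Q n = {}")
        case False
        then obtain A B where AB: "A \<in> D" "Q m = A" "enum A = m" "B \<in> D" "Q n = B" "enum B = n"
          using Q[of m] Q[of n] by blast
        then have "A \<noteq> B" using \<open>m \<noteq> n\<close> by auto
        then show ?thesis using pairwiseD[OF D(3) AB(1,4)] AB by simp
      qed auto
    qed
    have sumQ: "(\<Sum>n. emeasure lborel (Q n)) \<le> emeasure lborel (\<Union>D)"
    proof -
      have "(\<Sum>n. emeasure lborel (Q n)) = (\<Sum>n. emeasure lborel (interior (Q n)))" by (simp add: intQ)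
      also have "\<dots> = emeasure lborel (\<Union>n. interior (Q n))"
        using disj by (intro suminf_emeasure) auto
      also have "\<dots> \<le> emeasure lborel (\<Union>n. Q n)"
        by (intro emeasure_mono) (use interior_subset in fastforce)+
      finally show ?thesis by (simp add: UQ)
    qed
    have UDb: "\<Union>D \<in> sets borel" unfolding UQ[symmetric] by measurable
    have "emeasure lborel (\<Union>D) \<le> emeasure lborel S + ennreal e"
    proof -
      have "emeasure lborel (\<Union>D) = emeasure lebesgue (\<Union>D)" using UDb by simp
      also have "\<dots> = ennreal (measure lebesgue (\<Union>D))" using D(6) by (simp add: emeasure_eq_measure2)
      also have "\<dots> \<le> ennreal (measure lebesgue S + e)" using D(7) by (simp add: ennreal_leI)
      also have "\<dots> = emeasure lebesgue S + ennreal e"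
        using Slm e by (simp add: emeasure_eq_measure2)
      finally show ?thesis using S(1) by simp
    qed
    note sumQ2 = order_trans[OF sumQ this]
    have "\<exists>B. B \<in> sets borel \<and> g ` (Q n \<inter> S) \<subseteq> B \<and> emeasure lborel B \<le> ennreal c * emeasure lborel (Q n)" for n
    proof (cases "Q n \<inter> S = {}")
      case True then show ?thesis by (intro exI[of _ "{}"]) auto
    next
      case False
      then obtain x where x: "x \<in> Q n" "x \<in> S" by auto
      then obtain K where K: "K \<in> D" "Q n = K" using Q[of n] by auto
      then obtain u v where uv: "K = cbox u v" using D(2) by blast
      then obtain k where k: "\<forall>i \<in> Basis. v \<bullet> i - u \<bullet> i = ((a *\<^sub>R One) \<bullet> i - (- (a *\<^sub>R One)) \<bullet> i)/2^k"
        using D(4) K by blast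
      define s where "s = 2 * a / 2^k"
      have s: "s > 0" using a by (simp add: s_def)
      have vs: "v \<bullet> i - u \<bullet> i = s" if "i \<in> Basis" for i
        using k that by (simp add: s_def)
      define r where "r = L * (DIM('a) * s)"
      have r: "r > 0" using L s by (simp add: r_def)
      define B where "B = cbox (g x - r *\<^sub>R One) (g x + r *\<^sub>R One)"
      have "g ` (Q n \<inter> S) \<subseteq> B"
      proof
        fix z assume "z \<in> g ` (Q n \<inter> S)"
        then obtain y where y: "y \<in> Q n" "y \<in> S" "z = g y" by auto
        have "norm (y - x) \<le> (\<Sum>i\<in>Basis. \<bar>(y - x) \<bullet> i\<bar>)" by (rule norm_le_l1)
        also have "\<dots> \<le> (\<Sum>i\<in>(Basis::'a set). s)"
        proof (rule sum_mono)
          fix i :: 'a assume i: "i \<in> Basis"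
          have "u \<bullet> i \<le> x \<bullet> i" "x \<bullet> i \<le> v \<bullet> i" "u \<bullet> i \<le> y \<bullet> i" "y \<bullet> i \<le> v \<bullet> i"
            using x y K uv i by (auto simp: mem_box)
          then show "\<bar>(y - x) \<bullet> i\<bar> \<le> s" using vs[OF i] by (simp add: inner_diff_left)
        qed
        also have "\<dots> = DIM('a) * s" by simp
        finally have nxy: "norm (y - x) \<le> DIM('a) * s" .
        have "norm (g y - g x) \<le> L * norm (y - x)"
          using lipschitz_on_normD[OF lip] x y by blast
        also have "\<dots> \<le> r" unfolding r_def using nxy L by (intro mult_left_mono) auto
        finally have "\<bar>(g y - g x) \<bullet> i\<bar> \<le> r" if "i \<in> Basis" for i
          using Basis_le_norm[OF that, of "g y - g x"] by linarith
        then have "\<bar>g y \<bullet> i - g x \<bullet> i\<bar> \<le> r" if "i \<in> Basis" for i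
          using that by (simp add: inner_diff_left)
        then show "z \<in> B" using y by (force simp: B_def mem_box inner_diff_left inner_add_left abs_le_iff)
      qed
      moreover have "emeasure lborel B = ennreal ((2 * r) ^ DIM('a))"
      proof -
        have "emeasure lborel B = ennreal (\<Prod>i\<in>Basis. ((g x + r *\<^sub>R One) - (g x - r *\<^sub>R One)) \<bullet> i)"
          unfolding B_def using r by (subst emeasure_lborel_cbox) (auto simp: inner_diff_left inner_add_left)
        also have "(\<Prod>i\<in>Basis. ((g x + r *\<^sub>R One) - (g x - r *\<^sub>R One)) \<bullet> i) = (\<Prod>i\<in>(Basis::'a set). 2 * r)"
          by (intro prod.cong) (auto simp: inner_diff_left inner_add_left)
        finally show ?thesis by simp
      qed
      moreover have "emeasure lborel (Q n) = ennreal (s ^ DIM('a))"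
      proof -
        have "u \<bullet> b \<le> v \<bullet> b" if "b \<in> Basis" for b using vs[OF that] s by linarith
        then have "emeasure lborel (Q n) = ennreal (\<Prod>i\<in>Basis. (v - u) \<bullet> i)"
          unfolding K uv by (subst emeasure_lborel_cbox) (auto simp: inner_diff_left)
        also have "(\<Prod>i\<in>Basis. (v - u) \<bullet> i) = (\<Prod>i\<in>(Basis::'a set). s)"
          by (intro prod.cong) (auto simp: inner_diff_left vs)
        finally show ?thesis by simp
      qed
      moreover have "(2 * r) ^ DIM('a) = c * s ^ DIM('a)"
        by (simp add: r_def c_def power_mult_distrib mult.assoc)
      ultimately have "emeasure lborel B \<le> ennreal c * emeasure lborel (Q n)"
        using c0 s by (simp add: ennreal_mult)
      with \<open>g ` (Q n \<inter> S) \<subseteq> B\<close> show ?thesis by (intro exI[of _ B]) (auto simp: B_def)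
    qed
    then obtain B where B: "\<And>n. B n \<in> sets borel" "\<And>n. g ` (Q n \<inter> S) \<subseteq> B n"
      "\<And>n. emeasure lborel (B n) \<le> ennreal c * emeasure lborel (Q n)" by metis
    have "T \<subseteq> (\<Union>n. B n)"
    proof
      fix t assume "t \<in> T"
      then obtain x where "x \<in> S" "t = g x" using T by auto
      moreover then obtain n where "x \<in> Q n" using D(5) UQ by blast
      ultimately show "t \<in> (\<Union>n. B n)" using B(2)[of n] by auto
    qed
    then have "emeasure lborel T \<le> emeasure lborel (\<Union>n. B n)"
      using B(1) by (intro emeasure_mono) auto
    also have "\<dots> \<le> (\<Sum>n. emeasure lborel (B n))"
      using B(1) by (intro emeasure_subadditive_countably) auto
    also have "\<dots> \<le> (\<Sum>n. ennreal c * emeasure lborel (Q n))"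
      using B(3) by (intro suminf_le) auto
    also have "\<dots> = ennreal c * (\<Sum>n. emeasure lborel (Q n))" by simp
    also have "\<dots> \<le> ennreal c * (emeasure lborel S + ennreal e)"
      using sumQ2 by (intro mult_left_mono) auto
    finally show ?thesis .
  qed
  have "emeasure lborel T \<le> ennreal c * emeasure lborel S"
  proof (rule ennreal_le_epsilon)
    fix e :: real assume e: "e > 0"
    have "emeasure lborel T \<le> ennreal c * (emeasure lborel S + ennreal (e / c))"
      using key[of "e/c"] e c0 by simp
    also have "\<dots> = ennreal c * emeasure lborel S + ennreal e"
      using c0 e by (simp add: distrib_left ennreal_mult[symmetric])
    finally show "emeasure lborel T \<le> ennreal c * emeasure lborel S + ennreal e" .
  qed
  then show ?thesis by (simp add: c_def)
qed

text \<open>Applied to preimages, the volume bound says that Lebesgue measure on \<open>S\<close> is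
  at most a constant times the image under \<open>g\<close> of Lebesgue measure on
  \<open>S'\<close>; \<open>h\<close> is then integrated against both. Since \<open>g\<close> is
  controlled only on \<open>S'\<close>, its image measure is taken from the restricted
  space.\<close>

lemma nn_integral_lipschitz_image_le:
  fixes g :: "'a::euclidean_space \<Rightarrow> 'a"
  assumes lip: "L-lipschitz_on S' g" and L: "L > 0"
    and S': "S' \<in> sets borel" "bounded S'" and S: "S \<in> sets borel" "S \<subseteq> g ` S'"
    and h[measurable]: "h \<in> borel_measurable borel"
  shows "(\<integral>\<^sup>+y. h y * indicator S y \<partial>lborel)
    \<le> ennreal ((2 * L * DIM('a)) ^ DIM('a)) * (\<integral>\<^sup>+u. h (g u) * indicator S' u \<partial>lborel)"
proof -
  define c where "c = ennreal ((2 * L * DIM('a)) ^ DIM('a))"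
  have cont: "continuous_on S' g" using lip lipschitz_on_continuous_on by blast
  have gm: "g \<in> restrict_space borel S' \<rightarrow>\<^sub>M borel"
    using cont borel_measurable_continuous_on_restrict by blast
  define N where "N = distr (restrict_space lborel S') borel g"
  have gm': "g \<in> restrict_space lborel S' \<rightarrow>\<^sub>M borel"
    using gm by (simp cong: measurable_cong_sets)
  define N1 where "N1 = density lborel (indicator S :: 'a \<Rightarrow> ennreal)"
  have le: "N1 \<le> scale_measure c N"
  proof -
    have "\<forall>A. emeasure N1 A \<le> emeasure (scale_measure c N) A"
    proof
      fix A show "emeasure N1 A \<le> emeasure (scale_measure c N) A"
      proof (cases "A \<in> sets borel")
        case False then show ?thesis by (simp add: N1_def emeasure_notin_sets)
      next
        case True
        have "emeasure N1 A = (\<integral>\<^sup>+x. indicator S x * indicator A x \<partial>lborel)"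
          unfolding N1_def using S True by (subst emeasure_density) auto
        also have "\<dots> = (\<integral>\<^sup>+x. indicator (S \<inter> A) x \<partial>lborel)"
          by (intro nn_integral_cong) (auto split: split_indicator)
        also have "\<dots> = emeasure lborel (S \<inter> A)" using S True by (intro nn_integral_indicator) simp
        also have "\<dots> \<le> c * emeasure lborel (g -` A \<inter> S')"
          unfolding c_def
        proof (rule lipschitz_emeasure_image_le)
          show "L-lipschitz_on (g -` A \<inter> S') g" using lip by (rule lipschitz_on_subset) auto
          have "g -` A \<inter> space (restrict_space borel S') \<in> sets (restrict_space borel S')"
            using gm True by (rule measurable_sets)
          then show "g -` A \<inter> S' \<in> sets borel"
            using S' by (auto simp: sets_restrict_space space_restrict_space)
          show "bounded (g -` A \<inter> S')" using S' bounded_subset by blast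
        qed (use L S True in auto)
        also have "\<dots> = c * emeasure N A"
          unfolding N_def using True gm' S'
          by (simp add: emeasure_distr emeasure_restrict_space space_restrict_space)
        finally show ?thesis by simp
      qed
    qed
    then show ?thesis by (subst le_measure) (auto simp: N1_def N_def)
  qed
  have "(\<integral>\<^sup>+y. h y * indicator S y \<partial>lborel) = (\<integral>\<^sup>+y. h y \<partial>N1)"
    unfolding N1_def using S by (simp add: nn_integral_density mult.commute)
  also have "\<dots> \<le> (\<integral>\<^sup>+y. h y \<partial>scale_measure c N)"
    by (rule nn_integral_mono_measure) (use le in \<open>auto simp: N1_def N_def\<close>)
  also have "\<dots> = c * (\<integral>\<^sup>+y. h y \<partial>N)" by (simp add: nn_integral_scale_measure N_def)
  also have "(\<integral>\<^sup>+y. h y \<partial>N) = (\<integral>\<^sup>+u. h (g u) * indicator S' u \<partial>lborel)"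
    unfolding N_def using S' gm' by (simp add: nn_integral_distr nn_integral_restrict_space)
  finally show ?thesis by (simp add: c_def)
qed

section \<open>Square roots of positive definite matrices\<close>

text \<open>Cauchy-Schwarz in each row: the norm of the matrix type is the Frobenius norm, which
  dominates the operator norm.\<close>

lemma norm_matrix_vector_mult_le: "norm (A *v x) \<le> norm A * norm (x :: real^'n)"
  for A :: "real^'n^'m"
proof -
  have "norm (A *v x) = L2_set (\<lambda>i. norm (A $ i \<bullet> x)) UNIV"
    by (simp add: norm_vec_def matrix_vector_mul_component)
  also have "\<dots> \<le> L2_set (\<lambda>i. norm (A $ i) * norm x) UNIV"
    by (intro L2_set_mono) (auto simp: Cauchy_Schwarz_ineq2)
  also have "\<dots> = norm A * norm x"
    by (subst L2_set_left_distrib[symmetric]) (auto simp: norm_vec_def)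
  finally show ?thesis .
qed

lemma outer_square_component: "outer_square v $ i $ j = v $ i * v $ j"
  by (simp add: outer_square_def columnvector_def rowvector_def matrix_matrix_mult_def)

lemma outer_square_mult: "outer_square v *v x = (v \<bullet> x) *\<^sub>R v"
  by (simp add: vec_eq_iff matrix_vector_mult_def outer_square_component inner_vec_def
      sum_distrib_left sum_distrib_right mult_ac)

lemma transpose_outer_square: "transpose (outer_square v) = outer_square v"
  by (simp add: vec_eq_iff transpose_def outer_square_component)

lemma outer_square_scaleR: "outer_square (a *\<^sub>R v) = a\<^sup>2 *\<^sub>R outer_square v"
  by (simp add: vec_eq_iff outer_square_component power2_eq_square)

lemma symmetric_entry:
  assumes "transpose S = S"
  shows "S $ j $ i = S $ i $ j"
proof -
  have "transpose S $ i $ j = S $ j $ i" by (simp add: transpose_def)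
  then show ?thesis by (simp add: assms)
qed

lemma matrix_sandwich_outer_square:
  assumes "transpose S = S"
  shows "S ** outer_square v ** S = outer_square (S *v v)"
proof -
  have S: "S $ j $ i = S $ i $ j" for i j
    using assms by (rule symmetric_entry)
  show ?thesis
    by (simp add: vec_eq_iff matrix_matrix_mult_def outer_square_component matrix_vector_mult_def
        sum_product sum_distrib_right sum_distrib_left S mult_ac)
qed

lemma norm_outer_square: "norm (outer_square v) = (norm v)\<^sup>2"
proof -
  have "outer_square v $ i = v $ i *\<^sub>R v" for i
    by (simp add: vec_eq_iff outer_square_component)
  then have "norm (outer_square v) = L2_set (\<lambda>i. norm (v $ i) * norm v) UNIV"
    by (simp add: norm_vec_def[of "outer_square v"])
  also have "\<dots> = norm v * norm v"
    by (subst L2_set_left_distrib[symmetric]) (auto simp: norm_vec_def)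
  finally show ?thesis by (simp add: power2_eq_square)
qed

lemma continuous_outer_square: "continuous_on UNIV (outer_square :: real^'d \<Rightarrow> real^'d^'d)"
proof (rule continuous_on_eq)
  show "continuous_on UNIV (\<lambda>v::real^'d. (\<chi> i j. v $ i * v $ j)::real^'d^'d)"
    by (intro continuous_intros)
qed (simp add: vec_eq_iff outer_square_component)

definition pos_semidef :: "real^'d^'d \<Rightarrow> bool" where
  "pos_semidef A \<longleftrightarrow> transpose A = A \<and> (\<forall>x. 0 \<le> x \<bullet> (A *v x))"

lemma transpose_add: "transpose (A + B) = transpose A + transpose (B::'a::ab_group_add^'n^'m)"
  by (simp add: vec_eq_iff transpose_def)

lemma transpose_scaleR: "transpose (c *\<^sub>R A) = c *\<^sub>R transpose (A::real^'n^'m)"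
  by (simp add: vec_eq_iff transpose_def)

lemma pos_semidef_add: "pos_semidef A \<Longrightarrow> pos_semidef B \<Longrightarrow> pos_semidef (A + B)"
  by (auto simp: pos_semidef_def transpose_add matrix_vector_mult_add_rdistrib inner_add_right)

lemma pos_semidef_scaleR: "pos_semidef A \<Longrightarrow> c \<ge> 0 \<Longrightarrow> pos_semidef (c *\<^sub>R A)"
  by (auto simp: pos_semidef_def transpose_scaleR scaleR_matrix_vector_assoc[symmetric])

lemma pos_semidef_0: "pos_semidef 0"
  by (auto simp: pos_semidef_def transpose_def vec_eq_iff)

lemma pos_semidef_sum: "(\<And>i. i \<in> I \<Longrightarrow> pos_semidef (A i)) \<Longrightarrow> pos_semidef (sum A I)"
  by (induction I rule: infinite_finite_induct) (auto intro: pos_semidef_add simp: pos_semidef_0)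

lemma pos_semidef_outer_square: "pos_semidef (outer_square v)"
  by (auto simp: pos_semidef_def transpose_outer_square outer_square_mult inner_commute)

lemma sym_pos_def_imp_pos_semidef: "sym_pos_def A \<Longrightarrow> pos_semidef A"
  unfolding sym_pos_def_def pos_semidef_def by (metis inner_zero_left less_eq_real_def)

lemma sym_pos_def_add: "sym_pos_def A \<Longrightarrow> pos_semidef B \<Longrightarrow> sym_pos_def (A + B)"
  by (auto simp: sym_pos_def_def pos_semidef_def transpose_add matrix_vector_mult_add_rdistrib
      inner_add_right add_pos_nonneg)

lemma sym_pos_def_scaleR: "sym_pos_def A \<Longrightarrow> c > 0 \<Longrightarrow> sym_pos_def (c *\<^sub>R A)"
  by (auto simp: sym_pos_def_def transpose_scaleR scaleR_matrix_vector_assoc[symmetric])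

lemma inner_transpose: "transpose A \<bullet> transpose B = A \<bullet> (B::real^'n^'m)"
  by (simp add: inner_vec_def transpose_def) (rule sum.swap)

lemma inner_mult_right_symmetric:
  fixes D S :: "real^'d^'d"
  assumes "transpose S = S"
  shows "D \<bullet> (D ** S) = (\<Sum>i\<in>UNIV. D $ i \<bullet> (S *v (D $ i)))"
proof -
  have S: "S $ j $ i = S $ i $ j" for i j
    using assms by (rule symmetric_entry)
  have "(D ** S) $ i = S *v (D $ i)" for i
    by (simp add: vec_eq_iff matrix_matrix_mult_def matrix_vector_mult_def S mult.commute)
  then show ?thesis by (simp add: inner_vec_def[of D])
qed

lemma matrix_self_inner: "norm (D::real^'d^'d) ^ 2 = (\<Sum>i\<in>UNIV. (norm (D $ i))\<^sup>2)"
  by (simp add: power2_norm_eq_inner inner_vec_def[of D])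

text \<open>With \<open>D = S - T\<close>, the trace of \<open>D (S\<^sup>2 - T\<^sup>2) = D S D + D D T\<close> controls \<open>D\<close>.\<close>

lemma norm_diff_le_norm_diff_squares:
  fixes S T :: "real^'d^'d"
  assumes S: "transpose S = S" "\<And>x. l * (norm x)\<^sup>2 \<le> x \<bullet> (S *v x)" and l: "l > 0"
    and T: "pos_semidef T"
  shows "l * norm (S - T) \<le> norm (S ** S - T ** T)"
proof -
  define D where "D = S - T"
  have Tt: "transpose T = T" using T by (simp add: pos_semidef_def)
  have Dt: "transpose D = D"
    using S Tt by (simp add: D_def transpose_def vec_eq_iff)
  have eq: "S ** S - T ** T = S ** D + D ** T"
    by (simp add: D_def vec_eq_iff matrix_matrix_mult_def sum.distrib[symmetric] sum_subtractf[symmetric] algebra_simps)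
  have "transpose (S ** D) = D ** S" by (simp add: matrix_transpose_mul Dt S)
  then have 1: "D \<bullet> (S ** D) = D \<bullet> (D ** S)"
    using inner_transpose[of D "S ** D"] Dt by simp
  have "l * (norm D)\<^sup>2 \<le> D \<bullet> (D ** S)"
    unfolding inner_mult_right_symmetric[OF S(1)] matrix_self_inner sum_distrib_left
    by (intro sum_mono S(2))
  moreover have "0 \<le> D \<bullet> (D ** T)"
    unfolding inner_mult_right_symmetric[OF Tt] using T by (auto intro!: sum_nonneg simp: pos_semidef_def)
  ultimately have "l * (norm D)\<^sup>2 \<le> D \<bullet> (S ** S - T ** T)"
    unfolding eq by (simp add: inner_add_right 1)
  also have "\<dots> \<le> norm D * norm (S ** S - T ** T)" by (rule norm_cauchy_schwarz)
  finally have "norm D * (l * norm D) \<le> norm D * norm (S ** S - T ** T)"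
    by (simp add: power2_eq_square mult_ac)
  then show ?thesis
    by (cases "D = 0") (auto simp: D_def)
qed

lemma pos_def_coercive:
  fixes A :: "real^'d^'d"
  assumes "\<And>x. x \<noteq> 0 \<Longrightarrow> 0 < x \<bullet> (A *v x)"
  obtains a where "a > 0" "\<And>x. a * (norm x)\<^sup>2 \<le> x \<bullet> (A *v x)"
proof -
  have "compact (sphere (0::real^'d) 1)" by simp
  moreover have "sphere (0::real^'d) 1 \<noteq> {}" by simp
  moreover have "continuous_on (sphere 0 1) (\<lambda>x. x \<bullet> (A *v x))"
    by (intro continuous_intros)
  ultimately obtain y where y: "y \<in> sphere 0 1" "\<forall>x\<in>sphere 0 1. y \<bullet> (A *v y) \<le> x \<bullet> (A *v x)"
    using continuous_attains_inf by blast
  show ?thesis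
  proof
    show "0 < y \<bullet> (A *v y)" using y by (intro assms) auto
    fix x :: "real^'d"
    show "y \<bullet> (A *v y) * (norm x)\<^sup>2 \<le> x \<bullet> (A *v x)"
    proof (cases "x = 0")
      case False
      define u where "u = (1 / norm x) *\<^sub>R x"
      have "u \<in> sphere 0 1" using False by (simp add: u_def)
      then have "y \<bullet> (A *v y) \<le> u \<bullet> (A *v u)" using y by blast
      then have "y \<bullet> (A *v y) * (norm x)\<^sup>2 \<le> (u \<bullet> (A *v u)) * (norm x)\<^sup>2"
        by (intro mult_right_mono) auto
      also have "\<dots> = x \<bullet> (A *v x)"
        using False by (simp add: u_def matrix_vector_mult_scaleR field_simps power2_eq_square)
      finally show ?thesis .
    qed simp
  qed
qed

lemma quadratic_form_norm_le: "\<bar>x \<bullet> (A *v x)\<bar> \<le> norm A * (norm (x::real^'d))\<^sup>2"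
proof -
  have "\<bar>x \<bullet> (A *v x)\<bar> \<le> norm x * norm (A *v x)" by (rule Cauchy_Schwarz_ineq2)
  also have "\<dots> \<le> norm x * (norm A * norm x)"
    by (intro mult_left_mono norm_matrix_vector_mult_le) auto
  finally show ?thesis by (simp add: power2_eq_square mult_ac)
qed

text \<open>Square roots of \<open>C\<close> are the fixed points of \<open>\<Phi>\<close>, a
  relaxed correction by the defect \<open>C - S ** S\<close>. On the compact convex set
  \<open>Z\<close> of symmetric matrices between 0 and \<open>b\<close> the correction is small
  enough to stay in \<open>Z\<close>, so Brouwer's theorem gives a root.\<close>

lemma pos_semidef_sqrt_exists:
  fixes C :: "real^'d^'d"
  assumes C: "pos_semidef C"
  shows "\<exists>S. pos_semidef S \<and> S ** S = C"
proof -
  \<comment> \<open>\<open>b\<^sup>2\<close> has to dominate the quadratic form of \<open>C\<close>,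
    and \<open>b\<close> has to be positive even for \<open>C = 0\<close>.\<close>
  define b where "b = sqrt (norm C) + 1"
  have b: "b > 0" "norm C \<le> b\<^sup>2"
    by (auto simp: b_def power2_eq_square algebra_simps add_pos_nonneg intro: add_nonneg_pos)
  define Z where "Z = {S::real^'d^'d. transpose S = S \<and> (\<forall>x. 0 \<le> x \<bullet> (S *v x) \<and> x \<bullet> (S *v x) \<le> b * (norm x)\<^sup>2)}"
  define \<Phi> where "\<Phi> S = S + (1 / (2 * b)) *\<^sub>R (C - S ** S)" for S
  have comp: "S $ i $ j = axis i 1 \<bullet> (S *v axis j 1)" for S :: "real^'d^'d" and i j
    by (simp add: inner_axis' matrix_vector_mul_component inner_axis)
  have "convex Z"
  proof (rule convexI)
    fix S T :: "real^'d^'d" and u v :: real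
    assume "S \<in> Z" "T \<in> Z" and uv: "0 \<le> u" "0 \<le> v" "u + v = 1"
    then have S: "transpose S = S" "\<And>x. 0 \<le> x \<bullet> (S *v x)" "\<And>x. x \<bullet> (S *v x) \<le> b * (norm x)\<^sup>2"
      and T: "transpose T = T" "\<And>x. 0 \<le> x \<bullet> (T *v x)" "\<And>x. x \<bullet> (T *v x) \<le> b * (norm x)\<^sup>2"
      by (auto simp: Z_def)
    have "x \<bullet> ((u *\<^sub>R S + v *\<^sub>R T) *v x) = u * (x \<bullet> (S *v x)) + v * (x \<bullet> (T *v x))" for x
      by (simp add: matrix_vector_mult_add_rdistrib scaleR_matrix_vector_assoc[symmetric] inner_add_right)
    moreover have "u * (x \<bullet> (S *v x)) + v * (x \<bullet> (T *v x)) \<le> b * (norm x)\<^sup>2" for x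
      using convex_bound_le[OF S(3) T(3) uv] by simp
    ultimately show "u *\<^sub>R S + v *\<^sub>R T \<in> Z"
      using S T uv by (auto simp: Z_def transpose_add transpose_scaleR)
  qed
  moreover have "compact Z"
  proof -
    have "closed Z"
    proof -
      have "Z = {S. transpose S = S} \<inter> (\<Inter>x. {S. 0 \<le> x \<bullet> (S *v x)} \<inter> {S. x \<bullet> (S *v x) \<le> b * (norm x)\<^sup>2})"
        by (auto simp: Z_def)
      moreover have "continuous_on UNIV (\<lambda>S::real^'d^'d. x \<bullet> (S *v x))" for x
        unfolding matrix_vector_mult_def inner_vec_def by (intro continuous_intros)
      moreover have "continuous_on UNIV (transpose :: real^'d^'d \<Rightarrow> real^'d^'d)"
        unfolding transpose_def by (intro continuous_intros)
      ultimately show ?thesis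
        by (auto intro!: closed_Int closed_INT closed_Collect_eq closed_Collect_le continuous_on_const continuous_on_id)
    qed
    \<comment> \<open>Polarization: the form at \<open>x + y\<close> controls the off-diagonal
      entries.\<close>
    moreover have "bounded Z"
    proof (rule boundedI)
      fix S assume S: "S \<in> Z"
      have "\<bar>S $ i $ j\<bar> \<le> 3 * b" for i j
      proof -
        define x y :: "real^'d" where "x = axis i 1" and "y = axis j 1"
        have nx: "norm x = 1" "norm y = 1" by (auto simp: x_def y_def)
        have sym: "y \<bullet> (S *v x) = x \<bullet> (S *v y)"
        proof -
          have "transpose S = S" using S by (simp add: Z_def)
          then have "S $ j $ i = S $ i $ j" by (rule symmetric_entry)
          then show ?thesis unfolding x_def y_def comp .
        qed
        have e: "(x + y) \<bullet> (S *v (x + y)) = x \<bullet> (S *v x) + 2 * (x \<bullet> (S *v y)) + y \<bullet> (S *v y)"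
          by (simp add: matrix_vector_right_distrib inner_add_left inner_add_right sym)
        have "norm (x + y) \<le> 2" using norm_triangle_ineq[of x y] nx by simp
        then have n4: "(norm (x + y))\<^sup>2 \<le> 4" using power_mono[of "norm (x+y)" 2 2] by simp
        have "(x + y) \<bullet> (S *v (x + y)) \<le> b * 4"
        proof -
          have "(x + y) \<bullet> (S *v (x + y)) \<le> b * (norm (x + y))\<^sup>2" using S unfolding Z_def by blast
          also have "\<dots> \<le> b * 4" using n4 b by (intro mult_left_mono) auto
          finally show ?thesis .
        qed
        moreover have "x \<bullet> (S *v x) \<le> b * (norm x)\<^sup>2" "y \<bullet> (S *v y) \<le> b * (norm y)\<^sup>2"
          "0 \<le> x \<bullet> (S *v x)" "0 \<le> y \<bullet> (S *v y)" "0 \<le> (x + y) \<bullet> (S *v (x + y))"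
          using S unfolding Z_def by blast+
        ultimately have "\<bar>x \<bullet> (S *v y)\<bar> \<le> 3 * b" unfolding e nx using b by simp
        then show ?thesis unfolding x_def y_def comp .
      qed
      note ent = this
      have "norm S \<le> (\<Sum>i\<in>UNIV. norm (S $ i))" by (simp add: norm_vec_def L2_set_le_sum)
      also have "\<dots> \<le> (\<Sum>i\<in>UNIV. \<Sum>j\<in>UNIV. \<bar>S $ i $ j\<bar>)" by (intro sum_mono norm_le_l1_cart)
      also have "\<dots> \<le> (\<Sum>i\<in>(UNIV::'d set). \<Sum>j\<in>(UNIV::'d set). 3 * b)" by (intro sum_mono ent)
      finally show "norm S \<le> (\<Sum>i\<in>(UNIV::'d set). \<Sum>j\<in>(UNIV::'d set). 3 * b)" .
    qed
    ultimately show ?thesis by (simp add: compact_eq_bounded_closed)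
  qed
  moreover have "Z \<noteq> {}"
  proof -
    have "0 \<in> Z" using b by (auto simp: Z_def transpose_def vec_eq_iff)
    then show ?thesis by blast
  qed
  moreover have "continuous_on Z \<Phi>"
    unfolding \<Phi>_def matrix_matrix_mult_def by (intro continuous_intros) (use b in auto)
  moreover have "\<Phi> \<in> Z \<rightarrow> Z"
  proof
    fix S assume "S \<in> Z"
    then have S: "transpose S = S" "\<And>x. 0 \<le> x \<bullet> (S *v x)" "\<And>x. x \<bullet> (S *v x) \<le> b * (norm x)\<^sup>2"
      by (auto simp: Z_def)
    have adj: "x \<bullet> (S *v y) = (S *v x) \<bullet> y" for x y
      using S(1) by (metis dot_lmul_matrix vector_transpose_matrix)
    have SS: "x \<bullet> ((S ** S) *v x) = (norm (S *v x))\<^sup>2" for x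
      by (simp add: matrix_vector_mul_assoc[symmetric] adj power2_norm_eq_inner)
    have form: "x \<bullet> (\<Phi> S *v x) = x \<bullet> (S *v x) + (1 / (2*b)) * (x \<bullet> (C *v x) - (norm (S *v x))\<^sup>2)" for x
      unfolding \<Phi>_def
      by (simp only: matrix_vector_mult_add_rdistrib scaleR_matrix_vector_assoc[symmetric]
          matrix_vector_mult_diff_rdistrib inner_add_right inner_scaleR_right inner_diff_right SS)
    \<comment> \<open>In operator terms, \<open>2 b S - S\<^sup>2 \<le> b\<^sup>2\<close> because
      the difference is the square of \<open>b - S\<close>.\<close>
    have up: "x \<bullet> (\<Phi> S *v x) \<le> b * (norm x)\<^sup>2" for x
    proof -
      have "0 \<le> (norm (S *v x - b *\<^sub>R x))\<^sup>2" by simp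
      also have "\<dots> = (norm (S *v x))\<^sup>2 - 2 * b * (x \<bullet> (S *v x)) + b\<^sup>2 * (norm x)\<^sup>2"
        by (simp only: power2_norm_eq_inner)
          (simp add: inner_diff_left inner_diff_right inner_commute[of "S *v x" x] power2_eq_square algebra_simps
            del: dot_square_norm)
      finally have 1: "2 * b * (x \<bullet> (S *v x)) - (norm (S *v x))\<^sup>2 \<le> b\<^sup>2 * (norm x)\<^sup>2" by simp
      have "x \<bullet> (C *v x) \<le> norm C * (norm x)\<^sup>2" using quadratic_form_norm_le[of x C] by linarith
      also have "\<dots> \<le> b\<^sup>2 * (norm x)\<^sup>2" using b by (intro mult_right_mono) auto
      finally have "2 * b * (x \<bullet> (S *v x)) - (norm (S *v x))\<^sup>2 + x \<bullet> (C *v x) \<le> 2 * b * (b * (norm x)\<^sup>2)"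
        using 1 by (simp add: power2_eq_square)
      moreover have "2 * b * (x \<bullet> (\<Phi> S *v x)) = 2 * b * (x \<bullet> (S *v x)) - (norm (S *v x))\<^sup>2 + x \<bullet> (C *v x)"
        unfolding form using b by (simp add: field_simps)
      ultimately have "2 * b * (x \<bullet> (\<Phi> S *v x)) \<le> 2 * b * (b * (norm x)\<^sup>2)" by simp
      then show ?thesis using b by simp
    qed
    \<comment> \<open>The point is \<open>S\<^sup>2 \<le> b S\<close> for 0 \<le> S \<le> b,
      obtained by evaluating the form of \<open>S\<close> at \<open>x - S x / b\<close>; then
      \<open>2 b S - S\<^sup>2\<close> is nonnegative.\<close>
    have lo: "0 \<le> x \<bullet> (\<Phi> S *v x)" for x
    proof -
      define s where "s = S *v x"
      have "0 \<le> (x - (1/b) *\<^sub>R s) \<bullet> (S *v (x - (1/b) *\<^sub>R s))" by (rule S)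
      also have "\<dots> = x \<bullet> s - 2 / b * (norm s)\<^sup>2 + (1/b)\<^sup>2 * (s \<bullet> (S *v s))"
      proof -
        have "x \<bullet> (S *v s) = s \<bullet> s" using adj[of x s] by (simp add: s_def)
        moreover have "S *v (x - (1/b) *\<^sub>R s) = s - (1/b) *\<^sub>R (S *v s)"
          by (simp add: s_def matrix_vector_mult_diff_distrib matrix_vector_mult_scaleR)
        ultimately show ?thesis
          by (simp only: power2_norm_eq_inner inner_diff_left inner_diff_right inner_scaleR_left inner_scaleR_right)
            (simp add: power2_eq_square algebra_simps del: dot_square_norm)
      qed
      also have "\<dots> \<le> x \<bullet> s - 2 / b * (norm s)\<^sup>2 + (1/b)\<^sup>2 * (b * (norm s)\<^sup>2)"
        by (intro add_left_mono mult_left_mono S) auto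
      also have "\<dots> = x \<bullet> s - (norm s)\<^sup>2 / b" using b by (simp add: power2_eq_square field_simps)
      finally have "(norm s)\<^sup>2 \<le> b * (x \<bullet> s)" using b by (simp add: field_simps)
      moreover have "0 \<le> x \<bullet> (C *v x)" using C by (auto simp: pos_semidef_def)
      moreover have "0 \<le> x \<bullet> s" unfolding s_def by (rule S)
      then have "0 \<le> b * (x \<bullet> s)" using b by simp
      moreover have "2 * b * (x \<bullet> (\<Phi> S *v x)) = 2 * b * (x \<bullet> s) - (norm s)\<^sup>2 + x \<bullet> (C *v x)"
        unfolding form s_def using b by (simp add: field_simps)
      ultimately have "0 \<le> 2 * b * (x \<bullet> (\<Phi> S *v x))" by linarith
      then show ?thesis using b by (simp add: zero_le_mult_iff)
    qed
    have "transpose (\<Phi> S) = \<Phi> S"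
    proof -
      have "transpose (C - S ** S) = C - S ** S"
      proof -
        have "transpose (C - S ** S) = transpose C - transpose (S ** S)"
          by (simp add: transpose_def vec_eq_iff)
        then show ?thesis using C S by (simp add: matrix_transpose_mul pos_semidef_def)
      qed
      then show ?thesis by (simp add: \<Phi>_def transpose_add transpose_scaleR S)
    qed
    then show "\<Phi> S \<in> Z" using up lo by (simp add: Z_def)
  qed
  ultimately obtain S where S: "S \<in> Z" "\<Phi> S = S" using brouwer[of Z \<Phi>] by blast
  then have "S ** S = C" using b by (simp add: \<Phi>_def)
  then show ?thesis using S by (auto simp: Z_def pos_semidef_def)
qed

lemma symmetric_adjoint: "transpose S = S \<Longrightarrow> x \<bullet> (S *v y) = (S *v x) \<bullet> (y::real^'d)"
  by (metis dot_lmul_matrix vector_transpose_matrix)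

lemma norm_symmetric_mult:
  assumes "transpose S = S"
  shows "(norm (S *v x))\<^sup>2 = x \<bullet> ((S ** S) *v (x::real^'d))"
  using symmetric_adjoint[OF assms, of x "S *v x"]
  by (simp add: matrix_vector_mul_assoc[symmetric] power2_norm_eq_inner)

lemma mat_sqrt_unique:
  fixes S T :: "real^'d^'d"
  assumes "sym_pos_def S" "pos_semidef T" "S ** S = T ** T"
  shows "S = T"
proof -
  obtain a where a: "a > 0" "\<And>x. a * (norm x)\<^sup>2 \<le> x \<bullet> (S *v x)"
    using pos_def_coercive[of S] assms(1) by (auto simp: sym_pos_def_def)
  have "a * norm (S - T) \<le> norm (S ** S - T ** T)"
    using assms a by (intro norm_diff_le_norm_diff_squares) (auto simp: sym_pos_def_def)
  then show ?thesis using assms(3) a by (simp add: mult_le_0_iff)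
qed

lemma mat_sqrt_eqI: "sym_pos_def S \<Longrightarrow> S ** S = C \<Longrightarrow> mat_sqrt C = S"
  unfolding mat_sqrt_def
  by (rule the_equality) (auto intro: mat_sqrt_unique sym_pos_def_imp_pos_semidef)

lemma
  assumes "sym_pos_def C"
  shows sym_pos_def_mat_sqrt: "sym_pos_def (mat_sqrt C)"
    and mat_sqrt_square: "mat_sqrt C ** mat_sqrt C = C"
proof -
  obtain S where S: "pos_semidef S" "S ** S = C"
    using pos_semidef_sqrt_exists assms sym_pos_def_imp_pos_semidef by blast
  have sym: "transpose S = S" using S by (simp add: pos_semidef_def)
  have "0 < x \<bullet> (S *v x)" if "x \<noteq> 0" for x
  proof -
    have "(norm (S *v x))\<^sup>2 > 0"
      using assms that by (simp add: norm_symmetric_mult[OF sym] S sym_pos_def_def)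
    then have nz: "S *v x \<noteq> 0" by auto
    \<comment> \<open>A root of the root turns the form of \<open>S\<close> into a squared norm,
      \<open>x \<bullet> S x = |R x|\<^sup>2\<close>, which can vanish only if \<open>S x\<close>
      does.\<close>
    obtain R where R: "pos_semidef R" "R ** R = S" using pos_semidef_sqrt_exists S by blast
    have R': "transpose R = R" using R by (simp add: pos_semidef_def)
    have "R *v x \<noteq> 0"
      using nz R by (metis matrix_vector_mul_assoc matrix_vector_mult_0_right)
    then show ?thesis
      using norm_symmetric_mult[OF R', of x] R by (metis norm_eq_zero zero_less_power2)
  qed
  then have "sym_pos_def S" using sym by (simp add: sym_pos_def_def)
  then show "sym_pos_def (mat_sqrt C)" "mat_sqrt C ** mat_sqrt C = C"
    using mat_sqrt_eqI[OF _ S(2)] S by auto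
qed

lemma transpose_mat_sqrt: "sym_pos_def C \<Longrightarrow> transpose (mat_sqrt C) = mat_sqrt C"
  using sym_pos_def_mat_sqrt by (auto simp: sym_pos_def_def)

lemma norm_mat_sqrt_mult: "sym_pos_def C \<Longrightarrow> (norm (mat_sqrt C *v x))\<^sup>2 = x \<bullet> (C *v x)"
  using norm_symmetric_mult[OF transpose_mat_sqrt] by (metis mat_sqrt_square)

lemma mat_sqrt_scaleR:
  assumes "sym_pos_def C" "\<rho> > 0"
  shows "mat_sqrt (\<rho>\<^sup>2 *\<^sub>R C) = \<rho> *\<^sub>R mat_sqrt C"
proof (rule mat_sqrt_eqI)
  show "sym_pos_def (\<rho> *\<^sub>R mat_sqrt C)"
    using assms by (intro sym_pos_def_scaleR sym_pos_def_mat_sqrt)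
  show "(\<rho> *\<^sub>R mat_sqrt C) ** (\<rho> *\<^sub>R mat_sqrt C) = \<rho>\<^sup>2 *\<^sub>R C"
    by (subst (3) mat_sqrt_square[OF assms(1), symmetric])
      (simp add: vec_eq_iff matrix_matrix_mult_def power2_eq_square sum_distrib_left mult_ac)
qed

text \<open>\<open>norm_diff_le_norm_diff_squares\<close> needs coercivity of one of the two roots
  only. With the constant taken from the root at \<open>C\<close>, the estimate holds against every
  other positive definite matrix.\<close>

lemma continuous_on_mat_sqrt: "continuous_on {C. sym_pos_def C} mat_sqrt"
proof (rule continuous_onI)
  fix C :: "real^'d^'d" and e :: real
  assume "C \<in> {C. sym_pos_def C}" and e: "e > 0"
  then have C: "sym_pos_def C" by simp
  obtain a where a: "a > 0" "\<And>x. a * (norm x)\<^sup>2 \<le> x \<bullet> (mat_sqrt C *v x)"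
    using pos_def_coercive[of "mat_sqrt C"] sym_pos_def_mat_sqrt[OF C] by (auto simp: sym_pos_def_def)
  show "\<exists>d>0. \<forall>x'\<in>{C. sym_pos_def C}. dist x' C < d \<longrightarrow> dist (mat_sqrt x') (mat_sqrt C) \<le> e"
  proof (intro exI[of _ "a * e"] conjI ballI impI)
    fix D :: "real^'d^'d" assume "D \<in> {C. sym_pos_def C}" and d: "dist D C < a * e"
    then have D: "sym_pos_def D" by simp
    have "a * norm (mat_sqrt C - mat_sqrt D) \<le> norm (mat_sqrt C ** mat_sqrt C - mat_sqrt D ** mat_sqrt D)"
      using a D by (intro norm_diff_le_norm_diff_squares transpose_mat_sqrt[OF C]
          sym_pos_def_imp_pos_semidef sym_pos_def_mat_sqrt)
    also have "\<dots> < a * e" using d by (simp add: mat_sqrt_square C D dist_norm norm_minus_commute)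
    finally show "dist (mat_sqrt D) (mat_sqrt C) \<le> e"
      using a by (simp add: dist_norm norm_minus_commute)
  qed (use a e in auto)
qed

lemma pos_def_perturb:
  fixes A B :: "real^'d^'d"
  assumes "\<And>x. a * (norm x)\<^sup>2 \<le> x \<bullet> (A *v x)" "norm (B - A) \<le> e"
  shows "(a - e) * (norm x)\<^sup>2 \<le> x \<bullet> (B *v x)"
proof -
  have "x \<bullet> (B *v x) = x \<bullet> (A *v x) + x \<bullet> ((B - A) *v x)"
    by (simp add: matrix_vector_mult_diff_rdistrib inner_diff_right)
  moreover have "\<bar>x \<bullet> ((B - A) *v x)\<bar> \<le> e * (norm x)\<^sup>2"
    using quadratic_form_norm_le[of x "B - A"] mult_right_mono[OF assms(2), of "(norm x)\<^sup>2"] by simp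
  ultimately show ?thesis using assms(1)[of x] by (simp add: algebra_simps)
qed

lemma sym_pos_def_borel [measurable]: "{C :: real^'d^'d. sym_pos_def C} \<in> sets borel"
proof -
  have "open {C :: real^'d^'d. \<forall>x. x \<noteq> 0 \<longrightarrow> x \<bullet> (C *v x) > 0}"
    unfolding open_dist
  proof safe
    fix A :: "real^'d^'d" assume A: "\<forall>x. x \<noteq> 0 \<longrightarrow> x \<bullet> (A *v x) > 0"
    then obtain a where a: "a > 0" "\<And>x. a * (norm x)\<^sup>2 \<le> x \<bullet> (A *v x)"
      using pos_def_coercive[of A] by auto
    show "\<exists>e>0. \<forall>y. dist y A < e \<longrightarrow> y \<in> {C. \<forall>x. x \<noteq> 0 \<longrightarrow> 0 < x \<bullet> (C *v x)}"
    proof (intro exI[of _ "a / 2"] conjI allI impI CollectI)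
      fix B :: "real^'d^'d" and x :: "real^'d" assume "dist B A < a / 2" "x \<noteq> 0"
      then have "(a - a / 2) * (norm x)\<^sup>2 \<le> x \<bullet> (B *v x)"
        using a by (intro pos_def_perturb) (auto simp: dist_norm)
      moreover have "(a - a / 2) * (norm x)\<^sup>2 > 0" using a \<open>x \<noteq> 0\<close> by simp
      ultimately show "0 < x \<bullet> (B *v x)" by linarith
    qed (use a in auto)
  qed
  moreover have "closed {C :: real^'d^'d. transpose C = C}"
    unfolding transpose_def by (intro closed_Collect_eq continuous_intros)
  ultimately have "{C :: real^'d^'d. transpose C = C} \<inter> {C. \<forall>x. x \<noteq> 0 \<longrightarrow> x \<bullet> (C *v x) > 0} \<in> sets borel"
    by auto
  then show ?thesis by (simp add: sym_pos_def_def Collect_conj_eq)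
qed

lemma sym_pos_def_det_pos:
  fixes C :: "real^'d^'d"
  assumes "sym_pos_def C"
  shows "det C > 0"
proof -
  have "invertible C"
    unfolding invertible_left_inverse matrix_left_invertible_ker
    using assms by (metis inner_zero_right less_irrefl sym_pos_def_def)
  moreover have "det C = det (mat_sqrt C) * det (mat_sqrt C)"
    using mat_sqrt_square[OF assms] by (metis det_mul)
  ultimately show ?thesis using invertible_det_nz[of C] by (auto simp: less_le)
qed

text \<open>The vectors are the rows of the symmetric square root; their squared norms are the
  diagonal entries of \<open>E\<close>. Hence a small \<open>E\<close> is a sum of d small rank-one
  terms.\<close>

lemma pos_semidef_eq_sum_outer_square:
  fixes E :: "real^'d^'d"
  assumes "pos_semidef E"
  obtains v where "E = (\<Sum>i\<in>UNIV. outer_square (v i))" "\<And>i::'d. (norm (v i))\<^sup>2 \<le> norm E"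
proof -
  obtain S where S: "pos_semidef S" "S ** S = E" using pos_semidef_sqrt_exists assms by blast
  have sym: "S $ j $ i = S $ i $ j" for i j
    by (rule symmetric_entry) (use S in \<open>simp add: pos_semidef_def\<close>)
  have E: "E $ j $ k = (\<Sum>i\<in>UNIV. S $ i $ j * S $ i $ k)" for j k
    unfolding S(2)[symmetric] by (simp add: matrix_matrix_mult_def) (intro sum.cong; simp add: sym)
  show ?thesis
  proof
    show "E = (\<Sum>i\<in>UNIV. outer_square (S $ i))"
      by (simp add: vec_eq_iff E outer_square_component)
    fix i
    have "(norm (S $ i))\<^sup>2 = (\<Sum>j\<in>UNIV. S $ i $ j * S $ i $ j)"
      by (simp add: power2_norm_eq_inner inner_vec_def)
    also have "\<dots> = E $ i $ i" unfolding E by (intro sum.cong refl) (simp add: sym[of i])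
    also have "\<dots> \<le> norm E"
      using component_le_norm_cart[of "E $ i" i] Finite_Cartesian_Product.norm_nth_le[of E i] by linarith
    finally show "(norm (S $ i))\<^sup>2 \<le> norm E" .
  qed
qed

section \<open>The algorithm in coordinates relative to the optimum\<close>

definition sorts :: "nat \<Rightarrow> (nat \<Rightarrow> real) \<Rightarrow> (nat \<Rightarrow> nat) \<Rightarrow> bool" where
  "sorts lam v s \<longleftrightarrow> s permutes {1..lam} \<and>
     (\<forall>i\<in>{1..lam}. \<forall>j\<in>{1..lam}. i < j \<longrightarrow>
        v (s i) < v (s j) \<or> v (s i) = v (s j) \<and> s i < s j)"

text \<open>The rank of \<open>i\<close> in the lexicographic order of value and index;
  \<open>i\<close> counts itself, so that ranks start at 1.\<close>

definition position :: "nat \<Rightarrow> (nat \<Rightarrow> real) \<Rightarrow> nat \<Rightarrow> nat" where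
  "position lam v i = card {j\<in>{1..lam}. v j < v i \<or> v j = v i \<and> j \<le> i}"

lemma position_less_iff:
  assumes "i \<in> {1..lam}" "j \<in> {1..lam}"
  shows "position lam v i < position lam v j \<longleftrightarrow> v i < v j \<or> v i = v j \<and> i < j"
proof -
  have *: "position lam v i < position lam v j"
    if "i \<in> {1..lam}" "j \<in> {1..lam}" "v i < v j \<or> v i = v j \<and> i < j" for i j
    unfolding position_def using that by (intro psubset_card_mono psubsetI) force+
  show ?thesis
  proof
    assume l: "position lam v i < position lam v j"
    show "v i < v j \<or> v i = v j \<and> i < j"
    proof (rule ccontr)
      assume "\<not> ?thesis"
      then consider "i = j" | "v j < v i \<or> v j = v i \<and> j < i" by fastforce
      then show False using *[OF assms(2,1)] l by cases auto
    qed
  qed (use * assms in auto)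
qed

lemma bij_betw_position: "bij_betw (position lam v) {1..lam} {1..lam}"
proof -
  have inj: "inj_on (position lam v) {1..lam}"
  proof (rule inj_onI)
    fix i j assume ij: "i \<in> {1..lam}" "j \<in> {1..lam}" and e: "position lam v i = position lam v j"
    then show "i = j"
      using position_less_iff[OF ij, of v] position_less_iff[OF ij(2,1), of v]
      by (metis less_irrefl linorder_neqE_linordered_idom linorder_neqE_nat)
  qed
  moreover have "position lam v ` {1..lam} \<subseteq> {1..lam}"
  proof
    fix k assume "k \<in> position lam v ` {1..lam}"
    then obtain i where i: "i \<in> {1..lam}" "k = position lam v i" by auto
    have "card {j\<in>{1..lam}. v j < v i \<or> v j = v i \<and> j \<le> i} \<le> card {1..lam}"
      by (intro card_mono) auto
    moreover have "{j\<in>{1..lam}. v j < v i \<or> v j = v i \<and> j \<le> i} \<noteq> {}" using i by auto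
    then have "card {j\<in>{1..lam}. v j < v i \<or> v j = v i \<and> j \<le> i} > 0" by (simp add: card_gt_0_iff)
    ultimately show "k \<in> {1..lam}" using i by (simp add: position_def)
  qed
  ultimately show ?thesis
    by (metis bij_betw_def endo_inj_surj finite_atLeastAtMost)
qed

text \<open>Invert the bijection \<open>position\<close>, extended by the identity outside
  \<open>{1..lam}\<close> as \<open>permutes\<close> demands.\<close>

lemma sorts_exists: "\<exists>s. sorts lam v s"
proof -
  define I where "I = {1..lam}"
  define s where "s k = (if k \<in> I then inv_into I (position lam v) k else k)" for k
  have bij: "bij_betw (position lam v) I I" using bij_betw_position by (simp add: I_def)
  have sI: "s k \<in> I" "position lam v (s k) = k" if "k \<in> I" for k
    using bij that by (auto simp: s_def bij_betw_def intro: inv_into_into f_inv_into_f)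
  have "bij_betw s I I"
    using bij_betw_inv_into[OF bij] by (rule bij_betw_cong[THEN iffD1, rotated]) (simp add: s_def)
  then have "s permutes I" by (intro bij_imp_permutes) (auto simp: s_def)
  moreover have "v (s i) < v (s j) \<or> v (s i) = v (s j) \<and> s i < s j"
    if "i \<in> I" "j \<in> I" "i < j" for i j
    using position_less_iff[of "s i" lam "s j" v] sI that by (simp add: I_def)
  ultimately show ?thesis unfolding sorts_def I_def by blast
qed

text \<open>Every sorting permutation \<open>r\<close> inverts \<open>position\<close>: the indices
  ranked at or below \<open>r k\<close> are exactly \<open>r 1, ..., r k\<close>.\<close>

lemma sorts_unique:
  assumes s: "sorts lam v s" and t: "sorts lam v t"
  shows "s = t"
proof -
  define I where "I = {1..lam}"
  have pos: "position lam v (r k) = k" if r: "sorts lam v r" and k: "k \<in> I" for r k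
  proof -
    have rp: "r permutes I" using r by (simp add: sorts_def I_def)
    have "{j\<in>{1..lam}. v j < v (r k) \<or> v j = v (r k) \<and> j \<le> r k} = r ` {1..k}"
    proof (intro equalityI subsetI)
      fix j assume j: "j \<in> {j\<in>{1..lam}. v j < v (r k) \<or> v j = v (r k) \<and> j \<le> r k}"
      then have "j \<in> r ` I" using permutes_image[OF rp] by (simp add: I_def)
      then obtain i where i: "i \<in> I" "j = r i" by auto
      have "\<not> k < i"
      proof
        assume "k < i"
        then have "v (r k) < v (r i) \<or> v (r k) = v (r i) \<and> r k < r i"
          using r i k unfolding sorts_def I_def by blast
        then show False using j i by auto
      qed
      then show "j \<in> r ` {1..k}" using i by (auto simp: I_def)
    next
      fix j assume "j \<in> r ` {1..k}"
      then obtain i where i: "1 \<le> i" "i \<le> k" "j = r i" by auto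
      then have iI: "i \<in> I" using k by (auto simp: I_def)
      have "r i \<in> I" using iI rp by (simp add: permutes_in_image)
      moreover have "v (r i) < v (r k) \<or> v (r i) = v (r k) \<and> r i \<le> r k"
      proof (cases "i = k")
        case False
        then have "i < k" using i by simp
        then show ?thesis using r iI k unfolding sorts_def I_def by fastforce
      qed simp
      ultimately show "j \<in> {j\<in>{1..lam}. v j < v (r k) \<or> v j = v (r k) \<and> j \<le> r k}"
        using i by (simp add: I_def)
    qed
    then have "position lam v (r k) = card (r ` {1..k})" by (simp add: position_def)
    also have "\<dots> = k" using permutes_inj_on[OF rp] by (simp add: card_image)
    finally show ?thesis .
  qed
  show ?thesis
  proof
    fix k
    show "s k = t k"
    proof (cases "k \<in> I")
      case True
      then have "s k \<in> I" "t k \<in> I"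
        using s t by (auto simp: sorts_def I_def dest: permutes_in_image)
      then show ?thesis
        using pos[OF s True] pos[OF t True] bij_betw_position[of lam v]
          inj_onD[of "position lam v" I "s k" "t k"] by (simp add: bij_betw_def I_def)
    next
      case False
      then show ?thesis using s t by (auto simp: sorts_def I_def permutes_def)
    qed
  qed
qed

lemma ranking_eqI: "sorts lam v s \<Longrightarrow> ranking lam v = s"
  using sorts_unique unfolding ranking_def sorts_def by (intro the_equality) blast+

lemma sorts_ranking: "sorts lam v (ranking lam v)"
  using sorts_exists ranking_eqI by metis

lemma ranking_permutes: "ranking lam v permutes {1..lam}"
  using sorts_ranking by (simp add: sorts_def)

lemma ranking_in: "i \<in> {1..lam} \<Longrightarrow> ranking lam v i \<in> {1..lam}"
  using permutes_in_image[OF ranking_permutes] by blast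

lemma ranking_increasing:
  assumes "\<And>i j. i \<in> {1..lam} \<Longrightarrow> j \<in> {1..lam} \<Longrightarrow> i < j \<Longrightarrow> v i < v j"
  shows "ranking lam v = id"
  using assms by (intro ranking_eqI) (auto simp: sorts_def permutes_id)

text \<open>Only comparisons of values enter the ranking, which is how the scaling invariance of the
  objective becomes a property of the algorithm.\<close>

lemma ranking_cong:
  assumes "\<And>i j. i \<in> {1..lam} \<Longrightarrow> j \<in> {1..lam} \<Longrightarrow> v i \<le> v j \<longleftrightarrow> v' i \<le> v' j"
  shows "ranking lam v = ranking lam v'"
proof (rule ranking_eqI)
  have "v i < v j \<longleftrightarrow> v' i < v' j" "v i = v j \<longleftrightarrow> v' i = v' j"
    if "i \<in> {1..lam}" "j \<in> {1..lam}" for i j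
    using assms[OF that] assms[OF that(2,1)] by auto
  then show "sorts lam v (ranking lam v')"
    using sorts_ranking[where lam = lam and v = v'] ranking_in[where lam = lam and v = v'] unfolding sorts_def by simp
qed

text \<open>There are finitely many permutations, and the preimage of each is described by finitely
  many comparisons.\<close>

lemma measurable_ranking:
  assumes [measurable]: "\<And>i. i \<in> {1..lam} \<Longrightarrow> (\<lambda>x. v x i) \<in> borel_measurable M"
  shows "(\<lambda>x. ranking lam (v x)) \<in> M \<rightarrow>\<^sub>M count_space {s. s permutes {1..lam}}"
proof (subst measurable_count_space_eq2)
  show "finite {s. s permutes {1..lam}}" by (simp add: finite_permutations)
  show "(\<lambda>x. ranking lam (v x)) \<in> space M \<rightarrow> {s. s permutes {1..lam}} \<and>
    (\<forall>a\<in>{s. s permutes {1..lam}}. (\<lambda>x. ranking lam (v x)) -` {a} \<inter> space M \<in> sets M)"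
  proof (intro conjI ballI)
    fix s assume "s \<in> {s. s permutes {1..lam}}"
    then have s: "s permutes {1..lam}" by simp
    have sI: "s i \<in> {1..lam}" if "i \<in> {1..lam}" for i using permutes_in_image[OF s] that by blast
    have "(\<lambda>x. ranking lam (v x)) -` {s} \<inter> space M = {x\<in>space M. \<forall>i\<in>{1..lam}. \<forall>j\<in>{1..lam}. i < j \<longrightarrow>
        v x (s i) < v x (s j) \<or> v x (s i) = v x (s j) \<and> s i < s j}"
      using ranking_eqI[where lam = lam and s = s] sorts_ranking[where lam = lam] s by (auto simp: sorts_def)
    also have "\<dots> \<in> sets M"
    proof -
      have [measurable]: "(\<lambda>x. v x (s i)) \<in> borel_measurable M" if "i \<in> {1..lam}" for i
        using assms[OF sI[OF that]] .
      show ?thesis by measurable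
    qed
    finally show "(\<lambda>x. ranking lam (v x)) -` {s} \<inter> space M \<in> sets M" .
  qed (use ranking_permutes in blast)
qed

section \<open>The update in terms of candidates and its scaling equivariance\<close>

type_synonym 'd state = "(real^'d) \<times> (real^'d^'d)"

definition full_space :: "'d::finite state set" where
  "full_space = UNIV \<times> {C. sym_pos_def C}"

text \<open>In terms of the candidate solutions \<open>y i = m + mat_sqrt C *v u i\<close>, the new mean does not
  depend on the old state.\<close>

definition cma_update :: "nat \<Rightarrow> (nat \<Rightarrow> real) \<Rightarrow> real \<Rightarrow> 'd::finite state \<Rightarrow> (nat \<Rightarrow> real^'d) \<Rightarrow> 'd state" where
  "cma_update mu w c x y =
     (\<Sum>i=1..mu. w i *\<^sub>R y i,
      (1 - c) *\<^sub>R snd x + c *\<^sub>R (\<Sum>i=1..mu. w i *\<^sub>R outer_square (y i - fst x)))"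

definition cma_step :: "(real^'d \<Rightarrow> real) \<Rightarrow> real^'d \<Rightarrow> nat \<Rightarrow> nat \<Rightarrow> (nat \<Rightarrow> real) \<Rightarrow> real \<Rightarrow>
    'd::finite state \<Rightarrow> (nat \<Rightarrow> real^'d) \<Rightarrow> 'd state" where
  "cma_step f xstar lam mu w c x u =
     (cma_mean f lam mu w (xstar + fst x) (snd x) u - xstar, cma_cov f lam mu w c (xstar + fst x) (snd x) u)"

lemma matrix_add_rdistrib_real: "(A + B) ** C = A ** C + B ** (C :: real^'d^'d)"
  by (simp add: vec_eq_iff matrix_matrix_mult_def sum.distrib distrib_right)

lemma matrix_mult_sum_sandwich:
  fixes A :: "real^'d^'d"
  shows "A ** (\<Sum>i\<in>I. w i *\<^sub>R B i) ** A = (\<Sum>i\<in>I. w i *\<^sub>R (A ** B i ** A))"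
proof (induction I rule: infinite_finite_induct)
  case (insert i I)
  have "A ** (w i *\<^sub>R B i) ** A = w i *\<^sub>R (A ** B i ** A)"
    by (simp add: vec_eq_iff matrix_matrix_mult_def sum_distrib_left sum_distrib_right mult_ac)
  then show ?case using insert by (simp add: matrix_add_ldistrib matrix_add_rdistrib_real)
qed (auto simp: vec_eq_iff matrix_matrix_mult_def)

text \<open>Weights summing to one absorb the old mean into the weighted candidates, and symmetry of
  the root gives \<open>S u u\<^sup>T S = (S u) (S u)\<^sup>T\<close>. The state is thus seen by the
  update only through the candidates, their ranking, and an explicit quadratic expression.\<close>

lemma cma_step_eq_update:
  fixes x :: "'d::finite state"
  assumes x: "x \<in> full_space" and w: "(\<Sum>i=1..mu. w i) = 1"
  defines "y \<equiv> \<lambda>u i. fst x + mat_sqrt (snd x) *v u i"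
  shows "cma_step f xstar lam mu w c x u =
    cma_update mu w c x (\<lambda>i. y u (ranking lam (\<lambda>i. f (xstar + y u i)) i))"
proof -
  define s where "s = ranking lam (\<lambda>i. f (xstar + y u i))"
  have C: "sym_pos_def (snd x)" using x by (auto simp: full_space_def)
  have s: "cma_ranking f lam (xstar + fst x) (snd x) u = s"
    by (simp add: cma_ranking_def s_def y_def add.assoc)
  have "(\<Sum>i=1..mu. w i *\<^sub>R fst x) = fst x"
    using w by (simp add: scaleR_left.sum[symmetric])
  then have "cma_mean f lam mu w (xstar + fst x) (snd x) u - xstar = (\<Sum>i=1..mu. w i *\<^sub>R y u (s i))"
    by (simp add: cma_mean_def s y_def scaleR_right_distrib sum.distrib
        linear_sum[OF matrix_vector_mul_linear, of "mat_sqrt (snd x)"] matrix_vector_mult_scaleR)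
  moreover have "cma_cov f lam mu w c (xstar + fst x) (snd x) u =
      (1 - c) *\<^sub>R snd x + c *\<^sub>R (\<Sum>i=1..mu. w i *\<^sub>R outer_square (y u (s i) - fst x))"
    by (simp add: cma_cov_def s y_def matrix_mult_sum_sandwich
        matrix_sandwich_outer_square[OF transpose_mat_sqrt[OF C]])
  ultimately show ?thesis by (simp add: cma_step_def cma_update_def s_def)
qed

lemma cma_update_full:
  assumes "x \<in> full_space" "0 < c" "c < 1" "\<And>i. i \<in> {1..mu} \<Longrightarrow> w i \<ge> 0"
  shows "cma_update mu w c x y \<in> full_space"
  using assms by (auto simp: full_space_def cma_update_def
      intro!: sym_pos_def_add sym_pos_def_scaleR pos_semidef_scaleR pos_semidef_sum pos_semidef_outer_square)

definition rescale :: "real \<Rightarrow> 'd::finite state \<Rightarrow> 'd state" where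
  "rescale \<rho> x = (\<rho> *\<^sub>R fst x, \<rho>\<^sup>2 *\<^sub>R snd x)"

lemma rescale_full: "x \<in> full_space \<Longrightarrow> \<rho> > 0 \<Longrightarrow> rescale \<rho> x \<in> full_space"
  by (auto simp: full_space_def rescale_def intro!: sym_pos_def_scaleR)

lemma cma_update_rescale:
  "cma_update mu w c (rescale \<rho> x) (\<lambda>i. \<rho> *\<^sub>R y i) = rescale \<rho> (cma_update mu w c x y)"
  by (auto simp: cma_update_def rescale_def scaleR_sum_right scaleR_right_distrib
      scaleR_diff_right[symmetric] outer_square_scaleR mult_ac intro!: sum.cong)

text \<open>The root scales linearly when the covariance scales quadratically, so with the same
  samples all candidates are multiplied by \<rho>, and the ranking does not notice.\<close>

lemma cma_step_rescale:
  fixes x :: "'d::finite state"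
  assumes f: "scaling_invariant f xstar" and x: "x \<in> full_space" and w: "(\<Sum>i=1..mu. w i) = 1"
    and \<rho>: "\<rho> > 0"
  shows "cma_step f xstar lam mu w c (rescale \<rho> x) u = rescale \<rho> (cma_step f xstar lam mu w c x u)"
proof -
  define y where "y i = fst x + mat_sqrt (snd x) *v u i" for i
  have C: "sym_pos_def (snd x)" using x by (auto simp: full_space_def)
  have y: "fst (rescale \<rho> x) + mat_sqrt (snd (rescale \<rho> x)) *v u i = \<rho> *\<^sub>R y i" for i
    unfolding rescale_def y_def fst_conv snd_conv mat_sqrt_scaleR[OF C \<rho>]
    by (simp only: scaleR_right_distrib scaleR_matrix_vector_assoc)
  have "ranking lam (\<lambda>i. f (xstar + \<rho> *\<^sub>R y i)) = ranking lam (\<lambda>i. f (xstar + y i))"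
  proof (rule ranking_cong)
    fix i j
    show "f (xstar + \<rho> *\<^sub>R y i) \<le> f (xstar + \<rho> *\<^sub>R y j) \<longleftrightarrow> f (xstar + y i) \<le> f (xstar + y j)"
      using f \<rho> unfolding scaling_invariant_def add.commute[of xstar] by blast
  qed
  then show ?thesis
    unfolding cma_step_eq_update[OF rescale_full[OF x \<rho>] w] cma_step_eq_update[OF x w] y
      y_def[symmetric] cma_update_rescale[symmetric] by (rule arg_cong)
qed

definition normalize :: "'d::finite state \<Rightarrow> 'd state" where
  "normalize x = normalized_state 0 (fst x) (snd x)"

lemma normalized_state_eq: "normalized_state xstar m C = normalize (m - xstar, C)"
  by (simp add: normalize_def normalized_state_def)

lemma det_scaleR: "det (a *\<^sub>R (C::real^'d^'d)) = a ^ CARD('d) * det C"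
proof -
  have "a *\<^sub>R C = (\<chi> i. a *s C $ i)" by (simp add: vec_eq_iff vector_scalar_mult_def)
  then show ?thesis by (simp add: det_rows_mul)
qed

lemma det_scale_pos: "sym_pos_def C \<Longrightarrow> det_scale C > 0"
  using sym_pos_def_det_pos[of C] by (simp add: det_scale_def)

lemma det_scale_scaleR:
  assumes "sym_pos_def (C::real^'d^'d)" "a > 0"
  shows "det_scale (a *\<^sub>R C) = a * det_scale C"
proof -
  have "(a ^ CARD('d)) powr (1 / CARD('d)) = a"
    using assms by (simp add: powr_realpow[symmetric] powr_powr)
  then show ?thesis
    using sym_pos_def_det_pos[OF assms(1)] assms(2) by (simp add: det_scale_def det_scaleR powr_mult)
qed

lemma normalize_eq_rescale:
  assumes "x \<in> full_space"
  shows "normalize x = rescale (1 / sqrt (det_scale (snd x))) x"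
  using det_scale_pos[of "snd x"] assms
  by (auto simp: normalize_def normalized_state_def rescale_def full_space_def power_divide)

lemma normalize_rescale:
  assumes "x \<in> full_space" "\<rho> > 0"
  shows "normalize (rescale \<rho> x) = normalize x"
  using assms det_scale_pos[of "snd x"] det_scale_scaleR[of "snd x" "\<rho>\<^sup>2"]
  by (auto simp: normalize_def normalized_state_def rescale_def full_space_def real_sqrt_mult
      power2_eq_square)

lemma normalize_in_space:
  assumes "x \<in> full_space"
  shows "normalize x \<in> normalized_space"
proof -
  have C: "sym_pos_def (snd x)" using assms by (auto simp: full_space_def)
  have "det_scale (snd x) ^ CARD('a) = det (snd x)"
    using sym_pos_def_det_pos[OF C]
    by (simp add: det_scale_def powr_realpow[symmetric] powr_powr)
  then have "det ((1 / det_scale (snd x)) *\<^sub>R snd x) = 1"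
    using sym_pos_def_det_pos[OF C] by (simp add: det_scaleR power_divide)
  then show ?thesis
    using sym_pos_def_scaleR[OF C, of "1 / det_scale (snd x)"] det_scale_pos[OF C]
    by (simp add: normalized_space_def normalize_def normalized_state_def)
qed

lemma normalized_space_subset_full: "normalized_space \<subseteq> full_space"
  by (auto simp: normalized_space_def full_space_def)

lemma normalize_id: "x \<in> normalized_space \<Longrightarrow> normalize x = x"
  by (auto simp: normalized_space_def normalize_def normalized_state_def det_scale_def)

section \<open>The normalized kernel\<close>

lemma prod_Basis_vec: "(\<Prod>b\<in>(Basis::(real^'d) set). h b) = (\<Prod>i\<in>UNIV. h (axis i 1))"
proof -
  have "(Basis::(real^'d) set) = range (\<lambda>i. axis i 1)" by (auto simp: Basis_vec_def)
  moreover have "inj (\<lambda>i::'d. axis i (1::real))" by (auto simp: inj_on_def axis_eq_axis)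
  then have "prod h (range (\<lambda>i::'d. axis i (1::real))) = (\<Prod>i\<in>UNIV. h (axis i 1))"
    by (subst prod.reindex) auto
  ultimately show ?thesis by (simp only:)
qed

lemma measurable_std_gaussian_density [measurable]:
  "(\<lambda>x::real^'d. \<Prod>i\<in>UNIV. std_normal_density (x $ i)) \<in> borel_measurable borel"
  by (intro borel_measurable_prod measurable_compose[OF _ borel_measurable_normal_density]
      borel_measurable_continuous_onI continuous_intros)

lemma sets_std_gaussian [simp, measurable_cong]: "sets std_gaussian = sets borel"
  by (simp add: std_gaussian_def)

lemma space_std_gaussian [simp]: "space std_gaussian = UNIV"
  by (simp add: std_gaussian_def)

lemma prob_space_std_gaussian: "prob_space (std_gaussian :: (real^'d) measure)"
proof
  have 1: "(\<integral>\<^sup>+x. ennreal (std_normal_density x) \<partial>lborel) = 1"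
    using prob_space.emeasure_space_1[OF prob_space_normal_density[of 1 0]]
    by (simp add: emeasure_density)
  have "emeasure std_gaussian (space (std_gaussian :: (real^'d) measure)) =
      (\<integral>\<^sup>+x. ennreal (\<Prod>i\<in>UNIV. std_normal_density (x $ i)) \<partial>(lborel :: (real^'d) measure))"
    by (simp add: std_gaussian_def emeasure_density)
  also have "\<dots> = (\<integral>\<^sup>+x. (\<Prod>b\<in>Basis. ennreal (std_normal_density (x \<bullet> b))) \<partial>(lborel :: (real^'d) measure))"
    by (intro nn_integral_cong) (simp add: prod_Basis_vec inner_axis prod_ennreal)
  also have "\<dots> = (\<Prod>b\<in>(Basis::(real^'d) set). (\<integral>\<^sup>+x. ennreal (std_normal_density x) \<partial>lborel))"
    by (intro nn_integral_lborel_prod) auto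
  finally show "emeasure std_gaussian (space (std_gaussian :: (real^'d) measure)) = 1"
    by (simp add: 1)
qed

lemma measurable_matrix_vector_mult [measurable]:
  fixes f :: "'a \<Rightarrow> real^'n^'m" and g :: "'a \<Rightarrow> real^'n"
  assumes "f \<in> borel_measurable M" "g \<in> borel_measurable M"
  shows "(\<lambda>x. f x *v g x) \<in> borel_measurable M"
  using assms
proof (rule borel_measurable_continuous_Pair)
  show "continuous_on UNIV (\<lambda>x :: (real^'n^'m) \<times> (real^'n). fst x *v snd x)"
    unfolding matrix_vector_mult_def by (intro continuous_intros)
qed

lemma measurable_outer_square [measurable]:
  "f \<in> borel_measurable M \<Longrightarrow> (\<lambda>x. outer_square (f x)) \<in> borel_measurable M"
  by (rule borel_measurable_continuous_on[OF continuous_outer_square])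

lemma sym_pos_def_mat_1: "sym_pos_def (mat 1)"
  by (auto simp: sym_pos_def_def transpose_mat)

lemma full_space_borel [measurable]: "full_space \<in> sets (borel :: 'd::finite state measure)"
  unfolding full_space_def borel_prod[symmetric] by measurable

text \<open>Totalised by a point of the normalized space, so that it is a Borel map from the whole
  type into that space.\<close>

definition normalize' :: "'d::finite state \<Rightarrow> 'd state" where
  "normalize' x = (if x \<in> full_space then normalize x else (0, mat 1))"

lemma measurable_normalize': "normalize' \<in> borel \<rightarrow>\<^sub>M borel_on (normalized_space :: 'd::finite state set)"
proof (rule measurable_restrict_space2)
  show "normalize' \<in> space borel \<rightarrow> (normalized_space :: 'd state set)"
    using normalize_in_space by (auto simp: normalize'_def normalized_space_def sym_pos_def_mat_1)
  have [measurable]: "(det_scale :: real^'d^'d \<Rightarrow> real) \<in> borel_measurable borel"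
  proof -
    have "(det :: real^'d^'d \<Rightarrow> real) \<in> borel_measurable borel"
      unfolding det_def by (intro borel_measurable_continuous_onI continuous_intros)
    then show ?thesis unfolding det_scale_def[abs_def] by measurable
  qed
  have "normalize \<in> (borel :: 'd state measure) \<rightarrow>\<^sub>M borel"
    unfolding normalize_def[abs_def] normalized_state_def borel_prod[symmetric] by measurable
  then show "normalize' \<in> (borel :: 'd state measure) \<rightarrow>\<^sub>M borel"
    unfolding normalize'_def[abs_def] by measurable
qed

locale cma_es =
  fixes f :: "real^'d \<Rightarrow> real" and xstar :: "real^'d" and lam mu :: nat and w :: "nat \<Rightarrow> real" and c :: real
  assumes cont: "continuous_on UNIV f"
    and scal: "scaling_invariant f xstar"
    and negl: "negligible_level_sets f"
    and mu: "mu \<in> {1..lam}"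
    and w_pos: "\<And>i. i \<in> {1..mu} \<Longrightarrow> w i > 0"
    and w_sum: "(\<Sum>i=1..mu. w i) = 1"
    and c: "0 < c" "c < 1"
begin

definition noise :: "(nat \<Rightarrow> real^'d) measure" where
  "noise = PiM {1..lam} (\<lambda>_. std_gaussian)"

lemma sets_noise [measurable_cong]: "sets noise = sets (PiM {1..lam} (\<lambda>_. borel))"
  unfolding noise_def by (intro sets_PiM_cong) auto

lemma prob_space_noise: "prob_space noise"
  unfolding noise_def by (intro prob_space_PiM prob_space_std_gaussian)

abbreviation "upd \<equiv> cma_update mu w c"

text \<open>The default is an admissible state: then \<open>step_full\<close> holds for every
  argument, and joint measurability can be stated on the whole type. \<open>candidate\<close> uses
  the default \<open>mat 1\<close> for the same reason.\<close>

definition step :: "'d state \<Rightarrow> (nat \<Rightarrow> real^'d) \<Rightarrow> 'd state" where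
  "step x u = (if x \<in> full_space then cma_step f xstar lam mu w c x u else (0, mat 1))"

definition candidate :: "'d state \<Rightarrow> (nat \<Rightarrow> real^'d) \<Rightarrow> nat \<Rightarrow> real^'d" where
  "candidate x u i = fst x + mat_sqrt (if sym_pos_def (snd x) then snd x else mat 1) *v u i"

lemma step_eq_upd:
  assumes "x \<in> full_space"
  shows "step x u = upd x (\<lambda>i. candidate x u (ranking lam (\<lambda>i. f (xstar + candidate x u i)) i))"
  using cma_step_eq_update[OF assms w_sum, of f xstar lam c u] assms
  by (simp add: step_def candidate_def full_space_def mem_Times_iff)

lemma upd_full: "x \<in> full_space \<Longrightarrow> upd x y \<in> full_space"
  using w_pos c by (intro cma_update_full) (auto intro: less_imp_le)

lemma step_full: "step x u \<in> full_space"
proof (cases "x \<in> full_space")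
  case True then show ?thesis by (simp add: step_eq_upd upd_full)
next
  case False then show ?thesis by (simp add: step_def full_space_def sym_pos_def_mat_1)
qed

lemma step_rescale: "x \<in> full_space \<Longrightarrow> \<rho> > 0 \<Longrightarrow> step (rescale \<rho> x) u = rescale \<rho> (step x u)"
  using cma_step_rescale[OF scal _ w_sum] by (simp add: step_def rescale_full)

text \<open>A state and its normalization differ by a rescaling, which commutes with the step and is
  forgotten by \<open>normalize\<close>. This is why the normalized sequence is itself a Markov
  chain.\<close>

lemma normalize_step:
  assumes "x \<in> full_space"
  shows "normalize (step (normalize x) u) = normalize (step x u)"
proof -
  have "1 / sqrt (det_scale (snd x)) > 0"
    using assms det_scale_pos[of "snd x"] by (auto simp: full_space_def)
  then show ?thesis
    by (simp add: normalize_eq_rescale[OF assms] step_rescale[OF assms] normalize_rescale[OF step_full])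
qed

text \<open>Needed because points of the product space are undefined outside
  \<open>{1..lam}\<close>, whereas the samples of a run are arbitrary there.\<close>

lemma step_cong: "(\<And>i. i \<in> {1..lam} \<Longrightarrow> u i = u' i) \<Longrightarrow> step x u = step x u'"
proof -
  assume u: "\<And>i. i \<in> {1..lam} \<Longrightarrow> u i = u' i"
  show ?thesis
  proof (cases "x \<in> full_space")
    case True
    define s where "s = ranking lam (\<lambda>i. f (xstar + candidate x u i))"
    have s: "ranking lam (\<lambda>i. f (xstar + candidate x u' i)) = s"
      unfolding s_def by (intro ranking_cong) (simp add: candidate_def u)
    have "u (s i) = u' (s i)" if "i \<in> {1..mu}" for i
      using that mu by (intro u) (simp add: s_def, use ranking_in[of i lam] in auto)
    then show ?thesis
      unfolding step_eq_upd[OF True] s_def[symmetric] s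
      by (auto simp: cma_update_def candidate_def intro!: sum.cong)
  qed (simp add: step_def)
qed

lemma measurable_f [measurable]: "f \<in> borel_measurable borel"
  using cont by (rule borel_measurable_continuous_onI)

lemma measurable_candidate [measurable]:
  assumes "i \<in> {1..lam}"
  shows "(\<lambda>(x, u). candidate x u i) \<in> borel \<Otimes>\<^sub>M PiM {1..lam} (\<lambda>_. borel) \<rightarrow>\<^sub>M borel"
proof -
  have "(\<lambda>C::real^'d^'d. if C \<in> {C. sym_pos_def C} then mat_sqrt C else mat_sqrt (mat 1)) \<in> borel_measurable borel"
    by (intro borel_measurable_continuous_on_if sym_pos_def_borel continuous_on_mat_sqrt continuous_on_const)
  then have [measurable]: "(\<lambda>C::real^'d^'d. mat_sqrt (if sym_pos_def C then C else mat 1)) \<in> borel_measurable borel"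
    by (rule measurable_cong[THEN iffD1, rotated]) simp
  have [measurable]: "(\<lambda>u. u i) \<in> PiM {1..lam} (\<lambda>_. borel :: (real^'d) measure) \<rightarrow>\<^sub>M borel"
    using assms by (rule measurable_component_singleton)
  show ?thesis unfolding candidate_def borel_prod[symmetric] split_beta by measurable
qed

lemma measurable_upd [measurable]:
  assumes [measurable]: "g \<in> M \<rightarrow>\<^sub>M borel" and [measurable]: "\<And>i. i \<in> {1..mu} \<Longrightarrow> (\<lambda>x. y x i) \<in> M \<rightarrow>\<^sub>M borel"
  shows "(\<lambda>x. upd (g x) (y x)) \<in> M \<rightarrow>\<^sub>M borel"
proof -
  have [measurable]: "(\<lambda>x. fst (g x)) \<in> M \<rightarrow>\<^sub>M borel" "(\<lambda>x. snd (g x)) \<in> M \<rightarrow>\<^sub>M borel"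
    using assms(1) by (auto simp: borel_prod[symmetric])
  show ?thesis unfolding cma_update_def borel_prod[symmetric] by measurable
qed

lemma measurable_step [measurable]:
  "(\<lambda>(x, u). step x u) \<in> borel \<Otimes>\<^sub>M PiM {1..lam} (\<lambda>_. borel) \<rightarrow>\<^sub>M borel"
proof -
  let ?N = "(borel :: 'd state measure) \<Otimes>\<^sub>M PiM {1..lam} (\<lambda>_. borel :: (real^'d) measure)"
  define R where "R p = ranking lam (\<lambda>i. f (xstar + candidate (fst p) (snd p) i))" for p
  have cand: "(\<lambda>p. candidate (fst p) (snd p) i) \<in> ?N \<rightarrow>\<^sub>M borel" if "i \<in> {1..lam}" for i
    using measurable_candidate[OF that] by (simp add: split_beta')
  have R: "R \<in> ?N \<rightarrow>\<^sub>M count_space {s. s permutes {1..lam}}"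
    unfolding R_def
    by (rule measurable_ranking) (rule measurable_compose[OF _ measurable_f], intro borel_measurable_add cand, auto)
  have "(\<lambda>p. upd (fst p) (\<lambda>i. candidate (fst p) (snd p) (R p i))) \<in> ?N \<rightarrow>\<^sub>M borel"
  \<comment> \<open>For each fixed permutation the update is a measurable expression in the
    candidates; the ranking selects among finitely many of them.\<close>
  proof (rule measurable_compose_countable'[where f = "\<lambda>s p. upd (fst p) (\<lambda>i. candidate (fst p) (snd p) (s i))", OF _ R])
    fix s assume "s \<in> {s. s permutes {1..lam}}"
    then have "s i \<in> {1..lam}" if "i \<in> {1..mu}" for i
      using that mu permutes_in_image[of s "{1..lam}" i] by auto
    then show "(\<lambda>p. upd (fst p) (\<lambda>i. candidate (fst p) (snd p) (s i))) \<in> ?N \<rightarrow>\<^sub>M borel"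
      by (intro measurable_upd cand) auto
  qed (simp add: countable_finite finite_permutations)
  then have "(\<lambda>p. if fst p \<in> full_space then upd (fst p) (\<lambda>i. candidate (fst p) (snd p) (R p i)) else (0, mat 1))
      \<in> ?N \<rightarrow>\<^sub>M borel"
    by measurable
  moreover have "(if fst p \<in> full_space then upd (fst p) (\<lambda>i. candidate (fst p) (snd p) (R p i)) else (0, mat 1)) =
      (\<lambda>(x, u). step x u) p" for p
    by (auto simp: step_eq_upd R_def split_beta) (simp add: step_def)
  ultimately show ?thesis by simp
qed

abbreviation "X \<equiv> (normalized_space :: 'd state set)"
abbreviation "P \<equiv> normalized_kernel f xstar lam mu w c"

lemma P_eq: "x \<in> X \<Longrightarrow> P x = distr noise (borel_on X) (\<lambda>u. normalize' (step x u))"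
proof -
  assume x: "x \<in> X"
  have "normalize' (step x u) = normalized_state xstar (cma_mean f lam mu w (xstar + fst x) (snd x) u)
      (cma_cov f lam mu w c (xstar + fst x) (snd x) u)" for u
    using x normalized_space_subset_full step_full[of x u]
    by (auto simp: normalize'_def step_def cma_step_def normalized_state_eq)
  then show ?thesis by (simp add: normalized_kernel_def split_beta noise_def)
qed

lemma space_borel_on_X [simp]: "space (borel_on X) = X"
  by (simp add: space_restrict_space)

lemma measurable_step': "step x \<in> noise \<rightarrow>\<^sub>M borel"
proof -
  have "(\<lambda>u. (x, u)) \<in> noise \<rightarrow>\<^sub>M borel \<Otimes>\<^sub>M PiM {1..lam} (\<lambda>_. borel)" by measurable
  from measurable_compose[OF this measurable_step] show ?thesis by simp
qed

lemma markov_kernel_P: "markov_kernel X P"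
proof -
  have inj: "(\<lambda>p. (fst p, snd p)) \<in> borel_on X \<Otimes>\<^sub>M noise \<rightarrow>\<^sub>M borel \<Otimes>\<^sub>M PiM {1..lam} (\<lambda>_. borel)"
  proof (rule measurable_Pair)
    show "fst \<in> borel_on X \<Otimes>\<^sub>M noise \<rightarrow>\<^sub>M borel"
      using measurable_compose[OF measurable_fst measurable_restrict_space1[OF measurable_ident]] by simp
    show "snd \<in> borel_on X \<Otimes>\<^sub>M noise \<rightarrow>\<^sub>M PiM {1..lam} (\<lambda>_. borel)" by measurable
  qed
  have "(\<lambda>x. distr noise (borel_on X) (\<lambda>u. normalize' (step x u))) \<in> borel_on X \<rightarrow>\<^sub>M subprob_algebra (borel_on X)"
  proof (rule measurable_distr2)
    show "(\<lambda>(x, u). normalize' (step x u)) \<in> borel_on X \<Otimes>\<^sub>M noise \<rightarrow>\<^sub>M borel_on X"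
      using measurable_compose[OF measurable_compose[OF inj measurable_step] measurable_normalize']
      by (simp add: split_beta')
    show "(\<lambda>x. noise) \<in> borel_on X \<rightarrow>\<^sub>M subprob_algebra noise"
      using prob_space_noise
      by (intro measurable_const) (auto simp: space_subprob_algebra intro: prob_space_imp_subprob_space)
  qed
  then have "P \<in> borel_on X \<rightarrow>\<^sub>M subprob_algebra (borel_on X)"
    by (rule measurable_cong[THEN iffD1, rotated]) (simp add: P_eq)
  moreover have "prob_space (P x)" if "x \<in> X" for x
    unfolding P_eq[OF that]
    by (rule prob_space.prob_space_distr[OF prob_space_noise measurable_compose[OF measurable_step' measurable_normalize']])
  ultimately show ?thesis
    unfolding markov_kernel_def by (intro measurable_prob_algebraI) auto
qed

lemma P_subprob: "P \<in> borel_on X \<rightarrow>\<^sub>M subprob_algebra (borel_on X)"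
  using markov_kernel_P unfolding markov_kernel_def by (rule measurable_prob_algebraD)

text \<open>The transition operator of the chain before normalization, acting on functions of full
  states. All lower bounds are proved for it, since there the representative of a normalized state
  can be rescaled at will.\<close>

definition K :: "('d state \<Rightarrow> ennreal) \<Rightarrow> 'd state \<Rightarrow> ennreal" where
  "K h x = (\<integral>\<^sup>+u. h (step x u) \<partial>noise)"

lemma measurable_K [measurable]:
  assumes [measurable]: "h \<in> borel_measurable borel"
  shows "K h \<in> borel_measurable borel"
proof -
  interpret prob_space noise by (rule prob_space_noise)
  have "(\<lambda>(x, u). h (step x u)) \<in> borel \<Otimes>\<^sub>M PiM {1..lam} (\<lambda>_. borel) \<rightarrow>\<^sub>M borel"
    using measurable_compose[OF measurable_step assms] by (simp add: split_beta')
  then have "(\<lambda>(x, u). h (step x u)) \<in> borel \<Otimes>\<^sub>M noise \<rightarrow>\<^sub>M borel"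
    by (simp cong: measurable_cong_sets add: sets_pair_measure_cong[OF refl sets_noise])
  then show ?thesis unfolding K_def by (intro borel_measurable_nn_integral) simp
qed

lemma measurable_K_pow [measurable]: "h \<in> borel_measurable borel \<Longrightarrow> (K ^^ n) h \<in> borel_measurable borel"
  by (induction n) auto

lemma K_cong: "(\<And>x. x \<in> full_space \<Longrightarrow> h x = h' x) \<Longrightarrow> K h = K h'"
  by (rule ext) (simp add: K_def step_full)

lemma nn_integral_P:
  assumes x: "x \<in> full_space" and g: "g \<in> borel_measurable (borel_on X)"
  shows "(\<integral>\<^sup>+y. g y \<partial>P (normalize x)) = K (\<lambda>x. g (normalize' x)) x"
proof -
  have "(\<integral>\<^sup>+y. g y \<partial>P (normalize x)) = (\<integral>\<^sup>+u. g (normalize' (step (normalize x) u)) \<partial>noise)"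
    unfolding P_eq[OF normalize_in_space[OF x]]
    using measurable_compose[OF measurable_step' measurable_normalize'] g
    by (subst nn_integral_distr) auto
  also have "\<dots> = (\<integral>\<^sup>+u. g (normalize' (step x u)) \<partial>noise)"
    by (simp add: normalize'_def step_full normalize_step[OF x])
  finally show ?thesis by (simp add: K_def)
qed

lemma kernel_pow_subprob:
  assumes "x \<in> X"
  shows "kernel_pow X P n x \<in> space (subprob_algebra (borel_on X))"
proof (induction n)
  case 0
  show ?case using measurable_space[OF return_measurable, of x "borel_on X"] assms by simp
next
  case (Suc n)
  have "kernel_pow X P n x \<bind> P \<in> space (subprob_algebra (borel_on X))"
  proof -
    have "(\<lambda>M. M \<bind> P) \<in> subprob_algebra (borel_on X) \<rightarrow>\<^sub>M subprob_algebra (borel_on X)"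
      by (intro measurable_bind2 measurable_const measurable_ident) (use P_subprob in auto)
    from measurable_space[OF this Suc] show ?thesis .
  qed
  then show ?case by simp
qed

text \<open>Normalization intertwines the two chains. The left side depends on \<open>x\<close> only
  through \<open>normalize x\<close>, so the right side may be estimated at whichever representative
  is convenient.\<close>

lemma nn_integral_kernel_pow:
  assumes x: "x \<in> full_space" and g: "g \<in> borel_measurable (borel_on X)"
  shows "(\<integral>\<^sup>+y. g y \<partial>kernel_pow X P n (normalize x)) = (K ^^ n) (\<lambda>x. g (normalize' x)) x"
  using g
proof (induction n arbitrary: g)
  case 0
  then show ?case
    using normalize_in_space[OF x] x by (simp add: nn_integral_return normalize'_def)
next
  case (Suc n)
  have sets: "sets (kernel_pow X P n (normalize x)) = sets (borel_on X)"
    using kernel_pow_subprob[OF normalize_in_space[OF x], of n] by (simp add: space_subprob_algebra)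
  have PM: "P \<in> kernel_pow X P n (normalize x) \<rightarrow>\<^sub>M subprob_algebra (borel_on X)"
    using P_subprob by (simp cong: measurable_cong_sets add: sets)
  have gP: "(\<lambda>y. \<integral>\<^sup>+z. g z \<partial>P y) \<in> borel_measurable (borel_on X)"
    using measurable_compose[OF P_subprob nn_integral_measurable_subprob_algebra[OF Suc.prems]] .
  have "(\<integral>\<^sup>+y. g y \<partial>kernel_pow X P (Suc n) (normalize x)) =
      (\<integral>\<^sup>+y. (\<integral>\<^sup>+z. g z \<partial>P y) \<partial>kernel_pow X P n (normalize x))"
    by (simp add: nn_integral_bind[OF Suc.prems PM])
  also have "\<dots> = (K ^^ n) (\<lambda>x. \<integral>\<^sup>+z. g z \<partial>P (normalize' x)) x"
    by (rule Suc.IH[OF gP])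
  also have "\<dots> = (K ^^ n) (K (\<lambda>x. g (normalize' x))) x"
  proof -
    have eq: "(\<integral>\<^sup>+z. g z \<partial>P (normalize' y)) = K (\<lambda>x. g (normalize' x)) y" if "y \<in> full_space" for y
      using nn_integral_P[OF that Suc.prems] that by (simp add: normalize'_def)
    show ?thesis
    \<comment> \<open>\<open>normalize'\<close> and \<open>normalize\<close> agree on admissible
      states only: for \<open>n = 0\<close> the function is evaluated at \<open>x\<close> itself,
      otherwise after a step, which is always admissible.\<close>
    proof (cases n)
      case 0 then show ?thesis using eq[OF x] by simp
    next
      case (Suc k)
      then show ?thesis
        using K_cong[of "\<lambda>x. \<integral>\<^sup>+z. g z \<partial>P (normalize' x)", OF eq]
        by (simp only: Suc funpow_Suc_right o_def)
    qed
  qed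
  finally show ?case by (simp add: funpow_swap1)
qed

end

section \<open>The normalized states form a homogeneous Markov chain\<close>

context cma_es begin

lemma integral_step_eq_measure_P:
  assumes x: "x \<in> X" and A: "A \<in> sets (borel_on X)"
  shows "(\<integral>u. indicator A (normalize' (step x u)) \<partial>noise) = measure (P x) A"
proof -
  interpret N: prob_space noise by (rule prob_space_noise)
  have m: "(\<lambda>u. normalize' (step x u)) \<in> noise \<rightarrow>\<^sub>M borel_on X"
    by (rule measurable_compose[OF measurable_step' measurable_normalize'])
  have "measure (P x) A = measure noise ((\<lambda>u. normalize' (step x u)) -` A \<inter> space noise)"
    unfolding P_eq[OF x] using m A by (rule measure_distr)
  also have "\<dots> = (\<integral>u. indicator ((\<lambda>u. normalize' (step x u)) -` A \<inter> space noise) u \<partial>noise)"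
    by simp
  also have "\<dots> = (\<integral>u. indicator A (normalize' (step x u)) \<partial>noise)"
    by (intro Bochner_Integration.integral_cong) (auto split: split_indicator)
  finally show ?thesis by simp
qed

text \<open>The next normalized state is a measurable function of the current one and of a block of
  samples independent of the past, so conditioning on the past integrates out the block
  alone.\<close>

lemma homogeneous_chain:
  fixes M :: "'w measure"
  assumes run: "cma_es_run M f lam mu w c m C U"
  shows "homogeneous_markov_chain M X P (\<lambda>k \<omega>. normalized_state xstar (m k \<omega>) (C k \<omega>))"
proof -
  interpret run: cma_es_run M f lam mu w c m C U by (rule run)
  define x where "x k \<omega> = (m k \<omega> - xstar, C k \<omega>)" for k \<omega>
  define \<theta> where "\<theta> k \<omega> = normalized_state xstar (m k \<omega>) (C k \<omega>)" for k \<omega>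
  define I where "I = {1..lam}"
  define u where "u k \<omega> = (\<lambda>i\<in>I. U (Suc k) i \<omega>)" for k \<omega>
  let ?PI = "PiM I (\<lambda>_. borel :: (real^'d) measure)"
  let ?B = "borel_on X"
  have x0: "x 0 \<omega> \<in> full_space" if "\<omega> \<in> space M" for \<omega>
    using run.init[OF that] by (simp add: x_def full_space_def)
  have xS: "x (Suc k) \<omega> = step (x k \<omega>) (u k \<omega>)" if "\<omega> \<in> space M" "x k \<omega> \<in> full_space" for k \<omega>
  proof -
    have "x (Suc k) \<omega> = step (x k \<omega>) (\<lambda>i. U (Suc k) i \<omega>)"
      using that by (simp add: x_def step_def cma_step_def run.mean_step run.cov_step)
    also have "\<dots> = step (x k \<omega>) (u k \<omega>)"
      by (rule step_cong) (simp add: u_def I_def)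
    finally show ?thesis .
  qed
  have x_full: "x k \<omega> \<in> full_space" if "\<omega> \<in> space M" for k \<omega>
    by (induction k) (use x0 xS that step_full in auto)
  have \<theta>x: "\<theta> k \<omega> = normalize (x k \<omega>)" for k \<omega>
    by (simp add: \<theta>_def x_def normalized_state_eq)
  have \<theta>X: "\<theta> k \<omega> \<in> X" if "\<omega> \<in> space M" for k \<omega>
    using x_full[OF that] by (simp add: \<theta>x normalize_in_space)
  have \<theta>S: "\<theta> (Suc k) \<omega> = normalize' (step (\<theta> k \<omega>) (u k \<omega>))" if "\<omega> \<in> space M" for k \<omega>
    using x_full[OF that] by (simp add: \<theta>x xS that normalize_step normalize'_def step_full)
  have Um: "U (Suc k) i \<in> borel_measurable M" if "i \<in> I" for k i
    using run.sample_indep[of k] that by (auto simp: run.indep_vars_def I_def)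
  have um: "u k \<in> M \<rightarrow>\<^sub>M ?PI" for k
    unfolding u_def by (intro measurable_restrict Um)
  have um_distr: "distr M ?PI (u k) = noise" for k
  proof -
    have "distr M ?PI (u k) = PiM I (\<lambda>i. distr M borel (U (Suc k) i))"
      unfolding u_def using run.sample_indep[of k] mu Um
      by (intro run.indep_vars_iff_distr_eq_PiM'[THEN iffD1]) (auto simp: I_def)
    also have "\<dots> = noise"
      unfolding noise_def I_def by (intro PiM_cong) (simp_all add: run.sample_law)
    finally show ?thesis .
  qed
  have xm: "x k \<in> borel_measurable M" for k
    using run.mean_measurable run.cov_measurable unfolding x_def borel_prod[symmetric] by measurable
  have \<theta>m: "\<theta> k \<in> M \<rightarrow>\<^sub>M ?B" for k
  proof -
    have "(\<lambda>\<omega>. normalize' (x k \<omega>)) \<in> M \<rightarrow>\<^sub>M ?B"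
      by (rule measurable_compose[OF xm measurable_normalize'])
    then show ?thesis
      by (rule measurable_cong[THEN iffD1, rotated]) (simp add: \<theta>x normalize'_def x_full)
  qed
  have "AE \<omega> in M.
          real_cond_exp M
            (vimage_algebra (space M) (\<lambda>\<omega>. \<lambda>i\<in>{..k}. \<theta> i \<omega>) (PiM {..k} (\<lambda>_. ?B)))
            (\<lambda>\<omega>. indicator A (\<theta> (Suc k) \<omega>)) \<omega>
          = measure (P (\<theta> k \<omega>)) A" if A: "A \<in> sets ?B" for k A
  proof -
    define S where "S = PiM {..k} (\<lambda>_::nat. ?B)"
    define Z where "Z \<omega> = (\<lambda>i\<in>{..k}. \<theta> i \<omega>)" for \<omega>
    define F where "F = vimage_algebra (space M) Z S"
    have Zm: "Z \<in> M \<rightarrow>\<^sub>M S"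
      unfolding S_def Z_def by (intro measurable_restrict \<theta>m)
    define past where "past \<omega> = (\<lambda>j\<in>{..k}. (m j \<omega>, C j \<omega>), \<lambda>j\<in>{1..k}. \<lambda>i\<in>{1..lam}. U j i \<omega>)" for \<omega>
    define N where "N = (PiM {..k} (\<lambda>_. borel :: 'd state measure) \<Otimes>\<^sub>M
        PiM {1..k} (\<lambda>_. PiM {1..lam} (\<lambda>_. borel :: (real^'d) measure)))"
    have pm: "past \<in> M \<rightarrow>\<^sub>M N"
    proof -
      have "(\<lambda>\<omega>. (m j \<omega>, C j \<omega>)) \<in> borel_measurable M" for j
        using run.mean_measurable run.cov_measurable unfolding borel_prod[symmetric] by measurable
      \<comment> \<open>The block \<open>u k\<close> consists of the samples
        \<open>U (Suc k)\<close>, hence the samples \<open>U j\<close> form the block with index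
        \<open>j - 1\<close>.\<close>
      moreover have "(\<lambda>\<omega>. \<lambda>i\<in>{1..lam}. U j i \<omega>) \<in> M \<rightarrow>\<^sub>M PiM {1..lam} (\<lambda>_. borel)" if "j \<in> {1..k}" for j
        using um[of "j - 1"] that by (simp add: u_def[abs_def] I_def)
      ultimately show ?thesis
        unfolding past_def N_def by - (intro measurable_Pair; rule measurable_restrict; blast)
    qed
    have indep_past: "run.prob (past -` A' \<inter> space M \<inter> (u k -` B' \<inter> space M)) =
        run.prob (past -` A' \<inter> space M) * run.prob (u k -` B' \<inter> space M)"
      if "A' \<in> sets N" "B' \<in> sets ?PI" for A' B'
      using run.past_indep[of k] in_vimage_algebra[OF that(1), of past "space M"]
        in_vimage_algebra[OF that(2), of "u k" "space M"]
      unfolding run.indep_sets2_eq past_def[abs_def] N_def u_def[abs_def] I_def by blast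
    define \<phi> where "\<phi> p = (\<lambda>i\<in>{..k}. normalize' (fst (fst p i) - xstar, snd (fst p i)))"
      for p :: "(nat \<Rightarrow> 'd state) \<times> (nat \<Rightarrow> nat \<Rightarrow> real^'d)"
    have \<phi>m: "\<phi> \<in> N \<rightarrow>\<^sub>M S"
      unfolding \<phi>_def S_def
    proof (rule measurable_restrict)
      fix i assume i: "i \<in> {..k}"
      have "(\<lambda>p. fst p i) \<in> N \<rightarrow>\<^sub>M (borel :: 'd state measure)"
        unfolding N_def using measurable_compose[OF measurable_fst measurable_component_singleton[OF i]] .
      then have "(\<lambda>p. (fst (fst p i) - xstar, snd (fst p i))) \<in> N \<rightarrow>\<^sub>M (borel :: 'd state measure)"
        unfolding borel_prod[symmetric] by measurable
      then show "(\<lambda>p. normalize' (fst (fst p i) - xstar, snd (fst p i))) \<in> N \<rightarrow>\<^sub>M ?B"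
        by (rule measurable_compose[OF _ measurable_normalize'])
    qed
    \<comment> \<open>The history of normalized states written as a function of \<open>past\<close>,
      so that independence of \<open>past\<close> passes to it. It agrees with \<open>Z\<close> on
      the sample space because \<open>\<phi>\<close> uses the totalised normalization.\<close>
    define Z' where "Z' = \<phi> \<circ> past"
    have ZZ': "Z' \<omega> = Z \<omega>" if "\<omega> \<in> space M" for \<omega>
      unfolding Z'_def \<phi>_def Z_def past_def o_def
      using x_full[OF that] by (intro restrict_ext) (simp add: \<theta>x x_def normalize'_def)
    have Z'm: "Z' \<in> M \<rightarrow>\<^sub>M S"
      unfolding Z'_def by (rule measurable_comp[OF pm \<phi>m])
    \<comment> \<open>Independence as a product law, checked on rectangles; this is the form to
      which Fubini's theorem applies.\<close>
    have joint: "distr M S Z' \<Otimes>\<^sub>M noise = distr M (S \<Otimes>\<^sub>M ?PI) (\<lambda>\<omega>. (Z' \<omega>, u k \<omega>))"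
    proof (rule pair_measure_eqI)
      show "sigma_finite_measure (distr M S Z')" "sigma_finite_measure noise"
        using run.prob_space_distr[OF Z'm] prob_space_noise by (auto intro: prob_space_imp_sigma_finite)
      show "sets (distr M S Z' \<Otimes>\<^sub>M noise) = sets (distr M (S \<Otimes>\<^sub>M ?PI) (\<lambda>\<omega>. (Z' \<omega>, u k \<omega>)))"
        using sets_noise by (simp add: I_def cong: sets_pair_measure_cong)
      fix A' B' assume "A' \<in> sets (distr M S Z')" "B' \<in> sets noise"
      then have AB: "A' \<in> sets S" "B' \<in> sets ?PI" using sets_noise by (simp_all add: I_def)
      have eq: "Z' -` A' \<inter> space M = past -` (\<phi> -` A' \<inter> space N) \<inter> space M"
        using measurable_space[OF pm] by (auto simp: Z'_def)
      have "emeasure (distr M (S \<Otimes>\<^sub>M ?PI) (\<lambda>\<omega>. (Z' \<omega>, u k \<omega>))) (A' \<times> B') =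
          emeasure M (Z' -` A' \<inter> space M \<inter> (u k -` B' \<inter> space M))"
        using Z'm um AB by (subst emeasure_distr) (auto intro!: arg_cong[where f = "emeasure M"])
      also have "\<dots> = emeasure M (Z' -` A' \<inter> space M) * emeasure M (u k -` B' \<inter> space M)"
        unfolding eq using indep_past[OF measurable_sets[OF \<phi>m AB(1)] AB(2)]
        by (simp add: run.emeasure_eq_measure ennreal_mult')
      also have "\<dots> = emeasure (distr M S Z') A' * emeasure noise B'"
        using Z'm um AB by (simp add: emeasure_distr um_distr[symmetric, of k])
      finally show "emeasure (distr M S Z') A' * emeasure noise B' =
          emeasure (distr M (S \<Otimes>\<^sub>M ?PI) (\<lambda>\<omega>. (Z' \<omega>, u k \<omega>))) (A' \<times> B')" by simp
    qed
    have Zk: "Z \<omega> k = \<theta> k \<omega>" for \<omega> by (simp add: Z_def)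
    have comp_k: "(\<lambda>z. z k) \<in> S \<rightarrow>\<^sub>M ?B"
      unfolding S_def by (rule measurable_component_singleton) simp
    have PA: "(\<lambda>y. measure (P y) A) \<in> borel_measurable ?B"
      unfolding measure_def using P_subprob A by measurable
    have gm: "(\<lambda>z. measure (P (z k)) A) \<in> borel_measurable S"
      by (rule measurable_compose[OF comp_k PA])
    have le1: "measure (P y) A \<le> 1" if "y \<in> X" for y
      using markov_kernel_P that unfolding markov_kernel_def
      by (intro prob_space.prob_le_1) (auto dest!: measurable_space simp: space_prob_algebra)
    have sub: "subalgebra M F"
      unfolding F_def subalgebra_def using Zm by (auto simp: sets_vimage_algebra2 measurable_space)
    interpret F: sigma_finite_subalgebra M F
      by (rule finite_measure_subalgebra_is_sigma_finite)
        (simp add: finite_measure_subalgebra_def sub finite_measure_subalgebra_axioms_def run.finite_measure_axioms)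
    have "AE \<omega> in M. real_cond_exp M F (\<lambda>\<omega>. indicator A (\<theta> (Suc k) \<omega>)) \<omega> = measure (P (\<theta> k \<omega>)) A"
    proof (rule F.real_cond_exp_charact)
      fix B assume "B \<in> sets F"
      then obtain B' where B': "B' \<in> sets S" "B = Z -` B' \<inter> space M"
        unfolding F_def using Zm by (auto simp: sets_vimage_algebra2 measurable_space)
      \<comment> \<open>The integrand of the set integral over \<open>B\<close> as a function of
        history and fresh block. Its integral over the block is the indicator of \<open>B'\<close>
        times the kernel.\<close>
      define h where "h p = indicator B' (fst p) * (indicator A (normalize' (step (fst p k) (snd p))) :: real)"
        for p :: "(nat \<Rightarrow> 'd state) \<times> (nat \<Rightarrow> real^'d)"
      have hm: "h \<in> borel_measurable (S \<Otimes>\<^sub>M ?PI)"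
      proof -
        have "(\<lambda>p. (fst p k, snd p)) \<in> S \<Otimes>\<^sub>M ?PI \<rightarrow>\<^sub>M borel \<Otimes>\<^sub>M ?PI"
          using measurable_compose[OF measurable_compose[OF measurable_fst comp_k] measurable_restrict_space1[OF measurable_ident]]
          by (intro measurable_Pair measurable_snd) auto
        from measurable_compose[OF measurable_compose[OF this measurable_step[folded I_def]] measurable_normalize']
        have "(\<lambda>p. normalize' (step (fst p k) (snd p))) \<in> S \<Otimes>\<^sub>M ?PI \<rightarrow>\<^sub>M ?B" by simp
        then show ?thesis unfolding h_def
          using A B' by (intro borel_measurable_times borel_measurable_indicator'
              measurable_compose[OF _ borel_measurable_indicator] measurable_fst) auto
      qed
      interpret D: prob_space "distr M S Z'" using Z'm by (rule run.prob_space_distr)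
      interpret N: prob_space noise by (rule prob_space_noise)
      interpret DN: pair_prob_space "distr M S Z'" noise ..
      have hb: "norm (h p) \<le> 1" for p by (auto simp: h_def split: split_indicator)
      have setsDN: "sets (distr M S Z' \<Otimes>\<^sub>M noise) = sets (S \<Otimes>\<^sub>M ?PI)"
        using sets_noise by (intro sets_pair_measure_cong) (auto simp: I_def)
      have hi: "integrable (distr M S Z' \<Otimes>\<^sub>M noise) h"
        using hm unfolding measurable_cong_sets[OF setsDN refl, symmetric]
        by (intro DN.P.integrable_const_bound[of _ 1]) (simp_all only: hb eventually_True)
      have "(\<integral>\<omega>\<in>B. indicator A (\<theta> (Suc k) \<omega>) \<partial>M) = (\<integral>\<omega>. h (Z' \<omega>, u k \<omega>) \<partial>M)"
        unfolding set_lebesgue_integral_def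
        by (intro Bochner_Integration.integral_cong) (auto simp: h_def B' \<theta>S ZZ' Zk split: split_indicator)
      also have "\<dots> = (\<integral>p. h p \<partial>(distr M S Z' \<Otimes>\<^sub>M noise))"
        unfolding joint using Z'm um hm by (subst integral_distr) auto
      also have "\<dots> = (\<integral>z. (\<integral>v. h (z, v) \<partial>noise) \<partial>distr M S Z')"
        using DN.integral_fst'[OF hi] by simp
      also have "\<dots> = (\<integral>z. indicator B' z * measure (P (z k)) A \<partial>distr M S Z')"
      proof (rule Bochner_Integration.integral_cong)
        fix z assume "z \<in> space (distr M S Z')"
        then have "z k \<in> X" using measurable_space[OF comp_k, of z] by simp
        then show "(\<integral>v. h (z, v) \<partial>noise) = indicator B' z * measure (P (z k)) A"
          using integral_step_eq_measure_P[OF _ A] by (simp add: h_def)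
      qed simp
      also have "\<dots> = (\<integral>\<omega>. indicator B' (Z' \<omega>) * measure (P (Z' \<omega> k)) A \<partial>M)"
        using Z'm gm B' by (subst integral_distr) auto
      also have "\<dots> = (\<integral>\<omega>\<in>B. measure (P (\<theta> k \<omega>)) A \<partial>M)"
        unfolding set_lebesgue_integral_def
        by (intro Bochner_Integration.integral_cong) (auto simp: B' ZZ' Zk split: split_indicator)
      finally show "(\<integral>\<omega>\<in>B. indicator A (\<theta> (Suc k) \<omega>) \<partial>M) = (\<integral>\<omega>\<in>B. measure (P (\<theta> k \<omega>)) A \<partial>M)" .
    next
      have "(\<lambda>\<omega>. indicator A (\<theta> (Suc k) \<omega>) :: real) \<in> borel_measurable M"
        by (rule measurable_compose[OF \<theta>m borel_measurable_indicator[OF A]])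
      then show "integrable M (\<lambda>\<omega>. indicator A (\<theta> (Suc k) \<omega>) :: real)"
        by (intro run.integrable_const_bound[of _ 1]) (auto split: split_indicator)
    next
      show "integrable M (\<lambda>\<omega>. measure (P (\<theta> k \<omega>)) A)"
        using measurable_compose[OF \<theta>m PA] le1 \<theta>X
        by (intro run.integrable_const_bound[of _ 1]) auto
      have "Z \<in> F \<rightarrow>\<^sub>M S"
        unfolding F_def using measurable_space[OF Zm] by (intro measurable_vimage_algebra1) auto
      from measurable_compose[OF this gm]
      show "(\<lambda>\<omega>. measure (P (\<theta> k \<omega>)) A) \<in> borel_measurable F" by (simp add: Zk)
    qed
    then show ?thesis by (simp add: F_def Z_def[abs_def] S_def)
  qed
  then show ?thesis
    unfolding homogeneous_markov_chain_def
    using markov_kernel_P \<theta>m run.prob_space_axioms by (simp add: \<theta>_def[abs_def])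
qed

end

section \<open>Absorption of rank-one perturbations\<close>

lemma Basis_vec_eq: "(Basis :: ('a::euclidean_space^'m) set) = (\<lambda>(i, b). axis i b) ` (UNIV \<times> Basis)"
  by (auto simp: Basis_vec_def)

lemma prod_Basis_vec_vec:
  "(\<Prod>b\<in>(Basis::('a::euclidean_space^'m) set). h b) = (\<Prod>i\<in>UNIV. \<Prod>b\<in>Basis. h (axis i b))"
proof -
  have inj: "inj_on (\<lambda>(i, b). axis i b) ((UNIV::'m set) \<times> (Basis::'a set))"
    by (auto simp: inj_on_def axis_eq_axis nonzero_Basis)
  have "prod h ((\<lambda>(i, b). axis i b) ` ((UNIV::'m set) \<times> (Basis::'a set))) =
      (\<Prod>(i,b)\<in>UNIV \<times> Basis. h (axis i b))"
    by (subst prod.reindex[OF inj]) (simp add: split_beta')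
  also have "\<dots> = (\<Prod>i\<in>UNIV. \<Prod>b\<in>Basis. h (axis i b))"
    by (simp add: prod.cartesian_product)
  finally show ?thesis by (simp only: Basis_vec_eq)
qed

lemma measurable_vec_lambda [measurable]:
  "(\<lambda>r. \<chi> i. r i) \<in> PiM UNIV (\<lambda>_::'m::finite. borel) \<rightarrow>\<^sub>M (borel :: ('a::euclidean_space^'m) measure)"
proof (subst borel_measurable_euclidean_space, intro ballI)
  fix b :: "'a^'m" assume "b \<in> Basis"
  then obtain i b' where b: "b = axis i b'" by (auto simp: Basis_vec_def)
  have "(\<lambda>r. r i \<bullet> b') \<in> PiM UNIV (\<lambda>_::'m. borel :: 'a measure) \<rightarrow>\<^sub>M borel"
    by (intro borel_measurable_inner measurable_component_singleton measurable_const) auto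
  then show "(\<lambda>r. (\<chi> i. r i) \<bullet> b) \<in> PiM UNIV (\<lambda>_::'m. borel :: 'a measure) \<rightarrow>\<^sub>M borel"
    by (simp add: b inner_axis)
qed

text \<open>A box of matrices is the product of the boxes of its rows. This links integration over a
  matrix \<open>R\<close> to integration over the independent vectors of the double steps, which are
  its rows.\<close>

lemma lborel_vec_eq_distr_PiM:
  "lborel = distr (PiM UNIV (\<lambda>_::'m::finite. lborel)) borel (\<lambda>r. (\<chi> i. r i) :: 'a::euclidean_space^'m)"
proof (rule lborel_eqI)
  fix l u :: "'a^'m" assume le: "\<And>b. b \<in> Basis \<Longrightarrow> l \<bullet> b \<le> u \<bullet> b"
  interpret product_sigma_finite "\<lambda>_::'m. lborel :: 'a measure" ..
  have le': "(l $ i) \<bullet> b \<le> (u $ i) \<bullet> b" if "b \<in> Basis" for i b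
    using le[of "axis i b"] that by (auto simp: inner_axis Basis_vec_def)
  have box: "(\<chi> i. r i) \<in> box l u \<longleftrightarrow> (\<forall>i. r i \<in> box (l $ i) (u $ i))" for r
    by (auto simp: mem_box Basis_vec_def inner_axis)
  have sets: "sets (PiM UNIV (\<lambda>_::'m. lborel :: 'a measure)) = sets (PiM UNIV (\<lambda>_. borel))"
    by (intro sets_PiM_cong) auto
  have "emeasure (distr (PiM UNIV (\<lambda>_::'m. lborel)) borel (\<lambda>r. \<chi> i. r i)) (box l u) =
      emeasure (PiM UNIV (\<lambda>_::'m. lborel)) (PiE UNIV (\<lambda>i. box (l $ i) (u $ i)))"
    using measurable_vec_lambda
    by (subst emeasure_distr) (auto simp: box space_PiM PiE_iff measurable_cong_sets[OF sets refl]
        intro!: arg_cong[where f = "emeasure _"])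
  also have "\<dots> = (\<Prod>i\<in>UNIV. emeasure lborel (box (l $ i) (u $ i)))"
    by (subst emeasure_PiM) auto
  also have "\<dots> = (\<Prod>i\<in>UNIV. ennreal (\<Prod>b\<in>Basis. (u $ i - l $ i) \<bullet> b))"
    using le' by (intro prod.cong refl emeasure_lborel_box)
  also have "\<dots> = ennreal (\<Prod>i\<in>UNIV. \<Prod>b\<in>Basis. (u $ i - l $ i) \<bullet> b)"
    using le' by (subst prod_ennreal) (auto intro!: prod_nonneg simp: inner_diff_left)
  also have "(\<Prod>i\<in>UNIV. \<Prod>b\<in>Basis. (u $ i - l $ i) \<bullet> b) = (\<Prod>b\<in>Basis. (u - l) \<bullet> b)"
    by (simp add: prod_Basis_vec_vec inner_axis)
  finally show "emeasure (distr (PiM UNIV (\<lambda>_::'m. lborel)) borel (\<lambda>r. \<chi> i. r i)) (box l u) =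
    ennreal (\<Prod>b\<in>Basis. (u - l) \<bullet> b)" .
qed simp

lemma nn_integral_lborel_vec:
  fixes h :: "'a::euclidean_space^'m \<Rightarrow> ennreal"
  assumes "h \<in> borel_measurable borel"
  shows "(\<integral>\<^sup>+x. h x \<partial>lborel) = (\<integral>\<^sup>+r. h (\<chi> i. r i) \<partial>PiM UNIV (\<lambda>_. lborel))"
proof -
  have sets: "sets (PiM UNIV (\<lambda>_::'m. lborel :: 'a measure)) = sets (PiM UNIV (\<lambda>_. borel))"
    by (intro sets_PiM_cong) auto
  show ?thesis
    using measurable_vec_lambda assms
    by (subst lborel_vec_eq_distr_PiM, subst nn_integral_distr) (auto simp: measurable_cong_sets[OF sets refl])
qed

text \<open>This is \<open>R\<^sup>T D R\<close> with \<open>D\<close> the diagonal matrix of the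
  weights; the rows of \<open>R\<close> are the vectors being squared.\<close>

definition weighted_gram :: "('d \<Rightarrow> real) \<Rightarrow> real^'d^'d \<Rightarrow> real^'d^'d" where
  "weighted_gram \<omega> R = (\<Sum>j\<in>UNIV. \<omega> j *\<^sub>R outer_square (R $ j))"

lemma continuous_weighted_gram: "continuous_on UNIV (weighted_gram \<omega>)"
  unfolding weighted_gram_def
  by (intro continuous_intros continuous_on_compose2[OF continuous_outer_square]) auto

lemma measurable_weighted_gram [measurable]: "weighted_gram \<omega> \<in> borel \<rightarrow>\<^sub>M borel"
  by (rule borel_measurable_continuous_onI[OF continuous_weighted_gram])

lemma norm_rank_one: "norm ((\<chi> j. b $ j *\<^sub>R v) :: real^'d^'m) = norm b * norm v"
proof -
  have "norm ((\<chi> j. b $ j *\<^sub>R v) :: real^'d^'m) = L2_set (\<lambda>j. norm (b $ j) * norm v) UNIV"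
    by (simp add: norm_vec_def[of "\<chi> j. b $ j *\<^sub>R v"])
  also have "\<dots> = norm b * norm v"
    by (subst L2_set_left_distrib[symmetric]) (auto simp: norm_vec_def)
  finally show ?thesis .
qed

lemma norm_transpose: "norm (transpose A) = norm (A :: real^'n^'m)"
  by (simp add: norm_eq_sqrt_inner inner_transpose)

lemma transpose_mult_vector: "transpose R *v a = (\<Sum>j\<in>UNIV. a $ j *\<^sub>R R $ j)"
  for R :: "real^'d^'m"
  by (simp add: vec_eq_iff matrix_vector_mult_def transpose_def mult.commute)

text \<open>A rank-one update \<open>outer_square v\<close> of a weighted Gram matrix is absorbed by an explicit
  Lipschitz change of its factor. With \<open>v = \<Sum>\<^sub>j a\<^sub>j R\<^sub>j\<close> and \<open>u\<^sub>j = a\<^sub>j / sqrt \<omega>\<^sub>j\<close> it multiplies the factor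
  by the square root \<open>1 + t u u\<^sup>T\<close> of \<open>1 + u u\<^sup>T\<close>, where \<open>t = 1 / (1 + sqrt (1 + \<bar>u\<bar>\<^sup>2))\<close>.\<close>

definition absorb_scale :: "('d::finite \<Rightarrow> real) \<Rightarrow> real^'d \<Rightarrow> real" where
  "absorb_scale \<omega> a = 1 / (1 + norm (1::real, \<chi> j. a $ j / sqrt (\<omega> j)))"

definition absorb :: "('d::finite \<Rightarrow> real) \<Rightarrow> real^'d \<Rightarrow> real^'d^'d \<Rightarrow> real^'d^'d" where
  "absorb \<omega> v R =
     (let a = matrix_inv (transpose R) *v v in R + (\<chi> j. (a $ j * absorb_scale \<omega> a / \<omega> j) *\<^sub>R v))"

lemma weighted_gram_absorb:
  assumes \<omega>: "\<And>j. \<omega> j > 0" and inv: "transpose R *v (matrix_inv (transpose R) *v v) = v"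
  shows "weighted_gram \<omega> (absorb \<omega> v R) = weighted_gram \<omega> R + outer_square v"
proof -
  define a where "a = matrix_inv (transpose R) *v v"
  define t where "t = absorb_scale \<omega> a"
  define s where "s = (\<Sum>j\<in>UNIV. (a $ j)\<^sup>2 / \<omega> j)"
  have s0: "s \<ge> 0" unfolding s_def by (intro sum_nonneg divide_nonneg_nonneg) (simp_all add: less_imp_le[OF \<omega>])
  have "(norm (\<chi> j. a $ j / sqrt (\<omega> j)))\<^sup>2 = (\<Sum>j\<in>UNIV. (a $ j / sqrt (\<omega> j)) * (a $ j / sqrt (\<omega> j)))"
    by (simp only: power2_norm_eq_inner inner_vec_def inner_real_def vec_lambda_beta)
  also have "\<dots> = s"
    unfolding s_def using less_imp_le[OF \<omega>] by (intro sum.cong) (auto simp: power2_eq_square)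
  finally have "(norm (\<chi> j. a $ j / sqrt (\<omega> j)))\<^sup>2 = s" .
  then have t: "t = 1 / (1 + sqrt (1 + s))"
    by (simp add: t_def absorb_scale_def norm_Pair)
  \<comment> \<open>The condition for \<open>1 + t u u\<^sup>T\<close> to square to
    \<open>1 + u u\<^sup>T\<close>, where \<open>s\<close> is the squared norm of
    \<open>u\<close>.\<close>
  have t1: "2 * t + t\<^sup>2 * s = 1"
  proof -
    define q where "q = sqrt (1 + s)"
    have q: "q\<^sup>2 = 1 + s" "q \<ge> 1" using s0 by (auto simp: q_def)
    then have s: "s = (q - 1) * (q + 1)" by (simp add: power2_eq_square algebra_simps)
    have "t = 1 / (1 + q)" by (simp add: t q_def)
    then have "(q + 1) * t = 1" using q(2) by simp
    moreover have "t\<^sup>2 * s = ((q - 1) * t) * ((q + 1) * t)"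
      unfolding s by (simp add: power2_eq_square)
    ultimately show ?thesis by (simp add: algebra_simps)
  qed
  have v: "(\<Sum>j\<in>UNIV. a $ j * R $ j $ k) = v $ k" for k
  proof -
    have "(\<Sum>j\<in>UNIV. a $ j *\<^sub>R R $ j) = v"
      using inv unfolding a_def[symmetric] transpose_mult_vector .
    then have "(\<Sum>j\<in>UNIV. a $ j *\<^sub>R R $ j) $ k = v $ k" by simp
    then show ?thesis by simp
  qed
  have "weighted_gram \<omega> (absorb \<omega> v R) $ k $ l = weighted_gram \<omega> R $ k $ l + outer_square v $ k $ l" for k l
  proof -
    have "\<omega> j * ((R $ j $ k + a $ j * t / \<omega> j * v $ k) * (R $ j $ l + a $ j * t / \<omega> j * v $ l)) =
        \<omega> j * (R $ j $ k * R $ j $ l) + t * v $ l * (a $ j * R $ j $ k) + t * v $ k * (a $ j * R $ j $ l)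
          + t\<^sup>2 * (v $ k * v $ l) * ((a $ j)\<^sup>2 / \<omega> j)" for j
      using \<omega>[of j] by (simp add: field_simps power2_eq_square)
    note expand = this
    have "weighted_gram \<omega> (absorb \<omega> v R) $ k $ l =
        (\<Sum>j\<in>UNIV. \<omega> j * ((R $ j $ k + a $ j * t / \<omega> j * v $ k) * (R $ j $ l + a $ j * t / \<omega> j * v $ l)))"
      by (simp add: weighted_gram_def absorb_def Let_def a_def[symmetric] t_def[symmetric] outer_square_component)
    also have "\<dots> = (\<Sum>j\<in>UNIV. \<omega> j * (R $ j $ k * R $ j $ l)) + t * v $ l * v $ k + t * v $ k * v $ l
        + t\<^sup>2 * (v $ k * v $ l) * s"
      by (simp only: expand sum.distrib sum_distrib_left[symmetric] v s_def[symmetric])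
    also have "\<dots> = (\<Sum>j\<in>UNIV. \<omega> j * (R $ j $ k * R $ j $ l)) + (2 * t + t\<^sup>2 * s) * (v $ k * v $ l)"
      by (simp add: algebra_simps)
    finally show ?thesis unfolding t1 by (simp add: weighted_gram_def outer_square_component)
  qed
  then show ?thesis by (simp add: vec_eq_iff)
qed

text \<open>For small \<open>v\<close> the map \<open>absorb \<omega> v\<close> moves points of
  \<open>cball B r\<close> by at most \<open>r / 2\<close>, so by Brouwer's theorem it covers the
  half ball. Its Lipschitz constant does not depend on \<open>v\<close>, and neither does the
  resulting factor \<open>M\<close>. This uniformity allows \<open>v\<close> to depend on the
  initial state later on.\<close>

lemma absorb_rank_one:
  fixes B :: "real^'d^'d" and \<omega> :: "'d \<Rightarrow> real"
  assumes \<omega>: "\<And>j. \<omega> j > 0" and l: "l > 0" "\<And>a. l * norm a \<le> norm (transpose B *v a)"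
    and r: "0 < r" "r \<le> l / 2"
  shows "\<exists>e M :: real. e > 0 \<and> (\<forall>v h. norm v \<le> e \<longrightarrow> h \<in> borel_measurable borel \<longrightarrow>
    (\<integral>\<^sup>+R. h (weighted_gram \<omega> R) * indicator (cball B (r / 2)) R \<partial>lborel) \<le>
    ennreal M * (\<integral>\<^sup>+R. h (weighted_gram \<omega> R + outer_square v) * indicator (cball B r) R \<partial>lborel))"
proof -
  \<comment> \<open>Within distance \<open>l / 2\<close> of \<open>B\<close> half of the lower bound
    survives. It yields invertibility on the whole ball, with inverses bounded by
    \<open>A = 2 / l\<close>.\<close>
  have lower: "l / 2 * norm a \<le> norm (transpose R *v a)" if "R \<in> cball B r" for R a
  proof -
    have "norm (transpose (B - R) *v a) \<le> norm (B - R) * norm a"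
      using norm_matrix_vector_mult_le[of "transpose (B - R)" a] by (simp add: norm_transpose)
    also have "\<dots> \<le> l / 2 * norm a" using that r by (intro mult_right_mono) (auto simp: dist_norm)
    finally have "norm (transpose (B - R) *v a) \<le> l / 2 * norm a" .
    moreover have "transpose B *v a = transpose R *v a + transpose (B - R) *v a"
      by (simp add: transpose_mult_vector sum.distrib[symmetric] algebra_simps)
    then have "norm (transpose B *v a) \<le> norm (transpose R *v a) + norm (transpose (B - R) *v a)"
      using norm_triangle_ineq by simp
    ultimately show ?thesis using l(2)[of a] by (simp add: field_simps)
  qed
  have inv: "transpose R *v (matrix_inv (transpose R) *v v) = v" if "R \<in> cball B r" for R v
  proof -
    have "x = 0" if "transpose R *v x = 0" for x
      using lower[OF \<open>R \<in> cball B r\<close>, of x] that l by (simp add: mult_le_0_iff)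
    then have "invertible (transpose R)"
      unfolding invertible_left_inverse matrix_left_invertible_ker by blast
    then have "transpose R ** matrix_inv (transpose R) = mat 1"
      unfolding invertible_def matrix_inv_def by (rule someI2_ex) blast
    then show ?thesis by (simp add: matrix_vector_mul_assoc)
  qed
  \<comment> \<open>One constant, at least 1, that dominates both \<open>1 / \<omega> j\<close> and
    \<open>1 / sqrt (\<omega> j)\<close>.\<close>
  define k where "k = 1 + (\<Sum>j\<in>UNIV. 1 / \<omega> j)"
  have k: "1 / \<omega> j \<le> k" "k \<ge> 1" for j
  proof -
    have "1 / \<omega> j \<le> (\<Sum>j\<in>UNIV. 1 / \<omega> j)"
      using \<omega> by (intro member_le_sum) (auto intro: less_imp_le)
    then show "1 / \<omega> j \<le> k" by (simp add: k_def)
    show "k \<ge> 1" unfolding k_def using sum_nonneg[of UNIV "\<lambda>j. 1 / \<omega> j"] less_imp_le[OF \<omega>] by simp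
  qed
  have scaled: "norm (\<chi> j. b $ j / \<omega> j) \<le> k * norm b" for b :: "real^'d"
  proof -
    have "norm (\<chi> j. b $ j / \<omega> j) \<le> norm (k *\<^sub>R b)"
    proof (rule norm_le_componentwise_cart)
      fix j
      have "\<bar>b $ j\<bar> * (1 / \<omega> j) \<le> \<bar>b $ j\<bar> * k" using k(1) by (intro mult_left_mono) auto
      moreover have "norm ((\<chi> j. b $ j / \<omega> j) $ j) = \<bar>b $ j\<bar> * (1 / \<omega> j)"
        using less_imp_le[OF \<omega>[of j]] by (simp add: abs_divide)
      moreover have "norm ((k *\<^sub>R b) $ j) = \<bar>b $ j\<bar> * k" using k(2) by (simp add: abs_mult)
      ultimately show "norm ((\<chi> j. b $ j / \<omega> j) $ j) \<le> norm ((k *\<^sub>R b) $ j)" by (simp only:)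
    qed
    then show ?thesis using k(2) by simp
  qed
  have scaled': "norm (\<chi> j. b $ j / sqrt (\<omega> j)) \<le> k * norm b" for b :: "real^'d"
  proof -
    have "norm (\<chi> j. b $ j / sqrt (\<omega> j)) \<le> norm (k *\<^sub>R b)"
    proof (rule norm_le_componentwise_cart)
      fix j
      have "(1 / sqrt (\<omega> j))\<^sup>2 \<le> k\<^sup>2"
      proof -
        have "(1 / sqrt (\<omega> j))\<^sup>2 = 1 / \<omega> j" using less_imp_le[OF \<omega>[of j]] by (simp add: power_divide)
        moreover have "k * 1 \<le> k * k" using k(2) by (intro mult_left_mono) auto
        ultimately show ?thesis using k(1)[of j] by (simp add: power2_eq_square)
      qed
      then have "1 / sqrt (\<omega> j) \<le> k" by (rule power2_le_imp_le) (use k(2) in linarith)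
      then have "\<bar>b $ j\<bar> * (1 / sqrt (\<omega> j)) \<le> \<bar>b $ j\<bar> * k" by (intro mult_left_mono) auto
      moreover have "norm ((\<chi> j. b $ j / sqrt (\<omega> j)) $ j) = \<bar>b $ j\<bar> * (1 / sqrt (\<omega> j))"
        using less_imp_le[OF \<omega>[of j]] by (simp add: abs_divide)
      moreover have "norm ((k *\<^sub>R b) $ j) = \<bar>b $ j\<bar> * k" using k(2) by (simp add: abs_mult)
      ultimately show "norm ((\<chi> j. b $ j / sqrt (\<omega> j)) $ j) \<le> norm ((k *\<^sub>R b) $ j)" by (simp only:)
    qed
    then show ?thesis using k(2) by simp
  qed
  have t01: "0 \<le> absorb_scale \<omega> a" "absorb_scale \<omega> a \<le> 1" for a
  proof -
    have "0 < 1 + norm (1::real, \<chi> j. a $ j / sqrt (\<omega> j))" by (intro add_pos_nonneg) auto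
    then show "0 \<le> absorb_scale \<omega> a" "absorb_scale \<omega> a \<le> 1"
      unfolding absorb_scale_def by (simp_all add: divide_le_eq_1_pos)
  qed
  \<comment> \<open>Writing the square root of \<open>1 + |u|\<^sup>2\<close> as the norm of the
    pair \<open>(1, u)\<close> makes this the reverse triangle inequality.\<close>
  have t_lip: "\<bar>absorb_scale \<omega> a - absorb_scale \<omega> b\<bar> \<le> k * norm (a - b)" for a b
  proof -
    define p q where "p = norm (1::real, \<chi> j. a $ j / sqrt (\<omega> j))"
      and "q = norm (1::real, \<chi> j. b $ j / sqrt (\<omega> j))"
    have pq: "p \<ge> 0" "q \<ge> 0" by (auto simp: p_def q_def)
    have "absorb_scale \<omega> a - absorb_scale \<omega> b = (q - p) / ((1 + p) * (1 + q))"
      unfolding absorb_scale_def p_def[symmetric] q_def[symmetric] using pq by (simp add: field_simps)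
    moreover have "1 \<le> (1 + p) * (1 + q)" using pq by (simp add: algebra_simps)
    ultimately have "\<bar>absorb_scale \<omega> a - absorb_scale \<omega> b\<bar> \<le> \<bar>q - p\<bar>"
      using pq by (simp add: abs_divide divide_le_eq mult_le_cancel_left1)
    also have "\<dots> \<le> norm ((1::real, \<chi> j. b $ j / sqrt (\<omega> j)) - (1, \<chi> j. a $ j / sqrt (\<omega> j)))"
      unfolding p_def q_def by (rule norm_triangle_ineq3)
    also have "\<dots> = norm (\<chi> j. (b - a) $ j / sqrt (\<omega> j))"
    proof -
      have "(\<chi> j. b $ j / sqrt (\<omega> j)) - (\<chi> j. a $ j / sqrt (\<omega> j)) = (\<chi> j. (b - a) $ j / sqrt (\<omega> j))"
        by (simp add: vec_eq_iff diff_divide_distrib)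
      then show ?thesis by (simp add: norm_Pair)
    qed
    also have "\<dots> \<le> k * norm (b - a)" by (rule scaled')
    finally show ?thesis by (simp add: norm_minus_commute)
  qed
  define A where "A = 2 / l"
  have A: "A > 0" using l by (simp add: A_def)
  \<comment> \<open>The 1 is the identity part; the rest multiplies the Lipschitz constant
    \<open>A\<^sup>2\<close> of \<open>a\<close> by the one of \<open>b\<close> in terms of
    \<open>a\<close>, with \<open>norm v \<le> 1\<close>.\<close>
  define L where "L = 1 + k * (1 + A * k) * A\<^sup>2"
  have L: "L > 0" using k(2) A by (simp add: L_def add_pos_nonneg)
  \<comment> \<open>The displacement is \<open>norm (b R) * norm v\<close>, at most
    \<open>k * A * e\<close> since \<open>e \<le> 1\<close>; this choice makes it at most
    \<open>r / 2\<close>.\<close>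
  define e where "e = min 1 (r / (2 * (k * A)))"
  have kA: "k * A > 0" using k(2) A by simp
  have e: "e > 0" "e \<le> 1" using r kA by (auto simp: e_def)
  have "(\<integral>\<^sup>+R. h (weighted_gram \<omega> R) * indicator (cball B (r / 2)) R \<partial>lborel) \<le>
    ennreal ((2 * L * DIM(real^'d^'d)) ^ DIM(real^'d^'d)) *
      (\<integral>\<^sup>+R. h (weighted_gram \<omega> R + outer_square v) * indicator (cball B r) R \<partial>lborel)"
    if v: "norm v \<le> e" and h[measurable]: "h \<in> borel_measurable borel" for v h
  proof -
    define a where "a R = matrix_inv (transpose R) *v v" for R :: "real^'d^'d"
    define b where "b R = (\<chi> j. a R $ j * absorb_scale \<omega> (a R) / \<omega> j)" for R
    have g: "absorb \<omega> v R = R + (\<chi> j. b R $ j *\<^sub>R v)" for R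
      by (simp add: absorb_def Let_def a_def b_def)
    have na: "norm (a R) \<le> A * norm v" if "R \<in> cball B r" for R
      using lower[OF that, of "a R"] inv[OF that, of v] l by (simp add: a_def A_def field_simps)
    have nb: "norm (b R) \<le> k * norm (a R)" if "R \<in> cball B r" for R
    proof -
      have "norm (b R) = norm (\<chi> j. (absorb_scale \<omega> (a R) *\<^sub>R a R) $ j / \<omega> j)"
        by (simp add: b_def mult.commute)
      also have "\<dots> \<le> k * norm (absorb_scale \<omega> (a R) *\<^sub>R a R)" by (rule scaled)
      also have "\<dots> \<le> k * norm (a R)"
        using t01[of "a R"] k(2) by (intro mult_left_mono) (auto simp: mult_left_le_one_le)
      finally show ?thesis .
    qed
    have close: "norm (absorb \<omega> v R - R) \<le> r / 2" if "R \<in> cball B r" for R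
    proof -
      have "norm (absorb \<omega> v R - R) = norm (b R) * norm v" by (simp add: g norm_rank_one)
      also have "\<dots> \<le> (k * (A * e)) * 1"
        using nb[OF that] na[OF that] v e k(2) A
        by (intro mult_mono order_trans[OF nb[OF that]] mult_left_mono order_trans[OF na[OF that]]) auto
      also have "\<dots> = (k * A) * e" by simp
      also have "\<dots> \<le> (k * A) * (r / (2 * (k * A)))"
        using kA by (intro mult_left_mono) (auto simp: e_def)
      also have "\<dots> = r / 2" using k(2) A by simp
      finally show ?thesis .
    qed
    have a_lip: "norm (a R - a S) \<le> A\<^sup>2 * norm (R - S)" if R: "R \<in> cball B r" and S: "S \<in> cball B r" for R S
    proof -
      \<comment> \<open>The resolvent identity: subtract the equations that define
        \<open>a R\<close> and \<open>a S\<close>.\<close>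
      have "transpose R *v (a R - a S) = transpose (S - R) *v a S"
      proof -
        have "transpose (S - R) = transpose S - transpose R" by (simp add: transpose_def vec_eq_iff)
        then show ?thesis
          unfolding a_def by (simp only: matrix_vector_mult_diff_distrib matrix_vector_mult_diff_rdistrib
              inv[OF R, of v] inv[OF S, of v])
      qed
      then have "l / 2 * norm (a R - a S) \<le> norm (transpose (S - R) *v a S)"
        using lower[OF R, of "a R - a S"] by simp
      also have "\<dots> \<le> norm (S - R) * norm (a S)"
        using norm_matrix_vector_mult_le[of "transpose (S - R)" "a S"] by (simp add: norm_transpose)
      also have "\<dots> \<le> norm (S - R) * A"
        using na[OF S] v e A by (intro mult_left_mono) (auto intro: order_trans simp: mult_left_le)
      finally have "A * (l / 2 * norm (a R - a S)) \<le> A * (norm (S - R) * A)"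
        using A by (intro mult_left_mono) auto
      then show ?thesis using l by (simp add: A_def power2_eq_square norm_minus_commute)
    qed
    have b_lip: "norm (b R - b S) \<le> k * (1 + A * k) * norm (a R - a S)"
      if R: "R \<in> cball B r" and S: "S \<in> cball B r" for R S
    proof -
      let ?c = "absorb_scale \<omega> (a R) *\<^sub>R (a R - a S) + (absorb_scale \<omega> (a R) - absorb_scale \<omega> (a S)) *\<^sub>R a S"
      have "norm (b R - b S) = norm (\<chi> j. ?c $ j / \<omega> j)"
        by (rule arg_cong[where f = norm]) (simp add: b_def vec_eq_iff algebra_simps flip: diff_divide_distrib)
      also have "\<dots> \<le> k * norm ?c" by (rule scaled)
      also have "norm ?c \<le> 1 * norm (a R - a S) + (k * norm (a R - a S)) * A"
      proof (rule norm_triangle_le, rule add_mono)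
        show "norm (absorb_scale \<omega> (a R) *\<^sub>R (a R - a S)) \<le> 1 * norm (a R - a S)"
          using t01[of "a R"] by (simp add: mult_left_le_one_le)
        have "norm (a S) \<le> A" using na[OF S] v e A by (auto intro: order_trans simp: mult_left_le)
        then show "norm ((absorb_scale \<omega> (a R) - absorb_scale \<omega> (a S)) *\<^sub>R a S) \<le> k * norm (a R - a S) * A"
          using t_lip[of "a R" "a S"] k(2) unfolding norm_scaleR by (intro mult_mono) auto
      qed
      finally show ?thesis using k(2) by (simp add: algebra_simps)
    qed
    have lip: "L-lipschitz_on (cball B r) (absorb \<omega> v)"
    proof (rule lipschitz_onI)
      fix R S assume R: "R \<in> cball B r" and S: "S \<in> cball B r"
      have "absorb \<omega> v R - absorb \<omega> v S = (R - S) + (\<chi> j. (b R - b S) $ j *\<^sub>R v)"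
        by (simp add: g vec_eq_iff algebra_simps)
      then have "norm (absorb \<omega> v R - absorb \<omega> v S) \<le> norm (R - S) + norm (b R - b S) * norm v"
        using norm_triangle_ineq[of "R - S" "\<chi> j. (b R - b S) $ j *\<^sub>R v"] by (simp only: norm_rank_one)
      also have "\<dots> \<le> norm (R - S) + (k * (1 + A * k) * (A\<^sup>2 * norm (R - S))) * 1"
        using b_lip[OF R S] a_lip[OF R S] v e k(2) A
        by (intro add_left_mono mult_mono order_trans[OF b_lip[OF R S]] mult_left_mono) auto
      also have "\<dots> = L * norm (R - S)" by (simp add: L_def algebra_simps)
      finally show "dist (absorb \<omega> v R) (absorb \<omega> v S) \<le> L * dist R S" by (simp add: dist_norm)
    qed (use L in simp)
    \<comment> \<open>To solve \<open>absorb \<omega> v S = R\<close>, look for a fixed point of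
      \<open>S \<mapsto> R + (S - absorb \<omega> v S)\<close>: \<open>R\<close> is within
      \<open>r / 2\<close> of \<open>B\<close> and the bracket has norm at most
      \<open>r / 2\<close>.\<close>
    have surj: "cball B (r / 2) \<subseteq> absorb \<omega> v ` cball B r"
    proof
      fix R assume R: "R \<in> cball B (r / 2)"
      have "\<exists>S\<in>cball B r. absorb \<omega> v S = R"
      proof (rule brouwer_surjective_cball[OF lipschitz_on_continuous_on[OF lip] r(1) R])
        fix R S assume "R \<in> cball B (r / 2)" "S \<in> cball B r"
        then have "norm (B - R) \<le> r / 2" "norm (absorb \<omega> v S - S) \<le> r / 2"
          using close by (auto simp: dist_norm)
        then have "norm ((B - R) + (absorb \<omega> v S - S)) \<le> r" by norm
        then show "R + (S - absorb \<omega> v S) \<in> cball B r" by (simp add: dist_norm algebra_simps)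
      qed
      then show "R \<in> absorb \<omega> v ` cball B r" by auto
    qed
    have "(\<integral>\<^sup>+R. h (weighted_gram \<omega> R) * indicator (cball B (r / 2)) R \<partial>lborel) \<le>
        ennreal ((2 * L * DIM(real^'d^'d)) ^ DIM(real^'d^'d)) *
        (\<integral>\<^sup>+R. h (weighted_gram \<omega> (absorb \<omega> v R)) * indicator (cball B r) R \<partial>lborel)"
      using surj by (intro nn_integral_lipschitz_image_le[OF lip L]) auto
    also have "(\<integral>\<^sup>+R. h (weighted_gram \<omega> (absorb \<omega> v R)) * indicator (cball B r) R \<partial>lborel) =
        (\<integral>\<^sup>+R. h (weighted_gram \<omega> R + outer_square v) * indicator (cball B r) R \<partial>lborel)"
      using weighted_gram_absorb[where \<omega> = \<omega>, OF \<omega> inv] by (intro nn_integral_cong) (auto split: split_indicator)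
    finally show ?thesis .
  qed
  with e show ?thesis by blast
qed

text \<open>The vectors \<open>v\<close> and the test function \<open>h\<close> are quantified after
  all constants: the comparison is uniform over small perturbations.\<close>

definition gram_dominated ::
  "('d::finite \<Rightarrow> real) \<Rightarrow> real^'d^'d \<Rightarrow> 'i set \<Rightarrow> real \<Rightarrow> real \<Rightarrow> real \<Rightarrow> real \<Rightarrow> bool" where
  "gram_dominated \<omega> B I r e r' M \<longleftrightarrow> (\<forall>v h. (\<forall>i\<in>I. norm (v i) \<le> e) \<longrightarrow> h \<in> borel_measurable borel \<longrightarrow>
    (\<integral>\<^sup>+R. h (weighted_gram \<omega> R) * indicator (cball B r') R \<partial>lborel) \<le>
    ennreal M * (\<integral>\<^sup>+R. h (weighted_gram \<omega> R + (\<Sum>i\<in>I. outer_square (v i))) * indicator (cball B r) R \<partial>lborel))"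

text \<open>Absorb the terms one at a time. The induction hypothesis is used at radius
  \<open>r / 2\<close>, and the new term widens the ball from \<open>r / 2\<close> to
  \<open>r\<close>, with the terms already absorbed hidden in the test function.\<close>

lemma absorb_sum_outer_square:
  fixes B :: "real^'d^'d" and \<omega> :: "'d \<Rightarrow> real"
  assumes "finite (I :: 'i set)" and \<omega>: "\<And>j. \<omega> j > 0" and l: "l > 0" "\<And>a. l * norm a \<le> norm (transpose B *v a)"
    and r: "0 < r" "r \<le> l / 2"
  shows "\<exists>e r' M. e > 0 \<and> r' > 0 \<and> r' \<le> r \<and> M \<ge> 0 \<and> gram_dominated \<omega> B I r e r' M"
  using assms(1) r
proof (induction I arbitrary: r)
  case empty
  then show ?case
    by (intro exI[of _ 1] exI[of _ r]) (auto simp: gram_dominated_def)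
next
  case (insert i I)
  have "0 < r / 2" "r / 2 \<le> l / 2" using insert.prems by auto
  from insert.IH[OF this] obtain e' r' M' where IH: "e' > 0" "r' > 0" "r' \<le> r / 2" "M' \<ge> 0"
    and dom: "gram_dominated \<omega> B I (r / 2) e' r' M'"
    by blast
  obtain e M where e: "e > 0" and one: "\<And>v h. norm v \<le> e \<Longrightarrow> h \<in> borel_measurable borel \<Longrightarrow>
    (\<integral>\<^sup>+R. h (weighted_gram \<omega> R) * indicator (cball B (r / 2)) R \<partial>lborel) \<le>
    ennreal M * (\<integral>\<^sup>+R. h (weighted_gram \<omega> R + outer_square v) * indicator (cball B r) R \<partial>lborel)"
    using absorb_rank_one[where \<omega> = \<omega>, OF \<omega> l insert.prems] by blast
  have "gram_dominated \<omega> B (insert i I) r (min e e') r' (M' * max 0 M)"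
    unfolding gram_dominated_def
  proof (intro allI impI)
    fix v :: "'i \<Rightarrow> real^'d" and h :: "real^'d^'d \<Rightarrow> ennreal"
    assume v: "\<forall>i\<in>insert i I. norm (v i) \<le> min e e'" and h[measurable]: "h \<in> borel_measurable borel"
    have "(\<integral>\<^sup>+R. h (weighted_gram \<omega> R) * indicator (cball B r') R \<partial>lborel) \<le>
      ennreal M' * (\<integral>\<^sup>+R. h (weighted_gram \<omega> R + (\<Sum>i\<in>I. outer_square (v i))) * indicator (cball B (r / 2)) R \<partial>lborel)"
      using dom v h unfolding gram_dominated_def by simp
    also have "\<dots> \<le> ennreal M' * (ennreal M * (\<integral>\<^sup>+R. h (weighted_gram \<omega> R + outer_square (v i) + (\<Sum>i\<in>I. outer_square (v i))) * indicator (cball B r) R \<partial>lborel))"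
      using v one[of "v i" "\<lambda>C. h (C + (\<Sum>i\<in>I. outer_square (v i)))"] by (intro mult_left_mono) auto
    \<comment> \<open>The sign of \<open>M\<close> is unknown here, and \<open>ennreal\<close> sends
      negative numbers to 0.\<close>
    also have "ennreal M = ennreal (max 0 M)" by (simp add: ennreal_eq_0_iff max_def ennreal_neg)
    also have "ennreal M' * (ennreal (max 0 M) * (\<integral>\<^sup>+R. h (weighted_gram \<omega> R + outer_square (v i) + (\<Sum>i\<in>I. outer_square (v i))) * indicator (cball B r) R \<partial>lborel)) = ennreal (M' * max 0 M) * (\<integral>\<^sup>+R. h (weighted_gram \<omega> R + (\<Sum>i\<in>insert i I. outer_square (v i))) * indicator (cball B r) R \<partial>lborel)"
      using insert.hyps IH by (simp add: ennreal_mult mult.assoc add.assoc)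
    finally show "(\<integral>\<^sup>+R. h (weighted_gram \<omega> R) * indicator (cball B r') R \<partial>lborel) \<le>
      ennreal (M' * max 0 M) * (\<integral>\<^sup>+R. h (weighted_gram \<omega> R + (\<Sum>i\<in>insert i I. outer_square (v i))) * indicator (cball B r) R \<partial>lborel)" .
  qed
  then show ?case
    using IH e insert.prems by (intro exI[of _ "min e e'"] exI[of _ r'] exI[of _ "M' * max 0 M"]) auto
qed

section \<open>Lower bounds for the transition law\<close>

text \<open>Fubini, replacing one coordinate at a time; each replacement costs a factor
  \<open>M\<close>. It applies because each candidate is a function of its own sample only, as long
  as no ranking is involved.\<close>

lemma PiM_nn_integral_dominated:
  fixes N G :: "'a measure" and \<phi> :: "'a \<Rightarrow> 'a" and W :: "'i \<Rightarrow> 'a set"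
  assumes N: "sigma_finite_measure N" and G: "sigma_finite_measure G" and \<phi>[measurable]: "\<phi> \<in> G \<rightarrow>\<^sub>M N"
    and J: "finite J" and W[measurable]: "\<And>i. i \<in> J \<Longrightarrow> W i \<in> sets N"
    and dom: "\<And>i h. i \<in> J \<Longrightarrow> h \<in> borel_measurable N \<Longrightarrow>
      (\<integral>\<^sup>+y. h y * indicator (W i) y \<partial>N) \<le> M * (\<integral>\<^sup>+u. h (\<phi> u) * indicator (W i) (\<phi> u) \<partial>G)"
    and H: "H \<in> borel_measurable (PiM J (\<lambda>_. N))"
  shows "(\<integral>\<^sup>+y. H y * (\<Prod>i\<in>J. indicator (W i) (y i)) \<partial>PiM J (\<lambda>_. N)) \<le>
    M ^ card J * (\<integral>\<^sup>+u. H (\<lambda>i\<in>J. \<phi> (u i)) * (\<Prod>i\<in>J. indicator (W i) (\<phi> (u i))) \<partial>PiM J (\<lambda>_. G))"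
  using J W dom H
proof (induction J arbitrary: H rule: finite_induct)
  case empty
  interpret N: product_sigma_finite "\<lambda>_::'i. N" using N by (simp add: product_sigma_finite_def)
  interpret G: product_sigma_finite "\<lambda>_::'i. G" using G by (simp add: product_sigma_finite_def)
  show ?case by (simp add: PiM_empty nn_integral_count_space_finite)
next
  case (insert i J)
  interpret N: product_sigma_finite "\<lambda>_::'i. N" using N by (simp add: product_sigma_finite_def)
  interpret G: product_sigma_finite "\<lambda>_::'i. G" using G by (simp add: product_sigma_finite_def)
  interpret Gs: sigma_finite_measure G by (rule G)
  note [measurable] = insert.prems(1)
  have [measurable]: "W j \<in> sets N" if "j \<in> J" for j using insert.prems(1) that by blast
  have [measurable]: "W i \<in> sets N" using insert.prems(1) by blast
  have H[measurable]: "H \<in> borel_measurable (PiM (insert i J) (\<lambda>_. N))" by (rule insert.prems)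
  have ne: "j \<noteq> i" if "j \<in> J" for j using that insert.hyps by auto
  have prod_upd: "(\<Prod>j\<in>insert i J. indicator (W j) ((y(i := t)) j)) = indicator (W i) t * (\<Prod>j\<in>J. indicator (W j) (y j) :: ennreal)" for y t
    unfolding prod.insert[OF insert.hyps]
    by (intro arg_cong2[where f = "(*)"] prod.cong) (use ne in auto)
  define F where "F y = (\<integral>\<^sup>+u. H (y(i := \<phi> u)) * indicator (W i) (\<phi> u) \<partial>G)" for y
  have F: "F \<in> borel_measurable (PiM J (\<lambda>_. N))" unfolding F_def by measurable
  have "(\<integral>\<^sup>+y. H y * (\<Prod>j\<in>insert i J. indicator (W j) (y j)) \<partial>PiM (insert i J) (\<lambda>_. N)) =
      (\<integral>\<^sup>+y. (\<integral>\<^sup>+t. H (y(i := t)) * (\<Prod>j\<in>insert i J. indicator (W j) ((y(i := t)) j)) \<partial>N) \<partial>PiM J (\<lambda>_. N))"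
    using insert.hyps by (subst N.product_nn_integral_insert) auto
  also have "\<dots> = (\<integral>\<^sup>+y. (\<integral>\<^sup>+t. H (y(i := t)) * indicator (W i) t \<partial>N) * (\<Prod>j\<in>J. indicator (W j) (y j)) \<partial>PiM J (\<lambda>_. N))"
    unfolding prod_upd
    by (intro nn_integral_cong, subst nn_integral_multc[symmetric]) (auto simp: mult.assoc)
  also have "\<dots> \<le> (\<integral>\<^sup>+y. M * F y * (\<Prod>j\<in>J. indicator (W j) (y j)) \<partial>PiM J (\<lambda>_. N))"
  proof (intro nn_integral_mono mult_right_mono)
    fix y assume [measurable]: "y \<in> space (PiM J (\<lambda>_. N))"
    show "(\<integral>\<^sup>+t. H (y(i := t)) * indicator (W i) t \<partial>N) \<le> M * F y"
      unfolding F_def by (rule insert.prems(2)) auto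
  qed simp
  also have "\<dots> = M * (\<integral>\<^sup>+y. F y * (\<Prod>j\<in>J. indicator (W j) (y j)) \<partial>PiM J (\<lambda>_. N))"
    using F by (simp add: nn_integral_cmult mult.assoc)
  also have "\<dots> \<le> M * (M ^ card J * (\<integral>\<^sup>+u. F (\<lambda>i\<in>J. \<phi> (u i)) * (\<Prod>i\<in>J. indicator (W i) (\<phi> (u i))) \<partial>PiM J (\<lambda>_. G)))"
    using insert.prems F by (intro mult_left_mono insert.IH) auto
  also have "(\<integral>\<^sup>+u. F (\<lambda>i\<in>J. \<phi> (u i)) * (\<Prod>i\<in>J. indicator (W i) (\<phi> (u i))) \<partial>PiM J (\<lambda>_. G)) =
     (\<integral>\<^sup>+u. (\<integral>\<^sup>+t. H (\<lambda>j\<in>insert i J. \<phi> ((u(i := t)) j)) * (\<Prod>j\<in>insert i J. indicator (W j) (\<phi> ((u(i := t)) j))) \<partial>G) \<partial>PiM J (\<lambda>_. G))"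
  proof (intro nn_integral_cong)
    fix u assume [measurable]: "u \<in> space (PiM J (\<lambda>_. G))"
    have e1: "(\<lambda>j\<in>insert i J. \<phi> ((u(i := t)) j)) = (\<lambda>j\<in>J. \<phi> (u j))(i := \<phi> t)" for t
      using ne insert.hyps by (auto simp: fun_eq_iff)
    have e2: "(\<Prod>j\<in>insert i J. indicator (W j) (\<phi> ((u(i := t)) j))) =
        indicator (W i) (\<phi> t) * (\<Prod>j\<in>J. indicator (W j) (\<phi> (u j)) :: ennreal)" for t
      unfolding prod.insert[OF insert.hyps]
      by (intro arg_cong2[where f = "(*)"] prod.cong) (use ne in auto)
    have "(\<lambda>j\<in>J. \<phi> (u j)) \<in> space (PiM J (\<lambda>_. N))"
      using measurable_space[OF \<phi>] \<open>u \<in> _\<close> by (auto simp: space_PiM PiE_iff)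
    then have [measurable]: "(\<lambda>t. H ((\<lambda>j\<in>J. \<phi> (u j))(i := \<phi> t))) \<in> borel_measurable G" by measurable
    show "F (\<lambda>i\<in>J. \<phi> (u i)) * (\<Prod>i\<in>J. indicator (W i) (\<phi> (u i))) =
      (\<integral>\<^sup>+t. H (\<lambda>j\<in>insert i J. \<phi> ((u(i := t)) j)) * (\<Prod>j\<in>insert i J. indicator (W j) (\<phi> ((u(i := t)) j))) \<partial>G)"
      unfolding F_def e1 e2 by (subst nn_integral_multc[symmetric]) (auto simp: mult.assoc)
  qed
  also have "\<dots> = (\<integral>\<^sup>+u. H (\<lambda>j\<in>insert i J. \<phi> (u j)) * (\<Prod>j\<in>insert i J. indicator (W j) (\<phi> (u j))) \<partial>PiM (insert i J) (\<lambda>_. G))"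
    using insert.hyps by (subst G.product_nn_integral_insert) auto
  finally show ?case unfolding card_insert_disjoint[OF insert.hyps] power_Suc mult.assoc .
qed

lemma gaussian_density_lower_bound:
  "\<exists>\<delta>>0. \<forall>u::real^'d. norm u \<le> \<rho> \<longrightarrow> \<delta> \<le> (\<Prod>i\<in>UNIV. std_normal_density (u $ i))"
proof -
  define \<delta> where "\<delta> = (\<Prod>i\<in>(UNIV::'d set). 1 / sqrt (2 * pi) * exp (- \<rho>\<^sup>2 / 2))"
  show ?thesis
  proof (intro exI[of _ \<delta>] conjI allI impI)
    show "\<delta> > 0" unfolding \<delta>_def by (intro prod_pos) simp
    fix u :: "real^'d" assume u: "norm u \<le> \<rho>"
    show "\<delta> \<le> (\<Prod>i\<in>UNIV. std_normal_density (u $ i))"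
      unfolding \<delta>_def
    proof (intro prod_mono conjI)
      fix i
      have "\<bar>u $ i\<bar> \<le> \<rho>" using component_le_norm_cart[of u i] u by linarith
      then have "(u $ i)\<^sup>2 \<le> \<rho>\<^sup>2" by (rule abs_le_square_iff[THEN iffD1, OF order_trans]) simp
      then show "1 / sqrt (2 * pi) * exp (- \<rho>\<^sup>2 / 2) \<le> std_normal_density (u $ i)"
        unfolding std_normal_density_def by (intro mult_left_mono) auto
    qed simp
  qed
qed

text \<open>The map from sample to candidate is Lipschitz with constant \<open>sqrt R\<close>, and
  the samples hitting \<open>cball 0 R\<close> lie in a fixed ball, where the Gaussian density is
  bounded below. \<open>M\<close> depends only on \<open>R\<close> and \<open>a\<close>, not on the
  state.\<close>

lemma affine_gaussian_dominates:
  fixes R a :: real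
  assumes "R > 0" "a > 0"
  shows "\<exists>M\<ge>0. \<forall>m (C::real^'d^'d) W h. norm m \<le> R \<longrightarrow> norm C \<le> R \<longrightarrow> sym_pos_def C \<longrightarrow>
    (\<forall>v. a * (norm v)\<^sup>2 \<le> v \<bullet> (C *v v)) \<longrightarrow> W \<in> sets borel \<longrightarrow> W \<subseteq> cball 0 R \<longrightarrow> h \<in> borel_measurable borel \<longrightarrow>
    (\<integral>\<^sup>+y. h y * indicator W y \<partial>lborel) \<le>
    ennreal M * (\<integral>\<^sup>+u. h (m + mat_sqrt C *v u) * indicator W (m + mat_sqrt C *v u) \<partial>std_gaussian)"
proof -
  \<comment> \<open>A sample \<open>u\<close> whose candidate lies in \<open>cball 0 R\<close>
    satisfies \<open>a |u|\<^sup>2 \<le> |y - m|\<^sup>2 \<le> (2 R)\<^sup>2\<close>.\<close>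
  define \<rho> where "\<rho> = 2 * R / sqrt a"
  obtain \<delta> where \<delta>: "\<delta> > 0" "\<And>u::real^'d. norm u \<le> \<rho> \<Longrightarrow> \<delta> \<le> (\<Prod>i\<in>UNIV. std_normal_density (u $ i))"
    using gaussian_density_lower_bound[of \<rho>] by blast
  define L where "L = sqrt R"
  have L: "L > 0" using assms by (simp add: L_def)
  define c where "c = (2 * L * DIM(real^'d)) ^ DIM(real^'d)"
  have c: "c \<ge> 0" using L by (simp add: c_def)
  show ?thesis
  proof (intro exI[of _ "c / \<delta>"] conjI allI impI)
    show "c / \<delta> \<ge> 0" using c \<delta> by simp
    fix m :: "real^'d" and C :: "real^'d^'d" and W :: "(real^'d) set" and h :: "real^'d \<Rightarrow> ennreal"
    assume m: "norm m \<le> R" and C: "norm C \<le> R" "sym_pos_def C" "\<forall>v. a * (norm v)\<^sup>2 \<le> v \<bullet> (C *v v)"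
      and W[measurable]: "W \<in> sets borel" and WR: "W \<subseteq> cball 0 R" and h[measurable]: "h \<in> borel_measurable borel"
    define \<phi> where "\<phi> u = m + mat_sqrt C *v u" for u
    have \<phi>[measurable]: "\<phi> \<in> borel_measurable borel" unfolding \<phi>_def by measurable
    have lip: "L-lipschitz_on (cball 0 \<rho>) \<phi>"
    proof (rule lipschitz_onI)
      fix u v :: "real^'d"
      have "(norm (mat_sqrt C *v (u - v)))\<^sup>2 = (u - v) \<bullet> (C *v (u - v))" by (rule norm_mat_sqrt_mult[OF C(2)])
      also have "\<dots> \<le> norm C * (norm (u - v))\<^sup>2" using quadratic_form_norm_le[of "u - v" C] by simp
      also have "\<dots> \<le> R * (norm (u - v))\<^sup>2" using C(1) by (intro mult_right_mono) auto
      also have "\<dots> = (L * norm (u - v))\<^sup>2" using assms by (simp add: L_def power_mult_distrib)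
      finally have "norm (mat_sqrt C *v (u - v)) \<le> L * norm (u - v)"
        by (rule power2_le_imp_le) (use L in simp)
      then show "dist (\<phi> u) (\<phi> v) \<le> L * dist u v"
        by (simp add: \<phi>_def dist_norm matrix_vector_mult_diff_distrib)
    qed (use L in simp)
    have surj: "W \<subseteq> \<phi> ` cball 0 \<rho>"
    proof
      fix y assume y: "y \<in> W"
      have "x = 0" if "mat_sqrt C *v x = 0" for x
      proof -
        have "(norm (mat_sqrt C *v x))\<^sup>2 = x \<bullet> (C *v x)" by (rule norm_mat_sqrt_mult[OF C(2)])
        then show ?thesis using that C(2) by (auto simp: sym_pos_def_def)
      qed
      then have "invertible (mat_sqrt C)"
        unfolding invertible_left_inverse matrix_left_invertible_ker by blast
      then obtain D where "mat_sqrt C ** D = mat 1" unfolding invertible_def by blast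
      then have u: "mat_sqrt C *v (D *v (y - m)) = y - m" by (simp add: matrix_vector_mul_assoc)
      define u where "u = D *v (y - m)"
      have "a * (norm u)\<^sup>2 \<le> (norm (y - m))\<^sup>2"
        using C(3)[rule_format, of u] norm_mat_sqrt_mult[OF C(2), of u] u by (simp add: u_def)
      also have "\<dots> \<le> (2 * R)\<^sup>2"
        using y WR m norm_triangle_ineq4[of y m] by (intro power_mono) auto
      also have "\<dots> = a * \<rho>\<^sup>2" using assms by (simp add: \<rho>_def power_divide)
      finally have "(norm u)\<^sup>2 \<le> \<rho>\<^sup>2" using assms by simp
      then have "norm u \<le> \<rho>" by (rule power2_le_imp_le) (use assms in \<open>simp add: \<rho>_def\<close>)
      moreover have "y = \<phi> u" using u by (simp add: \<phi>_def u_def)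
      ultimately show "y \<in> \<phi> ` cball 0 \<rho>" by auto
    qed
    \<comment> \<open>The indicator is doubled: one copy is the target set of the change of
      variables, the other travels with the integrand and remains on the right.\<close>
    have "(\<integral>\<^sup>+y. h y * indicator W y \<partial>lborel) = (\<integral>\<^sup>+y. (h y * indicator W y) * indicator W y \<partial>lborel)"
      by (intro nn_integral_cong) (auto split: split_indicator)
    also have "\<dots> \<le> ennreal c * (\<integral>\<^sup>+u. (h (\<phi> u) * indicator W (\<phi> u)) * indicator (cball 0 \<rho>) u \<partial>lborel)"
      unfolding c_def by (rule nn_integral_lipschitz_image_le[OF lip L _ _ W surj]) auto
    also have "\<dots> \<le> ennreal c * (\<integral>\<^sup>+u. ennreal (1 / \<delta>) * ((\<Prod>i\<in>UNIV. std_normal_density (u $ i)) * (h (\<phi> u) * indicator W (\<phi> u))) \<partial>lborel)"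
    proof (intro mult_left_mono nn_integral_mono)
      fix u :: "real^'d"
      show "(h (\<phi> u) * indicator W (\<phi> u)) * indicator (cball 0 \<rho>) u \<le>
        ennreal (1 / \<delta>) * ((\<Prod>i\<in>UNIV. std_normal_density (u $ i)) * (h (\<phi> u) * indicator W (\<phi> u)))"
      proof (cases "u \<in> cball 0 \<rho>")
        case True
        then have "1 \<le> 1 / \<delta> * (\<Prod>i\<in>UNIV. std_normal_density (u $ i))"
          using \<delta>(1) \<delta>(2)[of u] by (simp add: field_simps)
        then have "1 \<le> ennreal (1 / \<delta> * (\<Prod>i\<in>UNIV. std_normal_density (u $ i)))" by simp
        then have "1 * (h (\<phi> u) * indicator W (\<phi> u)) \<le> ennreal (1 / \<delta> * (\<Prod>i\<in>UNIV. std_normal_density (u $ i))) * (h (\<phi> u) * indicator W (\<phi> u))"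
          by (intro mult_right_mono) auto
        moreover have "ennreal (1 / \<delta> * (\<Prod>i\<in>UNIV. std_normal_density (u $ i))) =
            ennreal (1 / \<delta>) * ennreal (\<Prod>i\<in>UNIV. std_normal_density (u $ i))"
          by (rule ennreal_mult) (use \<delta>(1) in \<open>auto intro!: prod_nonneg\<close>)
        moreover have "indicator (cball 0 \<rho>) u = (1 :: ennreal)" using True by simp
        ultimately show ?thesis by (simp only: mult_1_left mult_1_right mult.assoc)
      qed simp
    qed simp
    also have "\<dots> = ennreal c * (ennreal (1 / \<delta>) * (\<integral>\<^sup>+u. h (\<phi> u) * indicator W (\<phi> u) \<partial>std_gaussian))"
      unfolding std_gaussian_def by (subst nn_integral_density) (auto simp: nn_integral_cmult)
    also have "\<dots> = ennreal (c / \<delta>) * (\<integral>\<^sup>+u. h (\<phi> u) * indicator W (\<phi> u) \<partial>std_gaussian)"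
      using c \<delta> by (simp add: mult.assoc[symmetric] ennreal_mult[symmetric])
    finally show "(\<integral>\<^sup>+y. h y * indicator W y \<partial>lborel) \<le>
      ennreal (c / \<delta>) * (\<integral>\<^sup>+u. h (m + mat_sqrt C *v u) * indicator W (m + mat_sqrt C *v u) \<partial>std_gaussian)"
      unfolding \<phi>_def .
  qed
qed

text \<open>The indicator of a product set in factorized form, so that it splits under Fubini when
  one coordinate is singled out.\<close>

definition box_weight :: "('i \<Rightarrow> 'a set) \<Rightarrow> 'i set \<Rightarrow> ('i \<Rightarrow> 'a) \<Rightarrow> ennreal" where
  "box_weight W J y = (\<Prod>i\<in>J. indicator (W i) (y i))"

lemma measurable_box_weight:
  assumes "\<And>i. i \<in> J \<Longrightarrow> W i \<in> sets borel"
  shows "box_weight W J \<in> borel_measurable (PiM J (\<lambda>_. borel))"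
  unfolding box_weight_def[abs_def] using assms
  by (intro borel_measurable_prod_ennreal measurable_compose[OF measurable_component_singleton borel_measurable_indicator]) auto

lemma box_weight_eq_0: "finite J \<Longrightarrow> i \<in> J \<Longrightarrow> y i \<notin> W i \<Longrightarrow> box_weight W J y = 0"
  unfolding box_weight_def by (rule prod_zero) (auto intro: bexI[of _ i])

context cma_es begin

definition ordered_sets :: "(nat \<Rightarrow> (real^'d) set) \<Rightarrow> bool" where
  "ordered_sets W \<longleftrightarrow> (\<forall>i\<in>{1..lam}. W i \<in> sets borel \<and> bounded (W i)) \<and>
     (\<forall>i\<in>{1..lam}. \<forall>j\<in>{1..lam}. i < j \<longrightarrow> (\<forall>x\<in>W i. \<forall>y\<in>W j. f (xstar + x) < f (xstar + y)))"

text \<open>An iteration with the identity as ranking and Lebesgue measure on a box in place of the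
  law of the candidates.\<close>

definition lower_step :: "(nat \<Rightarrow> (real^'d) set) \<Rightarrow> ('d state \<Rightarrow> ennreal) \<Rightarrow> 'd state \<Rightarrow> ennreal" where
  "lower_step W h x = (\<integral>\<^sup>+y. h (upd x y) * box_weight W {1..lam} y \<partial>PiM {1..lam} (\<lambda>_. lborel))"

text \<open>The states for which \<open>affine_gaussian_dominates\<close> provides one common
  constant.\<close>

definition bounded_states :: "real \<Rightarrow> real \<Rightarrow> 'd state set" where
  "bounded_states R a = {x \<in> full_space. norm (fst x) \<le> R \<and> norm (snd x) \<le> R \<and>
     (\<forall>v. a * (norm v)\<^sup>2 \<le> v \<bullet> (snd x *v v))}"

lemma mu_subset: "{1..mu} \<subseteq> {1..lam}" "1 \<in> {1..mu}" "1 \<in> {1..lam}"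
  using mu by auto

lemma upd_cong: "(\<And>i. i \<in> {1..mu} \<Longrightarrow> y i = y' i) \<Longrightarrow> upd x y = upd x y'"
  by (auto simp: cma_update_def intro!: sum.cong)

lemma sum_w_norm_le:
  assumes "\<And>i. i \<in> {1..mu} \<Longrightarrow> norm (y i) \<le> (R::real)"
  shows "norm (\<Sum>i=1..mu. w i *\<^sub>R y i :: 'b::real_normed_vector) \<le> R"
proof -
  have "norm (\<Sum>i=1..mu. w i *\<^sub>R y i) \<le> (\<Sum>i=1..mu. w i * R)"
    by (rule sum_norm_le) (use assms w_pos in \<open>auto simp: abs_of_pos intro!: mult_left_mono less_imp_le\<close>)
  also have "\<dots> = R" using w_sum by (simp add: sum_distrib_right[symmetric])
  finally show ?thesis .
qed

lemma norm_snd_upd_le: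
  assumes "norm (fst x) \<le> R" "\<And>i. i \<in> {1..mu} \<Longrightarrow> norm (y i) \<le> R" "norm (snd x) \<le> S"
  shows "norm (snd (upd x y)) \<le> S + (2 * R)\<^sup>2"
proof -
  have "norm (\<Sum>i=1..mu. w i *\<^sub>R outer_square (y i - fst x)) \<le> (2 * R)\<^sup>2"
  proof (rule sum_w_norm_le)
    fix i assume "i \<in> {1..mu}"
    then have "norm (y i - fst x) \<le> 2 * R" using assms norm_triangle_ineq4[of "y i" "fst x"] by fastforce
    then show "norm (outer_square (y i - fst x)) \<le> (2 * R)\<^sup>2"
      unfolding norm_outer_square by (intro power_mono) auto
  qed
  then have "c * norm (\<Sum>i=1..mu. w i *\<^sub>R outer_square (y i - fst x)) \<le> 1 * (2 * R)\<^sup>2"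
    using c by (intro mult_mono) auto
  moreover have "(1 - c) * norm (snd x) \<le> 1 * S" using c assms(3) by (intro mult_mono) auto
  moreover have "norm (snd (upd x y)) \<le> (1 - c) * norm (snd x) + c * norm (\<Sum>i=1..mu. w i *\<^sub>R outer_square (y i - fst x))"
    unfolding cma_update_def snd_conv using c
    by (intro order_trans[OF norm_triangle_ineq]) simp
  ultimately show ?thesis by linarith
qed

text \<open>The coercivity of the covariance shrinks by the factor \<open>1 - c\<close> and the
  bounds grow, but the new constants again depend only on \<open>R\<close> and \<open>a\<close>, so
  the estimate of one step can be repeated.\<close>

lemma upd_bounded_states:
  assumes x: "x \<in> bounded_states R a" and y: "\<And>i. i \<in> {1..mu} \<Longrightarrow> norm (y i) \<le> R"
  shows "upd x y \<in> bounded_states (R + (2 * R)\<^sup>2) ((1 - c) * a)"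
proof -
  have x': "x \<in> full_space" "norm (fst x) \<le> R" "norm (snd x) \<le> R" "\<And>v. a * (norm v)\<^sup>2 \<le> v \<bullet> (snd x *v v)"
    using x by (auto simp: bounded_states_def)
  have "norm (fst (upd x y)) \<le> R" unfolding cma_update_def fst_conv by (rule sum_w_norm_le[OF y])
  moreover have "norm (snd (upd x y)) \<le> R + (2 * R)\<^sup>2" by (rule norm_snd_upd_le[OF x'(2) y x'(3)])
  moreover have "(1 - c) * a * (norm v)\<^sup>2 \<le> v \<bullet> (snd (upd x y) *v v)" for v
  proof -
    have "pos_semidef (c *\<^sub>R (\<Sum>i=1..mu. w i *\<^sub>R outer_square (y i - fst x)))"
      using c w_pos by (intro pos_semidef_scaleR pos_semidef_sum pos_semidef_outer_square) (auto intro: less_imp_le)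
    then have "0 \<le> v \<bullet> ((c *\<^sub>R (\<Sum>i=1..mu. w i *\<^sub>R outer_square (y i - fst x))) *v v)"
      by (simp add: pos_semidef_def)
    moreover have "(1 - c) * (a * (norm v)\<^sup>2) \<le> (1 - c) * (v \<bullet> (snd x *v v))"
      using c x'(4) by (intro mult_left_mono) auto
    ultimately show ?thesis
      unfolding cma_update_def snd_conv matrix_vector_mult_add_rdistrib inner_add_right
      by (simp add: scaleR_matrix_vector_assoc[symmetric])
  qed
  moreover have "R \<le> R + (2 * R)\<^sup>2" by simp
  ultimately show ?thesis
    using upd_full[OF x'(1)] unfolding bounded_states_def by (blast intro: order_trans)
qed

lemma bounded_states_mono: "R \<le> R' \<Longrightarrow> bounded_states R a \<subseteq> bounded_states R' a"
  by (auto simp: bounded_states_def)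

lemma sets_PiM_lborel [measurable_cong]:
  "sets (PiM J (\<lambda>_. lborel :: (real^'d) measure)) = sets (PiM J (\<lambda>_. borel))"
  by (intro sets_PiM_cong) auto

lemma measurable_upd_PiM: "(\<lambda>y. upd x y) \<in> PiM {1..lam} (\<lambda>_. borel) \<rightarrow>\<^sub>M borel"
  using mu_subset(1) by (intro measurable_upd measurable_const measurable_component_singleton) auto

lemma lower_step_mono:
  assumes "\<And>y. (\<And>i. i \<in> {1..lam} \<Longrightarrow> y i \<in> W i) \<Longrightarrow> h (upd x y) \<le> h' (upd x y)"
  shows "lower_step W h x \<le> lower_step W h' x"
  unfolding lower_step_def
proof (intro nn_integral_mono)
  fix y
  show "h (upd x y) * box_weight W {1..lam} y \<le> h' (upd x y) * box_weight W {1..lam} y"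
  proof (cases "\<forall>i\<in>{1..lam}. y i \<in> W i")
    case True then show ?thesis using assms by (intro mult_right_mono) auto
  next
    case False
    then have "box_weight W {1..lam} y = 0" using box_weight_eq_0[of "{1..lam}" _ y W] by blast
    then show ?thesis by simp
  qed
qed

text \<open>Samples whose candidates land in the sets \<open>W i\<close> are already in increasing
  order of objective value, so on this event the true step is \<open>upd\<close>. The constant is
  \<open>M ^ lam\<close> because all \<open>lam\<close> candidates are changed to Lebesgue
  measure.\<close>

lemma lower_step_le_K:
  assumes W: "ordered_sets W" and WR: "\<And>i. i \<in> {1..lam} \<Longrightarrow> W i \<subseteq> cball 0 R" and R: "R > 0" "a > 0"
  shows "\<exists>M\<ge>0. \<forall>x\<in>bounded_states R a. \<forall>h\<in>borel_measurable borel. lower_step W h x \<le> ennreal M * K h x"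
proof -
  obtain M :: real where M: "M \<ge> 0" "\<forall>m (C::real^'d^'d) W h. norm m \<le> R \<longrightarrow> norm C \<le> R \<longrightarrow> sym_pos_def C \<longrightarrow>
    (\<forall>v. a * (norm v)\<^sup>2 \<le> v \<bullet> (C *v v)) \<longrightarrow> W \<in> sets borel \<longrightarrow> W \<subseteq> cball 0 R \<longrightarrow> h \<in> borel_measurable borel \<longrightarrow>
    (\<integral>\<^sup>+y. h y * indicator W y \<partial>lborel) \<le>
    ennreal M * (\<integral>\<^sup>+u. h (m + mat_sqrt C *v u) * indicator W (m + mat_sqrt C *v u) \<partial>std_gaussian)"
    using affine_gaussian_dominates[where ?'d = 'd, OF R] by blast
  show ?thesis
  proof (intro exI[of _ "M ^ lam"] conjI ballI)
    show "M ^ lam \<ge> 0" using M by simp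
    fix x and h :: "'d state \<Rightarrow> ennreal" assume x: "x \<in> bounded_states R a" and h[measurable]: "h \<in> borel_measurable borel"
    have xf: "x \<in> full_space" "sym_pos_def (snd x)" using x by (auto simp: bounded_states_def full_space_def)
    define \<phi> where "\<phi> u = fst x + mat_sqrt (snd x) *v u" for u
    have \<phi>: "\<phi> \<in> std_gaussian \<rightarrow>\<^sub>M lborel" unfolding \<phi>_def by measurable
    have hu: "(\<lambda>y. h (upd x y)) \<in> borel_measurable (PiM {1..lam} (\<lambda>_. lborel))"
      using measurable_compose[OF measurable_upd_PiM h] by (simp cong: measurable_cong_sets add: sets_PiM_lborel)
    have "lower_step W h x \<le> ennreal M ^ card {1..lam} * (\<integral>\<^sup>+u. h (upd x (\<lambda>i\<in>{1..lam}. \<phi> (u i))) *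
        (\<Prod>i\<in>{1..lam}. indicator (W i) (\<phi> (u i))) \<partial>PiM {1..lam} (\<lambda>_. std_gaussian))"
      unfolding lower_step_def box_weight_def
    proof (rule PiM_nn_integral_dominated[OF _ _ \<phi>])
      show "sigma_finite_measure (lborel :: (real^'d) measure)" ..
      show "sigma_finite_measure (std_gaussian :: (real^'d) measure)"
        by (rule prob_space_imp_sigma_finite[OF prob_space_std_gaussian])
      fix i and h' :: "real^'d \<Rightarrow> ennreal" assume i: "i \<in> {1..lam}" and h': "h' \<in> borel_measurable (lborel :: (real^'d) measure)"
      show "(\<integral>\<^sup>+y. h' y * indicator (W i) y \<partial>lborel) \<le> ennreal M * (\<integral>\<^sup>+u. h' (\<phi> u) * indicator (W i) (\<phi> u) \<partial>std_gaussian)"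
        unfolding \<phi>_def using x W i WR h' xf by (intro M(2)[rule_format]) (auto simp: bounded_states_def ordered_sets_def)
    qed (use W hu in \<open>auto simp: ordered_sets_def\<close>)
    also have "\<dots> \<le> ennreal M ^ card {1..lam} * (\<integral>\<^sup>+u. h (step x u) \<partial>PiM {1..lam} (\<lambda>_. std_gaussian))"
    proof (intro mult_left_mono nn_integral_mono)
      fix u
      show "h (upd x (\<lambda>i\<in>{1..lam}. \<phi> (u i))) * (\<Prod>i\<in>{1..lam}. indicator (W i) (\<phi> (u i))) \<le> h (step x u)"
      proof (cases "\<forall>i\<in>{1..lam}. \<phi> (u i) \<in> W i")
        case True
        have cand: "candidate x u i = \<phi> (u i)" for i using xf by (simp add: candidate_def \<phi>_def)
        have "ranking lam (\<lambda>i. f (xstar + candidate x u i)) = id"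
          using W True unfolding cand ordered_sets_def by (intro ranking_increasing) blast
        then have "step x u = upd x (\<lambda>i. \<phi> (u i))" by (simp add: step_eq_upd[OF xf(1)] cand)
        also have "\<dots> = upd x (\<lambda>i\<in>{1..lam}. \<phi> (u i))"
          using mu_subset(1) by (intro upd_cong) auto
        finally show ?thesis using True by simp
      next
        case False
        then have "(\<Prod>i\<in>{1..lam}. indicator (W i) (\<phi> (u i)) :: ennreal) = 0"
          using box_weight_eq_0[of "{1..lam}" _ "\<lambda>i. \<phi> (u i)" W] unfolding box_weight_def by blast
        then show ?thesis by (simp only: mult_zero_right zero_le)
      qed
    qed simp
    also have "\<dots> = ennreal (M ^ lam) * K h x"
      using M by (simp add: K_def noise_def ennreal_power)
    finally show "lower_step W h x \<le> ennreal (M ^ lam) * K h x" .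
  qed
qed

fun lower_steps :: "(nat \<Rightarrow> (real^'d) set) list \<Rightarrow> ('d state \<Rightarrow> ennreal) \<Rightarrow> 'd state \<Rightarrow> ennreal" where
  "lower_steps [] h = h"
| "lower_steps (W # Ws) h = lower_step W (lower_steps Ws h)"

lemma lower_steps_le_K_pow:
  assumes "\<And>W. W \<in> set Ws \<Longrightarrow> ordered_sets W" and "R > 0" "a > 0"
  shows "\<exists>M\<ge>0. \<forall>x\<in>bounded_states R a. \<forall>h\<in>borel_measurable borel.
    lower_steps Ws h x \<le> ennreal M * (K ^^ length Ws) h x"
  using assms
proof (induction Ws arbitrary: R a)
  case Nil
  then show ?case by (intro exI[of _ 1]) auto
next
  case (Cons W Ws)
  have W: "ordered_sets W" using Cons.prems by auto
  have "bounded (\<Union>i\<in>{1..lam}. W i)" using W by (auto simp: ordered_sets_def)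
  then obtain R' where R': "\<And>y i. i \<in> {1..lam} \<Longrightarrow> y \<in> W i \<Longrightarrow> norm y \<le> R'"
    by (metis UN_I bounded_iff)
  define R1 where "R1 = max R R'"
  have R1: "R1 > 0" "R \<le> R1" using Cons.prems by (auto simp: R1_def)
  have WR: "W i \<subseteq> cball 0 R1" if "i \<in> {1..lam}" for i
    using R'[OF that] by (force simp: R1_def)
  obtain M where M: "M \<ge> 0" "\<And>x h. x \<in> bounded_states R1 a \<Longrightarrow> h \<in> borel_measurable borel \<Longrightarrow> lower_step W h x \<le> ennreal M * K h x"
    using lower_step_le_K[OF W WR R1(1) Cons.prems(3)] by blast
  have "\<exists>M\<ge>0. \<forall>x\<in>bounded_states (R1 + (2 * R1)\<^sup>2) ((1 - c) * a). \<forall>h\<in>borel_measurable borel.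
    lower_steps Ws h x \<le> ennreal M * (K ^^ length Ws) h x"
    using Cons.prems R1 c by (intro Cons.IH) (auto intro: add_pos_nonneg)
  then obtain M' where M': "M' \<ge> 0" "\<And>x h. x \<in> bounded_states (R1 + (2 * R1)\<^sup>2) ((1 - c) * a) \<Longrightarrow> h \<in> borel_measurable borel \<Longrightarrow>
    lower_steps Ws h x \<le> ennreal M' * (K ^^ length Ws) h x" by blast
  show ?case
  proof (intro exI[of _ "M' * M"] conjI ballI)
    fix x and h :: "'d state \<Rightarrow> ennreal"
    assume "x \<in> bounded_states R a" and h: "h \<in> borel_measurable borel"
    then have x: "x \<in> bounded_states R1 a" using bounded_states_mono[OF R1(2)] by blast
    have hn: "(K ^^ length Ws) h \<in> borel_measurable borel" by (rule measurable_K_pow[OF h])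
    have "lower_step W (lower_steps Ws h) x \<le> lower_step W (\<lambda>x. ennreal M' * (K ^^ length Ws) h x) x"
    proof (rule lower_step_mono)
      fix y assume "\<And>i. i \<in> {1..lam} \<Longrightarrow> y i \<in> W i"
      then have "norm (y i) \<le> R1" if "i \<in> {1..mu}" for i
        using WR[of i] that mu_subset(1) by fastforce
      then show "lower_steps Ws h (upd x y) \<le> ennreal M' * (K ^^ length Ws) h (upd x y)"
        by (intro M' upd_bounded_states[OF x] h)
    qed
    also have "\<dots> \<le> ennreal M * K (\<lambda>x. ennreal M' * (K ^^ length Ws) h x) x"
      using hn by (intro M x) auto
    also have "K (\<lambda>x. ennreal M' * (K ^^ length Ws) h x) x = ennreal M' * K ((K ^^ length Ws) h) x"
      unfolding K_def[of _ x] by (rule nn_integral_cmult[OF measurable_compose[OF measurable_step' hn]])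
    finally show "lower_steps (W # Ws) h x \<le> ennreal (M' * M) * (K ^^ length (W # Ws)) h x"
      using M M' by (simp add: ennreal_mult mult_ac)
  qed (use M M' in simp)
qed

text \<open>If \<open>f\<close> took finitely many values near \<open>p\<close>, a ball would be a
  finite union of null sets. So \<open>lam\<close> distinct values occur; points attaining them are
  numbered in increasing order, and continuity separates the values on small balls.\<close>

lemma ordered_balls_exist:
  assumes "\<epsilon> > 0"
  obtains a \<eta> where "\<eta> > 0" "\<And>i. i \<in> {1..lam} \<Longrightarrow> a i \<in> ball p \<epsilon>"
    "\<And>i j x y. i \<in> {1..lam} \<Longrightarrow> j \<in> {1..lam} \<Longrightarrow> i < j \<Longrightarrow> x \<in> ball (a i) \<eta> \<Longrightarrow> y \<in> ball (a j) \<eta> \<Longrightarrow>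
      f (xstar + x) < f (xstar + y)"
proof -
  define g where "g x = f (xstar + x)" for x
  have "infinite (g ` ball p \<epsilon>)"
  proof
    assume fin: "finite (g ` ball p \<epsilon>)"
    have "ball (xstar + p) \<epsilon> \<subseteq> (\<Union>t\<in>g ` ball p \<epsilon>. {x. f x = t})"
    proof
      fix x assume "x \<in> ball (xstar + p) \<epsilon>"
      then have "x - xstar \<in> ball p \<epsilon>" by (simp add: dist_norm algebra_simps)
      moreover have "f x = g (x - xstar)" by (simp add: g_def)
      ultimately show "x \<in> (\<Union>t\<in>g ` ball p \<epsilon>. {x. f x = t})" by blast
    qed
    moreover have "(\<Union>t\<in>g ` ball p \<epsilon>. {x. f x = t}) \<in> null_sets lborel"
      using negl fin unfolding negligible_level_sets_def by (intro null_sets.finite_UN) auto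
    ultimately have "ball (xstar + p) \<epsilon> \<in> null_sets lborel"
      by (rule null_sets_subset[rotated 2]) auto
    then have "emeasure lborel (ball (xstar + p) \<epsilon>) = 0" by auto
    then show False using assms unit_ball_vol_pos[of "real CARD('d)"] by (simp add: emeasure_ball)
  qed
  then obtain T where T: "finite T" "card T = lam" "T \<subseteq> g ` ball p \<epsilon>"
    by (meson infinite_arbitrarily_large)
  define t where "t i = sorted_list_of_set T ! (i - 1)" for i
  have tT: "t i \<in> T" if "i \<in> {1..lam}" for i
    using that T nth_mem[of "i - 1" "sorted_list_of_set T"] by (auto simp: t_def)
  have t_less: "t i < t j" if "i \<in> {1..lam}" "j \<in> {1..lam}" "i < j" for i j
    using that T strict_sorted_list_of_set[of T] unfolding t_def sorted_wrt_iff_nth_less by auto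
  have "\<exists>x. x \<in> ball p \<epsilon> \<and> g x = t i" if "i \<in> {1..lam}" for i
    using subsetD[OF T(3) tT[OF that]] by auto
  then obtain a where a: "\<And>i. i \<in> {1..lam} \<Longrightarrow> a i \<in> ball p \<epsilon>" "\<And>i. i \<in> {1..lam} \<Longrightarrow> g (a i) = t i"
    by metis
  have contg: "continuous_on UNIV g"
    unfolding g_def by (intro continuous_on_compose2[OF cont] continuous_intros) auto
  have "\<exists>d>0. \<forall>x\<in>ball (a i) d. \<forall>y\<in>ball (a j) d. g x < g y" if ij: "i \<in> {1..lam}" "j \<in> {1..lam}" "i < j" for i j
  proof -
    obtain e where e: "t i < e" "e < t j" using dense[OF t_less[OF ij]] by blast
    have "open {x. g x < e}" "open {x. e < g x}"
      using contg by (auto intro!: open_Collect_less continuous_on_const)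
    moreover have "a i \<in> {x. g x < e}" "a j \<in> {x. e < g x}" using a ij e by auto
    ultimately obtain d1 d2 where d1: "d1 > 0" "ball (a i) d1 \<subseteq> {x. g x < e}"
      and d2: "d2 > 0" "ball (a j) d2 \<subseteq> {x. e < g x}"
      unfolding open_contains_ball by blast
    have "g x < g y" if "x \<in> ball (a i) (min d1 d2)" "y \<in> ball (a j) (min d1 d2)" for x y
      using that d1 d2 by force
    then show ?thesis using d1 d2 by (intro exI[of _ "min d1 d2"]) auto
  qed
  note pair = this
  define d where "d i j = (SOME d. d > 0 \<and> (\<forall>x\<in>ball (a i) d. \<forall>y\<in>ball (a j) d. g x < g y))" for i j
  have d: "d i j > 0 \<and> (\<forall>x\<in>ball (a i) (d i j). \<forall>y\<in>ball (a j) (d i j). g x < g y)"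
    if "i \<in> {1..lam}" "j \<in> {1..lam}" "i < j" for i j
    unfolding d_def by (rule someI_ex) (rule pair[OF that])
  \<comment> \<open>The element 1 keeps the minimum meaningful when there is no pair of
    indices.\<close>
  define D where "D = insert 1 ((\<lambda>(i, j). d i j) ` {(i, j). i \<in> {1..lam} \<and> j \<in> {1..lam} \<and> i < j})"
  have "finite {(i, j). i \<in> {1..lam} \<and> j \<in> {1..lam} \<and> i < j}"
    by (rule finite_subset[of _ "{1..lam} \<times> {1..lam}"]) auto
  then have finD: "finite D" unfolding D_def by (intro finite.insertI finite_imageI)
  show ?thesis
  proof (rule that[of "Min D" a])
    show "Min D > 0" using finD d by (subst Min_gr_iff) (auto simp: D_def)
    fix i j x y assume ij: "i \<in> {1..lam}" "j \<in> {1..lam}" "i < j"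
      and xy: "x \<in> ball (a i) (Min D)" "y \<in> ball (a j) (Min D)"
    have "d i j \<in> D" using ij by (auto simp: D_def)
    then have "Min D \<le> d i j" using finD by (rule Min_le[rotated])
    then show "f (xstar + x) < f (xstar + y)" using d[OF ij] xy by (auto simp: g_def)
  qed (use a in auto)
qed

end

section \<open>Two consecutive steps\<close>

lemma nn_integral_lborel_translate:
  fixes g :: "'a::euclidean_space \<Rightarrow> ennreal"
  assumes "g \<in> borel_measurable borel"
  shows "(\<integral>\<^sup>+x. g (x + a) \<partial>lborel) = (\<integral>\<^sup>+x. g x \<partial>lborel)"
proof -
  have "(\<integral>\<^sup>+x. g x \<partial>lborel) = (\<integral>\<^sup>+x. g x \<partial>distr lborel borel ((+) a))"
    by (simp add: lborel_distr_plus)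
  also have "\<dots> = (\<integral>\<^sup>+x. g (a + x) \<partial>lborel)"
    using assms by (subst nn_integral_distr) auto
  finally show ?thesis by (simp add: add.commute)
qed

text \<open>Completing the square in one matrix entry, primes marking the second index. Here
  \<open>e\<close> is \<open>1 - c\<close>, \<open>a\<close> is \<open>w 1\<close>, \<open>q\<close>
  the tail of the first candidates, \<open>M\<close> the average of the second ones, and the
  assumptions say that \<open>s\<close> is the vertex, where the terms linear in
  \<open>t - s\<close> cancel.\<close>

lemma double_step_identity:
  fixes a c e m q s t M :: real
  assumes "M = (e + a) * s - e * m + q" "M' = (e + a) * s' - e * m' + q'"
  shows "e * (c * (a * ((t - m) * (t' - m')))) + c * (- (M * (a * t' + q')) - (a * t + q) * M' + (a * t + q) * (a * t' + q')) =
    c * a * (e + a) * ((t - s) * (t' - s')) +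
    (e * (c * (a * ((s - m) * (s' - m')))) + c * (- (M * (a * s' + q')) - (a * s + q) * M' + (a * s + q) * (a * s' + q')))"
  unfolding assms by (simp add: algebra_simps)

context cma_es begin

definition avg :: "(nat \<Rightarrow> real^'d) \<Rightarrow> real^'d" where
  "avg y = (\<Sum>i=1..mu. w i *\<^sub>R y i)"

definition tail :: "(nat \<Rightarrow> real^'d) \<Rightarrow> real^'d" where
  "tail y = (\<Sum>i\<in>{1..mu} - {1}. w i *\<^sub>R y i)"

text \<open>Two steps with candidates \<open>y(1 := t)\<close> and \<open>y'\<close> give a mean independent of \<open>t\<close> and a covariance
  quadratic in \<open>t\<close>; \<open>center\<close> is the vertex of that quadratic and \<open>residual\<close> its value there when the
  initial covariance is \<open>0\<close>.\<close>

definition center :: "real^'d \<Rightarrow> (nat \<Rightarrow> real^'d) \<Rightarrow> (nat \<Rightarrow> real^'d) \<Rightarrow> real^'d" where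
  "center m y y' = (1 / (1 - c + w 1)) *\<^sub>R ((1 - c) *\<^sub>R m + avg y' - tail y)"

definition residual :: "real^'d \<Rightarrow> (nat \<Rightarrow> real^'d) \<Rightarrow> (nat \<Rightarrow> real^'d) \<Rightarrow> real^'d^'d" where
  "residual m y y' = snd (upd (upd (m, 0) (y(1 := center m y y'))) y')"

text \<open>The coefficient of \<open>t t\<^sup>T\<close> after two steps: \<open>c * w 1\<close>
  from the first, discounted by \<open>1 - c\<close>, plus \<open>c * (w 1)\<^sup>2\<close> from the
  second, because \<open>t\<close> moves the intermediate mean by
  \<open>w 1 *\<^sub>R t\<close>.\<close>

definition kappa :: real where "kappa = c * w 1 * (1 - c + w 1)"

lemma w1: "w 1 > 0" using w_pos[of 1] mu by simp

lemma fst_upd: "fst (upd x y) = avg y"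
  by (simp add: cma_update_def avg_def)

lemma sum_split_first: "(\<Sum>i=1..mu. g i) = g 1 + (\<Sum>i\<in>{1..mu} - {1}. g i :: 'b::comm_monoid_add)"
  using mu by (intro sum.remove) auto

lemma avg_upd: "avg (y(1 := t)) = w 1 *\<^sub>R t + tail y"
  unfolding avg_def tail_def sum_split_first by (intro arg_cong2[where f = "(+)"] sum.cong) auto

text \<open>The terms are grouped as initial covariance, terms involving \<open>t\<close>, and terms
  free of \<open>t\<close>. In the second step the square of the intermediate mean has total weight
  one because the weights sum to one.\<close>

lemma upd_upd_component:
  "snd (upd (upd (m, C) (y(1 := t))) y') $ k $ l =
     (1 - c)\<^sup>2 * C $ k $ l + (1 - c) * (c * (w 1 * ((t $ k - m $ k) * (t $ l - m $ l))))
     + c * (- (avg y' $ k * (w 1 * t $ l + tail y $ l)) - (w 1 * t $ k + tail y $ k) * avg y' $ l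
       + (w 1 * t $ k + tail y $ k) * (w 1 * t $ l + tail y $ l))
     + ((1 - c) * (c * (\<Sum>i\<in>{1..mu} - {1}. w i * ((y i $ k - m $ k) * (y i $ l - m $ l))))
       + c * (\<Sum>i=1..mu. w i * (y' i $ k * y' i $ l)))"
proof -
  have first: "(\<Sum>i=1..mu. w i *\<^sub>R outer_square ((y(1 := t)) i - m)) $ k $ l =
      w 1 * ((t $ k - m $ k) * (t $ l - m $ l)) + (\<Sum>i\<in>{1..mu} - {1}. w i * ((y i $ k - m $ k) * (y i $ l - m $ l)))"
    unfolding sum_split_first by (simp add: outer_square_component)
  have second: "(\<Sum>i=1..mu. w i *\<^sub>R outer_square (y' i - z)) $ k $ l =
      (\<Sum>i=1..mu. w i * (y' i $ k * y' i $ l)) - avg y' $ k * z $ l - z $ k * avg y' $ l + z $ k * z $ l" for z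
  proof -
    have "(\<Sum>i=1..mu. w i *\<^sub>R outer_square (y' i - z)) $ k $ l =
      (\<Sum>i=1..mu. w i * (y' i $ k * y' i $ l) - w i * y' i $ k * z $ l - z $ k * (w i * y' i $ l) + w i * (z $ k * z $ l))"
      by (simp add: outer_square_component algebra_simps)
    also have "\<dots> = (\<Sum>i=1..mu. w i * (y' i $ k * y' i $ l)) - avg y' $ k * z $ l - z $ k * avg y' $ l
        + (\<Sum>i=1..mu. w i) * (z $ k * z $ l)"
      by (simp add: sum.distrib sum_subtractf avg_def sum_distrib_left sum_distrib_right)
    finally show ?thesis by (simp only: w_sum mult_1_left)
  qed
  have z: "fst (upd (m, C) (y(1 := t))) = w 1 *\<^sub>R t + tail y" by (simp only: fst_upd avg_upd)
  have "snd (upd (upd (m, C) (y(1 := t))) y') $ k $ l =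
      (1 - c) * ((1 - c) * C $ k $ l + c * (\<Sum>i=1..mu. w i *\<^sub>R outer_square ((y(1 := t)) i - m)) $ k $ l)
      + c * (\<Sum>i=1..mu. w i *\<^sub>R outer_square (y' i - (w 1 *\<^sub>R t + tail y))) $ k $ l"
    unfolding cma_update_def[of mu w c "upd (m, C) (y(1 := t))"] z
    by (simp add: cma_update_def)
  then show ?thesis
    unfolding first second by (simp add: algebra_simps power2_eq_square)
qed

lemma upd_upd:
  "upd (upd (m, C) (y(1 := t))) y' =
    (avg y', (1 - c)\<^sup>2 *\<^sub>R C + kappa *\<^sub>R outer_square (t - center m y y') + residual m y y')"
proof -
  define s where "s = center m y y'"
  have A: "1 - c + w 1 > 0" using w1 c by simp
  have "(1 - c + w 1) *\<^sub>R s = (1 - c) *\<^sub>R m + avg y' - tail y"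
    using A by (simp add: s_def center_def)
  then have "(1 - c + w 1) * s $ k = (1 - c) * m $ k + avg y' $ k - tail y $ k" for k
    by (simp add: vec_eq_iff)
  \<comment> \<open>The defining equation of the vertex solved for the average, in the shape
    required by \<open>double_step_identity\<close>.\<close>
  then have M: "avg y' $ k = (1 - c + w 1) * s $ k - (1 - c) * m $ k + tail y $ k" for k
    by (simp add: algebra_simps)
  have "snd (upd (upd (m, C) (y(1 := t))) y') $ k $ l =
      ((1 - c)\<^sup>2 *\<^sub>R C + kappa *\<^sub>R outer_square (t - s) + residual m y y') $ k $ l" for k l
  proof -
    have res: "residual m y y' $ k $ l = (1 - c) * (c * (w 1 * ((s $ k - m $ k) * (s $ l - m $ l))))
     + c * (- (avg y' $ k * (w 1 * s $ l + tail y $ l)) - (w 1 * s $ k + tail y $ k) * avg y' $ l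
       + (w 1 * s $ k + tail y $ k) * (w 1 * s $ l + tail y $ l))
     + ((1 - c) * (c * (\<Sum>i\<in>{1..mu} - {1}. w i * ((y i $ k - m $ k) * (y i $ l - m $ l))))
       + c * (\<Sum>i=1..mu. w i * (y' i $ k * y' i $ l)))"
      unfolding residual_def s_def[symmetric] upd_upd_component by simp
    show ?thesis
      unfolding vector_add_component vector_scaleR_component upd_upd_component res outer_square_component
        kappa_def vector_minus_component
      using double_step_identity[OF M[of k] M[of l], of c "t $ k" "t $ l"] by simp
  qed
  then show ?thesis by (auto simp: s_def vec_eq_iff fst_upd intro!: prod_eqI)
qed

abbreviation "L J \<equiv> PiM J (\<lambda>_::nat. lborel :: (real^'d) measure)"
abbreviation "I \<equiv> {1..lam}"
abbreviation "I' \<equiv> {1..lam} - {1}"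

lemma measurable_avg:
  "(\<And>i. i \<in> {1..mu} \<Longrightarrow> (\<lambda>x. y x i) \<in> M \<rightarrow>\<^sub>M borel) \<Longrightarrow> (\<lambda>x. avg (y x)) \<in> M \<rightarrow>\<^sub>M borel"
  unfolding avg_def by measurable

lemma measurable_center:
  assumes [measurable]: "m \<in> M \<rightarrow>\<^sub>M borel"
    and y[measurable]: "\<And>i. i \<in> {1..mu} - {1} \<Longrightarrow> (\<lambda>x. y x i) \<in> M \<rightarrow>\<^sub>M borel"
    and y': "\<And>i. i \<in> {1..mu} \<Longrightarrow> (\<lambda>x. y' x i) \<in> M \<rightarrow>\<^sub>M borel"
  shows "(\<lambda>x. center (m x) (y x) (y' x)) \<in> M \<rightarrow>\<^sub>M borel"
proof -
  have [measurable]: "(\<lambda>x. avg (y' x)) \<in> M \<rightarrow>\<^sub>M borel" by (rule measurable_avg[OF y'])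
  show ?thesis unfolding center_def tail_def by measurable
qed

lemma measurable_residual:
  assumes m[measurable]: "m \<in> M \<rightarrow>\<^sub>M borel"
    and y: "\<And>i. i \<in> {1..mu} - {1} \<Longrightarrow> (\<lambda>x. y x i) \<in> M \<rightarrow>\<^sub>M borel"
    and y': "\<And>i. i \<in> {1..mu} \<Longrightarrow> (\<lambda>x. y' x i) \<in> M \<rightarrow>\<^sub>M borel"
  shows "(\<lambda>x. residual (m x) (y x) (y' x)) \<in> M \<rightarrow>\<^sub>M borel"
proof -
  have "(\<lambda>x. ((y x)(1 := center (m x) (y x) (y' x))) i) \<in> M \<rightarrow>\<^sub>M borel" if "i \<in> {1..mu}" for i
    using that y measurable_center[OF m y y'] by (cases "i = 1") auto
  moreover have "(\<lambda>x. (m x, 0 :: real^'d^'d)) \<in> M \<rightarrow>\<^sub>M borel"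
    unfolding borel_prod[symmetric] by measurable
  ultimately have "(\<lambda>x. upd (upd (m x, 0) ((y x)(1 := center (m x) (y x) (y' x)))) (y' x)) \<in> M \<rightarrow>\<^sub>M borel"
    by (intro measurable_upd y')
  then show ?thesis unfolding residual_def borel_prod[symmetric] by (rule measurable_compose[OF _ measurable_snd])
qed

lemma sigma_finite_L: "finite J \<Longrightarrow> sigma_finite_measure (L J)"
proof -
  interpret product_sigma_finite "\<lambda>_::nat. lborel :: (real^'d) measure" ..
  show "finite J \<Longrightarrow> sigma_finite_measure (L J)" by (rule sigma_finite)
qed

lemma measurable_box_weight_L:
  "(\<And>i. i \<in> J \<Longrightarrow> W i \<in> sets borel) \<Longrightarrow> box_weight W J \<in> borel_measurable (L J)"
  using measurable_box_weight[of J W] by (simp cong: measurable_cong_sets add: sets_PiM_lborel)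

lemma measurable_lower_step:
  assumes W: "\<And>i. i \<in> I \<Longrightarrow> W i \<in> sets borel" and h: "h \<in> borel_measurable borel"
  shows "lower_step W h \<in> borel_measurable borel"
proof -
  interpret sigma_finite_measure "L I" by (rule sigma_finite_L) simp
  have "(\<lambda>p. upd (fst p) (snd p)) \<in> borel \<Otimes>\<^sub>M L I \<rightarrow>\<^sub>M borel"
    using mu_subset(1) by (intro measurable_upd measurable_fst)
      (auto intro!: measurable_compose[OF measurable_snd] measurable_component_singleton[THEN measurable_compose])
  from measurable_compose[OF this h]
  have [measurable]: "(\<lambda>p. h (upd (fst p) (snd p))) \<in> borel \<Otimes>\<^sub>M L I \<rightarrow>\<^sub>M borel" .
  have [measurable]: "box_weight W I \<in> borel_measurable (L I)"
    by (rule measurable_box_weight_L[OF W])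
  have "(\<lambda>(x, y). h (upd x y) * box_weight W I y) \<in> borel_measurable (borel \<Otimes>\<^sub>M L I)"
    unfolding split_beta' by measurable
  then show ?thesis unfolding lower_step_def by (intro borel_measurable_nn_integral) simp
qed

lemma measurable_lower_steps:
  assumes "\<And>W i. W \<in> set Ws \<Longrightarrow> i \<in> I \<Longrightarrow> W i \<in> sets borel" "h \<in> borel_measurable borel"
  shows "lower_steps Ws h \<in> borel_measurable borel"
  using assms by (induction Ws) (auto intro: measurable_lower_step)

text \<open>A double step without its rank-one term. That term is moved into the starting
  covariance, divided by \<open>(1 - c)\<^sup>2\<close>, since exactly this factor is applied to
  \<open>snd x\<close>. Candidate 1 of the first step is absent because it is replaced by the
  integration over \<open>r\<close>.\<close>

definition refresh ::
  "(nat \<Rightarrow> (real^'d) set) \<Rightarrow> (nat \<Rightarrow> (real^'d) set) \<Rightarrow> ('d state \<Rightarrow> ennreal) \<Rightarrow> 'd state \<Rightarrow> ennreal" where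
  "refresh W V H x = (\<integral>\<^sup>+p. H (avg (snd p), (1 - c)\<^sup>2 *\<^sub>R snd x + residual (fst x) (fst p) (snd p)) *
     (box_weight W I' (fst p) * box_weight V I (snd p)) \<partial>(L I' \<Otimes>\<^sub>M L I))"

lemma sigma_finite_LL: "sigma_finite_measure (L I' \<Otimes>\<^sub>M L I)"
  by (intro sigma_finite_pair_measure sigma_finite_L) auto

lemma measurable_component_L: "i \<in> J \<Longrightarrow> (\<lambda>y. y i) \<in> L J \<rightarrow>\<^sub>M borel"
  using measurable_component_singleton[of i J "\<lambda>_. lborel"] by simp

lemma measurable_refresh_integrand:
  assumes W: "\<And>i. i \<in> I \<Longrightarrow> W i \<in> sets borel" and V: "\<And>i. i \<in> I \<Longrightarrow> V i \<in> sets borel"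
    and H: "H \<in> borel_measurable borel" and x: "x \<in> N \<rightarrow>\<^sub>M borel" and p: "p \<in> N \<rightarrow>\<^sub>M (L I' \<Otimes>\<^sub>M L I)"
  shows "(\<lambda>z. H (avg (snd (p z)), (1 - c)\<^sup>2 *\<^sub>R snd (x z) + residual (fst (x z)) (fst (p z)) (snd (p z))) *
     (box_weight W I' (fst (p z)) * box_weight V I (snd (p z)))) \<in> borel_measurable N"
proof -
  have y: "(\<lambda>z. fst (p z)) \<in> N \<rightarrow>\<^sub>M L I'" by (rule measurable_compose[OF p measurable_fst])
  have y': "(\<lambda>z. snd (p z)) \<in> N \<rightarrow>\<^sub>M L I" by (rule measurable_compose[OF p measurable_snd])
  have yi: "(\<lambda>z. fst (p z) i) \<in> N \<rightarrow>\<^sub>M borel" if "i \<in> {1..mu} - {1}" for i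
    using that mu_subset(1) by (intro measurable_compose[OF y measurable_component_L]) auto
  have yi': "(\<lambda>z. snd (p z) i) \<in> N \<rightarrow>\<^sub>M borel" if "i \<in> {1..mu}" for i
    using that mu_subset(1) by (intro measurable_compose[OF y' measurable_component_L]) auto
  have [measurable]: "(\<lambda>z. fst (x z)) \<in> N \<rightarrow>\<^sub>M borel" "(\<lambda>z. snd (x z)) \<in> N \<rightarrow>\<^sub>M borel"
    using x by (auto simp: borel_prod[symmetric])
  have [measurable]: "(\<lambda>z. residual (fst (x z)) (fst (p z)) (snd (p z))) \<in> N \<rightarrow>\<^sub>M borel"
    by (intro measurable_residual yi yi') auto
  have [measurable]: "(\<lambda>z. avg (snd (p z))) \<in> N \<rightarrow>\<^sub>M borel" by (intro measurable_avg yi')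
  have "(\<lambda>z. (avg (snd (p z)), (1 - c)\<^sup>2 *\<^sub>R snd (x z) + residual (fst (x z)) (fst (p z)) (snd (p z)))) \<in> N \<rightarrow>\<^sub>M borel"
    unfolding borel_prod[symmetric] by measurable
  from measurable_compose[OF this H]
  have [measurable]: "(\<lambda>z. H (avg (snd (p z)), (1 - c)\<^sup>2 *\<^sub>R snd (x z) + residual (fst (x z)) (fst (p z)) (snd (p z)))) \<in> borel_measurable N" .
  have [measurable]: "(\<lambda>z. box_weight W I' (fst (p z))) \<in> borel_measurable N"
    using W by (intro measurable_compose[OF y] measurable_box_weight_L) auto
  have [measurable]: "(\<lambda>z. box_weight V I (snd (p z))) \<in> borel_measurable N"
    using V by (intro measurable_compose[OF y'] measurable_box_weight_L) auto
  show ?thesis by measurable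
qed

lemma measurable_refresh:
  assumes "\<And>i. i \<in> I \<Longrightarrow> W i \<in> sets borel" "\<And>i. i \<in> I \<Longrightarrow> V i \<in> sets borel" "H \<in> borel_measurable borel"
  shows "refresh W V H \<in> borel_measurable borel"
proof -
  interpret sigma_finite_measure "L I' \<Otimes>\<^sub>M L I" by (rule sigma_finite_LL)
  show ?thesis
    unfolding refresh_def using measurable_refresh_integrand[OF assms measurable_fst measurable_snd]
    by (intro borel_measurable_nn_integral) (simp add: split_beta')
qed

text \<open>\<open>r\<close> is the offset of candidate 1 from the vertex. The vertex varies with
  the mean and the other candidates, but one fixed ball of offsets is to be allowed for all of
  them.\<close>

definition compatible ::
  "(nat \<Rightarrow> (real^'d) set) \<Rightarrow> (nat \<Rightarrow> (real^'d) set) \<Rightarrow> real \<Rightarrow> real^'d \<Rightarrow> real \<Rightarrow> bool" where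
  "compatible W V \<sigma> b \<rho> \<longleftrightarrow> (\<forall>m y y' r. norm m \<le> \<sigma> \<longrightarrow> (\<forall>i\<in>I'. y i \<in> W i) \<longrightarrow> (\<forall>i\<in>I. y' i \<in> V i) \<longrightarrow>
     r \<in> cball b \<rho> \<longrightarrow> r + center m y y' \<in> W 1)"

text \<open>With all other candidates fixed, candidate 1 is substituted by
  \<open>r + center m y y'\<close>, a translation. Compatibility then permits restricting
  \<open>r\<close> to a ball independent of everything else, and Fubini brings its integral to the
  outside.\<close>

lemma double_step_lower:
  assumes W: "\<And>i. i \<in> I \<Longrightarrow> W i \<in> sets borel" and V: "\<And>i. i \<in> I \<Longrightarrow> V i \<in> sets borel"
    and H: "H \<in> borel_measurable borel" and comp: "compatible W V \<sigma> b \<rho>" and m: "norm m \<le> \<sigma>"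
  shows "(\<integral>\<^sup>+r. refresh W V H (m, C + (kappa / (1 - c)\<^sup>2) *\<^sub>R outer_square r) * indicator (cball b \<rho>) r \<partial>lborel)
    \<le> lower_step W (lower_step V H) (m, C)"
proof -
  interpret P: product_sigma_finite "\<lambda>_::nat. lborel :: (real^'d) measure" ..
  interpret LI: sigma_finite_measure "L I" by (rule sigma_finite_L) simp
  interpret LL: sigma_finite_measure "L I' \<Otimes>\<^sub>M L I" by (rule sigma_finite_LL)
  interpret Q1: pair_sigma_finite "L I" "lborel :: (real^'d) measure" ..
  interpret Q2: pair_sigma_finite "L I' \<Otimes>\<^sub>M L I" "lborel :: (real^'d) measure" ..
  have ins: "insert 1 I' = I" "1 \<notin> I'" "finite I'" using mu by auto
  define \<Phi> where "\<Phi> y t y' = H (upd (upd (m, C) (y(1 := t))) y') * box_weight V I y' * (indicator (W 1) t * box_weight W I' y)" for y t y'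
  define \<Psi> where "\<Psi> p r = H (avg (snd p), (1 - c)\<^sup>2 *\<^sub>R (C + (kappa / (1 - c)\<^sup>2) *\<^sub>R outer_square r) + residual m (fst p) (snd p)) *
     (box_weight W I' (fst p) * box_weight V I (snd p)) * indicator (cball b \<rho>) r" for p r
  have \<Psi>m: "(\<lambda>(p, r). \<Psi> p r) \<in> borel_measurable ((L I' \<Otimes>\<^sub>M L I) \<Otimes>\<^sub>M lborel)"
  proof -
    have x: "(\<lambda>z. (m, C + (kappa / (1 - c)\<^sup>2) *\<^sub>R outer_square (snd z))) \<in> (L I' \<Otimes>\<^sub>M L I) \<Otimes>\<^sub>M lborel \<rightarrow>\<^sub>M borel"
      unfolding borel_prod[symmetric] by measurable
    have "(\<lambda>z. indicator (cball b \<rho>) (snd z) :: ennreal) \<in> borel_measurable ((L I' \<Otimes>\<^sub>M L I) \<Otimes>\<^sub>M lborel)"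
      by (rule measurable_compose[OF measurable_snd borel_measurable_indicator]) simp
    with measurable_refresh_integrand[OF W V H x measurable_fst] show ?thesis
      unfolding \<Psi>_def split_beta' by (auto intro!: borel_measurable_times_ennreal)
  qed
  have \<Phi>meas: "(\<lambda>(y', t). \<Phi> y t y') \<in> borel_measurable (L I \<Otimes>\<^sub>M lborel)" if y: "y \<in> space (L I')" for y
  proof -
    have c1: "(\<lambda>z. (y(1 := snd z)) i) \<in> L I \<Otimes>\<^sub>M (lborel :: (real^'d) measure) \<rightarrow>\<^sub>M borel" for i
      by (cases "i = 1") auto
    have c2: "(\<lambda>z. fst z i) \<in> L I \<Otimes>\<^sub>M (lborel :: (real^'d) measure) \<rightarrow>\<^sub>M borel" if "i \<in> {1..mu}" for i
      using that mu_subset(1) by (intro measurable_compose[OF measurable_fst measurable_component_L]) auto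
    have [measurable]: "(\<lambda>z. H (upd (upd (m, C) (y(1 := snd z))) (fst z))) \<in> borel_measurable (L I \<Otimes>\<^sub>M lborel)"
      by (intro measurable_compose[OF _ H] measurable_upd c1 c2 measurable_const) auto
    have [measurable]: "box_weight V I \<in> borel_measurable (L I)" using V by (rule measurable_box_weight_L)
    have [measurable]: "W 1 \<in> sets borel" using W mu by auto
    show ?thesis unfolding \<Phi>_def split_beta' by measurable
  qed
  have ineq: "(\<integral>\<^sup>+r. \<Psi> (y, y') r \<partial>lborel) \<le> (\<integral>\<^sup>+t. \<Phi> y t y' \<partial>lborel)"
    if y: "y \<in> space (L I')" and y': "y' \<in> space (L I)" for y y'
  proof -
    have "(\<lambda>t. \<Phi> y t y') \<in> borel_measurable lborel"
      using measurable_compose[OF measurable_Pair1'[OF y'] \<Phi>meas[OF y]] by simp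
    \<comment> \<open>Lebesgue measure is invariant under the translation by the vertex, which is
      constant for fixed \<open>y\<close> and \<open>y'\<close>.\<close>
    then have "(\<integral>\<^sup>+t. \<Phi> y t y' \<partial>lborel) = (\<integral>\<^sup>+r. \<Phi> y (r + center m y y') y' \<partial>lborel)"
      by (subst nn_integral_lborel_translate) auto
    moreover have "(\<integral>\<^sup>+r. \<Psi> (y, y') r \<partial>lborel) \<le> (\<integral>\<^sup>+r. \<Phi> y (r + center m y y') y' \<partial>lborel)"
    proof (rule nn_integral_mono)
      fix r
      show "\<Psi> (y, y') r \<le> \<Phi> y (r + center m y y') y'"
      proof (cases "(\<forall>i\<in>I'. y i \<in> W i) \<and> (\<forall>i\<in>I. y' i \<in> V i) \<and> r \<in> cball b \<rho>")
        case True
        then have "r + center m y y' \<in> W 1" using comp m unfolding compatible_def by blast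
        moreover have "(1 - c)\<^sup>2 *\<^sub>R ((kappa / (1 - c)\<^sup>2) *\<^sub>R outer_square r) = kappa *\<^sub>R outer_square r"
          using c by simp
        ultimately show ?thesis
          using True unfolding \<Psi>_def \<Phi>_def upd_upd by (simp add: scaleR_right_distrib mult_ac del: scaleR_scaleR)
      next
        case False
        then have "box_weight W I' y = 0 \<or> box_weight V I y' = 0 \<or> indicator (cball b \<rho>) r = (0::ennreal)"
          using box_weight_eq_0[OF ins(3), of _ y W] box_weight_eq_0[of I _ y' V]
          by (metis finite_atLeastAtMost indicator_simps(2))
        then have "\<Psi> (y, y') r = 0" unfolding \<Psi>_def fst_conv snd_conv by fastforce
        then show ?thesis by simp
      qed
    qed
    ultimately show ?thesis by simp
  qed
  have bw: "box_weight W I (y(1 := t)) = indicator (W 1) t * box_weight W I' y" for y t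
  proof -
    have "box_weight W (insert 1 I') (y(1 := t)) = indicator (W 1) t * box_weight W I' y"
      unfolding box_weight_def prod.insert[OF ins(3,2)]
      by (intro arg_cong2[where f = "(*)"] prod.cong) auto
    then show ?thesis by (simp only: ins(1))
  qed
  have inner: "lower_step V H (upd (m, C) (y(1 := t))) * (indicator (W 1) t * box_weight W I' y) = (\<integral>\<^sup>+y'. \<Phi> y t y' \<partial>L I)" for y t
  proof -
    have "(\<lambda>y'. H (upd (upd (m, C) (y(1 := t))) y') * box_weight V I y') \<in> borel_measurable (L I)"
      using measurable_compose[OF measurable_upd_PiM H] measurable_box_weight_L[OF V]
      by (intro borel_measurable_times_ennreal) (auto cong: measurable_cong_sets simp: sets_PiM_lborel)
    then show ?thesis unfolding lower_step_def \<Phi>_def by (rule nn_integral_multc[symmetric])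
  qed
  have "(\<integral>\<^sup>+r. refresh W V H (m, C + (kappa / (1 - c)\<^sup>2) *\<^sub>R outer_square r) * indicator (cball b \<rho>) r \<partial>lborel)
    = (\<integral>\<^sup>+r. (\<integral>\<^sup>+p. \<Psi> p r \<partial>(L I' \<Otimes>\<^sub>M L I)) \<partial>lborel)"
    unfolding refresh_def \<Psi>_def fst_conv snd_conv
  proof (rule nn_integral_cong, rule nn_integral_multc[symmetric])
    fix r
    show "(\<lambda>p. H (avg (snd p), (1 - c)\<^sup>2 *\<^sub>R (C + (kappa / (1 - c)\<^sup>2) *\<^sub>R outer_square r) + residual m (fst p) (snd p)) *
         (box_weight W I' (fst p) * box_weight V I (snd p))) \<in> borel_measurable (L I' \<Otimes>\<^sub>M L I)"
      using measurable_refresh_integrand[where x = "\<lambda>_. (m, C + (kappa / (1 - c)\<^sup>2) *\<^sub>R outer_square r)" and p = "\<lambda>p. p",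
          OF W V H measurable_const measurable_ident[unfolded id_def]]
      by simp
  qed
  also have "\<dots> = (\<integral>\<^sup>+p. (\<integral>\<^sup>+r. \<Psi> p r \<partial>lborel) \<partial>(L I' \<Otimes>\<^sub>M L I))"
    using Q2.Fubini'[of \<Psi>] \<Psi>m by simp
  also have "\<dots> = (\<integral>\<^sup>+y. (\<integral>\<^sup>+y'. (\<integral>\<^sup>+r. \<Psi> (y, y') r \<partial>lborel) \<partial>L I) \<partial>L I')"
  proof (rule LI.nn_integral_fst[symmetric])
    show "(\<lambda>p. \<integral>\<^sup>+r. \<Psi> p r \<partial>lborel) \<in> borel_measurable (L I' \<Otimes>\<^sub>M L I)"
      using \<Psi>m by (intro lborel.borel_measurable_nn_integral) simp
  qed
  also have "\<dots> \<le> (\<integral>\<^sup>+y. (\<integral>\<^sup>+y'. (\<integral>\<^sup>+t. \<Phi> y t y' \<partial>lborel) \<partial>L I) \<partial>L I')"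
    by (intro nn_integral_mono ineq)
  also have "\<dots> = (\<integral>\<^sup>+y. (\<integral>\<^sup>+t. (\<integral>\<^sup>+y'. \<Phi> y t y' \<partial>L I) \<partial>lborel) \<partial>L I')"
    by (intro nn_integral_cong Q1.Fubini'[symmetric] \<Phi>meas)
  also have "\<dots> = (\<integral>\<^sup>+y. (\<integral>\<^sup>+t. lower_step V H (upd (m, C) (y(1 := t))) * box_weight W I (y(1 := t)) \<partial>lborel) \<partial>L I')"
    unfolding bw inner ..
  also have "\<dots> = (\<integral>\<^sup>+y. lower_step V H (upd (m, C) y) * box_weight W I y \<partial>L (insert 1 I'))"
  proof (rule P.product_nn_integral_insert[OF ins(3,2), symmetric])
    show "(\<lambda>y. lower_step V H (upd (m, C) y) * box_weight W I y) \<in> borel_measurable (L (insert 1 I'))"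
      unfolding ins(1)
      using measurable_compose[OF measurable_upd_PiM measurable_lower_step[OF V H]] measurable_box_weight_L[OF W]
      by (intro borel_measurable_times_ennreal) (auto cong: measurable_cong_sets simp: sets_PiM_lborel)
  qed
  also have "\<dots> = lower_step W (lower_step V H) (m, C)"
    unfolding ins(1) lower_step_def[of W] ..
  finally show ?thesis .
qed

end

section \<open>Iterating double steps\<close>

context cma_es begin

fun refreshes :: "('d \<Rightarrow> nat \<Rightarrow> (real^'d) set) \<Rightarrow> (nat \<Rightarrow> (real^'d) set) \<Rightarrow> 'd list \<Rightarrow>
    ('d state \<Rightarrow> ennreal) \<Rightarrow> 'd state \<Rightarrow> ennreal" where
  "refreshes W V [] H = H"
| "refreshes W V (j # js) H = refresh (W j) V (refreshes W V js H)"

fun schedule :: "('d \<Rightarrow> nat \<Rightarrow> (real^'d) set) \<Rightarrow> (nat \<Rightarrow> (real^'d) set) \<Rightarrow> 'd list \<Rightarrow>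
    (nat \<Rightarrow> (real^'d) set) list" where
  "schedule W V [] = []"
| "schedule W V (j # js) = W j # V # schedule W V js"

text \<open>All rank-one terms are accounted for in the initial covariance: the vector at position p
  of the list, counted from 0, gets the weight \<open>kappa / (1 - c)\<^sup>2\<close> divided by p
  further factors \<open>(1 - c)\<^sup>2\<close>, since each double step up to its own discounts the
  covariance.\<close>

fun coef :: "'d list \<Rightarrow> 'd \<Rightarrow> real" where
  "coef [] i = 0"
| "coef (j # js) i = (if i = j then kappa / (1 - c)\<^sup>2 else coef js i / (1 - c)\<^sup>2)"

lemma kappa_pos: "kappa > 0"
  using w1 c by (simp add: kappa_def)

lemma coef_pos: "i \<in> set js \<Longrightarrow> coef js i > 0"
  using kappa_pos c by (induction js) auto

lemma set_schedule: "U \<in> set (schedule W V js) \<Longrightarrow> U = V \<or> (\<exists>j. U = W j)"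
  by (induction js) auto

lemma measurable_refreshes:
  assumes "\<And>j i. i \<in> I \<Longrightarrow> W j i \<in> sets borel" "\<And>i. i \<in> I \<Longrightarrow> V i \<in> sets borel" "H \<in> borel_measurable borel"
  shows "refreshes W V js H \<in> borel_measurable borel"
  using assms by (induction js) (auto intro!: measurable_refresh)

lemma norm_avg_le: "(\<And>i. i \<in> I \<Longrightarrow> norm (y i) \<le> \<sigma>) \<Longrightarrow> norm (avg y) \<le> \<sigma>"
  unfolding avg_def using mu_subset(1) by (intro sum_w_norm_le) auto

text \<open>Moves the integration over the later vectors through one double step: the discount turns
  \<open>\<omega> i / (1 - c)\<^sup>2\<close> back into \<open>\<omega> i\<close>, and the
  assumption applies at the new mean, an average of points of
  \<open>cball 0 \<sigma>\<close>.\<close>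

lemma refresh_le:
  fixes b :: "'d \<Rightarrow> real^'d"
  assumes J: "finite J"
    and W: "\<And>i. i \<in> I \<Longrightarrow> W i \<in> sets borel" and V: "\<And>i. i \<in> I \<Longrightarrow> V i \<in> sets borel"
    and V\<sigma>: "\<And>i. i \<in> I \<Longrightarrow> V i \<subseteq> cball 0 \<sigma>"
    and G: "G \<in> borel_measurable borel"
    and le: "\<And>m C. norm m \<le> \<sigma> \<Longrightarrow>
      (\<integral>\<^sup>+r. G (m, C + (\<Sum>i\<in>J. \<omega> i *\<^sub>R outer_square (r i))) * box_weight (\<lambda>i. cball (b i) \<rho>) J r
        \<partial>PiM J (\<lambda>_. lborel)) \<le> H (m, C)"
  shows "(\<integral>\<^sup>+r. refresh W V G (m, C + (\<Sum>i\<in>J. (\<omega> i / (1 - c)\<^sup>2) *\<^sub>R outer_square (r i))) * box_weight (\<lambda>i. cball (b i) \<rho>) J r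
        \<partial>PiM J (\<lambda>_. lborel)) \<le> refresh W V H (m, C)"
proof -
  let ?LJ = "PiM J (\<lambda>_. lborel :: (real^'d) measure)"
  interpret P: product_sigma_finite "\<lambda>_::'d. lborel :: (real^'d) measure" ..
  interpret LJ: sigma_finite_measure ?LJ by (rule P.sigma_finite[OF J])
  interpret LL: sigma_finite_measure "L I' \<Otimes>\<^sub>M L I" by (rule sigma_finite_LL)
  interpret Q: pair_sigma_finite "L I' \<Otimes>\<^sub>M L I" ?LJ ..
  have c0: "1 - c \<noteq> 0" using c by simp
  define S where "S r = (\<Sum>i\<in>J. (\<omega> i / (1 - c)\<^sup>2) *\<^sub>R outer_square (r i))" for r :: "'d \<Rightarrow> real^'d"
  have comp: "(\<lambda>r. r i) \<in> ?LJ \<rightarrow>\<^sub>M borel" if "i \<in> J" for i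
    using measurable_component_singleton[OF that, of "\<lambda>_. lborel"] by simp
  have Sm: "S \<in> ?LJ \<rightarrow>\<^sub>M borel"
    unfolding S_def by (intro borel_measurable_sum borel_measurable_scaleR measurable_outer_square comp) auto
  have bwm: "box_weight (\<lambda>i. cball (b i) \<rho>) J \<in> borel_measurable ?LJ"
  proof -
    have "sets ?LJ = sets (PiM J (\<lambda>_. borel))" by (intro sets_PiM_cong) auto
    then show ?thesis
      using measurable_box_weight[of J "\<lambda>i. cball (b i) \<rho>"] by (simp cong: measurable_cong_sets)
  qed
  define F where "F p r = G (avg (snd p), (1 - c)\<^sup>2 *\<^sub>R (C + S r) + residual m (fst p) (snd p)) *
      (box_weight W I' (fst p) * box_weight V I (snd p)) * box_weight (\<lambda>i. cball (b i) \<rho>) J r" for p r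
  have x: "(\<lambda>z. (m, C + S (snd z))) \<in> (L I' \<Otimes>\<^sub>M L I) \<Otimes>\<^sub>M ?LJ \<rightarrow>\<^sub>M borel"
    using measurable_compose[OF measurable_snd Sm] unfolding borel_prod[symmetric] by measurable
  have Fm: "(\<lambda>(p, r). F p r) \<in> borel_measurable ((L I' \<Otimes>\<^sub>M L I) \<Otimes>\<^sub>M ?LJ)"
    using measurable_refresh_integrand[where W = W and V = V and H = G, OF W V G x measurable_fst]
      measurable_compose[OF measurable_snd bwm]
    unfolding F_def split_beta' by (auto intro!: borel_measurable_times_ennreal)
  have "(\<integral>\<^sup>+r. refresh W V G (m, C + S r) * box_weight (\<lambda>i. cball (b i) \<rho>) J r \<partial>?LJ) =
      (\<integral>\<^sup>+r. (\<integral>\<^sup>+p. F p r \<partial>(L I' \<Otimes>\<^sub>M L I)) \<partial>?LJ)"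
    unfolding refresh_def F_def fst_conv snd_conv
  proof (rule nn_integral_cong, rule nn_integral_multc[symmetric])
    fix r
    show "(\<lambda>p. G (avg (snd p), (1 - c)\<^sup>2 *\<^sub>R (C + S r) + residual m (fst p) (snd p)) *
         (box_weight W I' (fst p) * box_weight V I (snd p))) \<in> borel_measurable (L I' \<Otimes>\<^sub>M L I)"
      using measurable_refresh_integrand[where x = "\<lambda>_. (m, C + S r)" and p = "\<lambda>p. p",
          OF W V G measurable_const measurable_ident[unfolded id_def]]
      by simp
  qed
  also have "\<dots> = (\<integral>\<^sup>+p. (\<integral>\<^sup>+r. F p r \<partial>?LJ) \<partial>(L I' \<Otimes>\<^sub>M L I))"
    by (rule Q.Fubini'[OF Fm])
  also have "\<dots> \<le> refresh W V H (m, C)"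
    unfolding refresh_def fst_conv snd_conv
  proof (rule nn_integral_mono)
    fix p
    let ?C = "(1 - c)\<^sup>2 *\<^sub>R C + residual m (fst p) (snd p)"
    have arg: "(1 - c)\<^sup>2 *\<^sub>R (C + S r) + residual m (fst p) (snd p) = ?C + (\<Sum>i\<in>J. \<omega> i *\<^sub>R outer_square (r i))" for r
      using c0 by (simp add: S_def scaleR_right_distrib scaleR_sum_right)
    show "(\<integral>\<^sup>+r. F p r \<partial>?LJ) \<le> H (avg (snd p), ?C) * (box_weight W I' (fst p) * box_weight V I (snd p))"
    proof (cases "\<forall>i\<in>I. snd p i \<in> V i")
      case True
      then have av: "norm (avg (snd p)) \<le> \<sigma>" using V\<sigma> by (intro norm_avg_le) fastforce
      have "(\<lambda>r. ?C + (\<Sum>i\<in>J. \<omega> i *\<^sub>R outer_square (r i))) \<in> ?LJ \<rightarrow>\<^sub>M borel"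
        by (intro borel_measurable_add borel_measurable_sum borel_measurable_scaleR measurable_outer_square comp) auto
      then have "(\<lambda>r. (avg (snd p), ?C + (\<Sum>i\<in>J. \<omega> i *\<^sub>R outer_square (r i)))) \<in> ?LJ \<rightarrow>\<^sub>M borel"
        unfolding borel_prod[symmetric] by (intro measurable_Pair) auto
      from borel_measurable_times_ennreal[OF measurable_compose[OF this G] bwm]
      have "(\<integral>\<^sup>+r. F p r \<partial>?LJ) = (\<integral>\<^sup>+r. G (avg (snd p), ?C + (\<Sum>i\<in>J. \<omega> i *\<^sub>R outer_square (r i))) *
          box_weight (\<lambda>i. cball (b i) \<rho>) J r \<partial>?LJ) * (box_weight W I' (fst p) * box_weight V I (snd p))"
        unfolding F_def arg by (subst nn_integral_multc[symmetric]) (auto intro!: nn_integral_cong simp: mult_ac)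
      also have "\<dots> \<le> H (avg (snd p), ?C) * (box_weight W I' (fst p) * box_weight V I (snd p))"
        by (intro mult_right_mono le[OF av]) auto
      finally show ?thesis .
    next
      case False
      then have "box_weight V I (snd p) = 0"
        using box_weight_eq_0[of I _ "snd p" V] by blast
      then show ?thesis unfolding F_def by simp
    qed
  qed
  finally show ?thesis unfolding S_def .
qed

text \<open>The vector of the first double step is integrated last: for fixed \<open>t\<close> the
  remaining ones are handled by \<open>refresh_le\<close> with the induction hypothesis, and then
  \<open>double_step_lower\<close> integrates over \<open>t\<close>.\<close>

lemma refreshes_le:
  assumes W: "\<And>j i. i \<in> I \<Longrightarrow> W j i \<in> sets borel" and V: "\<And>i. i \<in> I \<Longrightarrow> V i \<in> sets borel"
    and V\<sigma>: "\<And>i. i \<in> I \<Longrightarrow> V i \<subseteq> cball 0 \<sigma>"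
    and H: "H \<in> borel_measurable borel" and comp: "\<And>j. compatible (W j) V \<sigma> (b j) \<rho>"
    and m: "norm m \<le> \<sigma>" and js: "distinct js"
  shows "(\<integral>\<^sup>+r. refreshes W V js H (m, C + (\<Sum>i\<in>set js. coef js i *\<^sub>R outer_square (r i))) *
      box_weight (\<lambda>i. cball (b i) \<rho>) (set js) r \<partial>PiM (set js) (\<lambda>_. lborel)) \<le>
    lower_steps (schedule W V js) H (m, C)"
  using m js
proof (induction js arbitrary: m C)
  case Nil
  show ?case by (simp add: PiM_empty nn_integral_count_space_finite box_weight_def)
next
  case (Cons j js)
  let ?J = "set js"
  let ?k = "kappa / (1 - c)\<^sup>2"
  interpret P: product_sigma_finite "\<lambda>_::'d. lborel :: (real^'d) measure" ..
  have j: "j \<notin> ?J" "distinct js" using Cons.prems by auto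
  define H' where "H' = lower_steps (schedule W V js) H"
  define G where "G = refreshes W V js H"
  have H': "H' \<in> borel_measurable borel"
    unfolding H'_def using W V H set_schedule by (intro measurable_lower_steps) blast+
  have G: "G \<in> borel_measurable borel" unfolding G_def using W V H by (intro measurable_refreshes)
  define Q where "Q r = refresh (W j) V G (m, C + (\<Sum>i\<in>insert j ?J. coef (j # js) i *\<^sub>R outer_square (r i))) *
      box_weight (\<lambda>i. cball (b i) \<rho>) (insert j ?J) r" for r
  have Qm: "Q \<in> borel_measurable (PiM (insert j ?J) (\<lambda>_. lborel))"
  proof -
    let ?M = "PiM (insert j ?J) (\<lambda>_. lborel :: (real^'d) measure)"
    have ci: "(\<lambda>r. r i) \<in> ?M \<rightarrow>\<^sub>M borel" if "i \<in> insert j ?J" for i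
      using measurable_component_singleton[OF that, of "\<lambda>_. lborel"] by simp
    have "(\<lambda>r. C + (\<Sum>i\<in>insert j ?J. coef (j # js) i *\<^sub>R outer_square (r i))) \<in> ?M \<rightarrow>\<^sub>M borel"
      by (intro borel_measurable_add borel_measurable_sum borel_measurable_scaleR measurable_outer_square ci) auto
    then have "(\<lambda>r. (m, C + (\<Sum>i\<in>insert j ?J. coef (j # js) i *\<^sub>R outer_square (r i)))) \<in> ?M \<rightarrow>\<^sub>M borel"
      unfolding borel_prod[symmetric] by (intro measurable_Pair) auto
    moreover have "refresh (W j) V G \<in> borel_measurable borel" using W V G by (intro measurable_refresh)
    moreover have "box_weight (\<lambda>i. cball (b i) \<rho>) (insert j ?J) \<in> borel_measurable ?M"
    proof -
      have "sets ?M = sets (PiM (insert j ?J) (\<lambda>_. borel))" by (intro sets_PiM_cong) auto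
      then show ?thesis
        using measurable_box_weight[of "insert j ?J" "\<lambda>i. cball (b i) \<rho>"] by (simp cong: measurable_cong_sets)
    qed
    ultimately show ?thesis unfolding Q_def by (intro borel_measurable_times_ennreal) (auto intro: measurable_compose)
  qed
  have Qupd: "Q (r(j := t)) = refresh (W j) V G (m, (C + ?k *\<^sub>R outer_square t) + (\<Sum>i\<in>?J. (coef js i / (1 - c)\<^sup>2) *\<^sub>R outer_square (r i))) *
      box_weight (\<lambda>i. cball (b i) \<rho>) ?J r * indicator (cball (b j) \<rho>) t" for r t
  proof -
    have "(\<Sum>i\<in>insert j ?J. coef (j # js) i *\<^sub>R outer_square ((r(j := t)) i)) =
        ?k *\<^sub>R outer_square t + (\<Sum>i\<in>?J. (coef js i / (1 - c)\<^sup>2) *\<^sub>R outer_square (r i))"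
      using j by (subst sum.insert) (auto intro!: sum.cong)
    moreover have "box_weight (\<lambda>i. cball (b i) \<rho>) (insert j ?J) (r(j := t)) =
        indicator (cball (b j) \<rho>) t * box_weight (\<lambda>i. cball (b i) \<rho>) ?J r"
      unfolding box_weight_def using j
      by (subst prod.insert) (auto intro!: arg_cong2[where f = "(*)"] prod.cong)
    ultimately show ?thesis unfolding Q_def by (simp add: add.assoc mult_ac)
  qed
  have "(\<integral>\<^sup>+r. Q r \<partial>PiM (insert j ?J) (\<lambda>_. lborel)) =
      (\<integral>\<^sup>+t. (\<integral>\<^sup>+r. Q (r(j := t)) \<partial>PiM ?J (\<lambda>_. lborel)) \<partial>lborel)"
    using j Qm by (intro P.product_nn_integral_insert_rev) auto
  also have "\<dots> \<le> (\<integral>\<^sup>+t. refresh (W j) V H' (m, C + ?k *\<^sub>R outer_square t) * indicator (cball (b j) \<rho>) t \<partial>lborel)"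
  proof (rule nn_integral_mono)
    fix t :: "real^'d"
    show "(\<integral>\<^sup>+r. Q (r(j := t)) \<partial>PiM ?J (\<lambda>_. lborel)) \<le>
        refresh (W j) V H' (m, C + ?k *\<^sub>R outer_square t) * indicator (cball (b j) \<rho>) t"
    proof (cases "t \<in> cball (b j) \<rho>")
      case True
      have "(\<integral>\<^sup>+r. Q (r(j := t)) \<partial>PiM ?J (\<lambda>_. lborel)) \<le> refresh (W j) V H' (m, C + ?k *\<^sub>R outer_square t)"
        unfolding Qupd indicator_simps(1)[OF True] mult_1_right
        by (rule refresh_le[where \<sigma> = \<sigma>, OF _ W V V\<sigma> G])
          (use Cons.IH j in \<open>auto simp: G_def H'_def\<close>)
      then show ?thesis using True by simp
    qed (simp add: Qupd)
  qed
  also have "\<dots> \<le> lower_step (W j) (lower_step V H') (m, C)"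
    using Cons.prems(1) by (intro double_step_lower[where \<sigma> = \<sigma>] W V H' comp) auto
  finally show ?case by (simp add: Q_def G_def H'_def)
qed

text \<open>The rows of a matrix in a Frobenius ball lie in the balls around the rows of its centre,
  so the integral over matrices is at most the one over independent rows.\<close>

lemma refreshes_gram_le:
  assumes W: "\<And>j i. i \<in> I \<Longrightarrow> W j i \<in> sets borel" and V: "\<And>i. i \<in> I \<Longrightarrow> V i \<in> sets borel"
    and V\<sigma>: "\<And>i. i \<in> I \<Longrightarrow> V i \<subseteq> cball 0 \<sigma>"
    and H: "H \<in> borel_measurable borel" and comp: "\<And>j. compatible (W j) V \<sigma> (b j) \<rho>"
    and m: "norm m \<le> \<sigma>" and js: "distinct js" "set js = UNIV"
  shows "(\<integral>\<^sup>+R. refreshes W V js H (m, C + weighted_gram (coef js) R) * indicator (cball (\<chi> j. b j) \<rho>) R \<partial>lborel) \<le>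
    lower_steps (schedule W V js) H (m, C)"
proof -
  define F where "F R = refreshes W V js H (m, C + weighted_gram (coef js) R) * (\<Prod>i\<in>UNIV. indicator (cball (b i) \<rho>) (R $ i))" for R
  have [measurable]: "refreshes W V js H \<in> borel_measurable borel" using W V H by (intro measurable_refreshes)
  have x: "(\<lambda>R. (m, C + weighted_gram (coef js) R)) \<in> borel \<rightarrow>\<^sub>M borel"
    unfolding borel_prod[symmetric] by measurable
  have "(\<lambda>R. indicator (cball (b i) \<rho>) (R $ i) :: ennreal) \<in> borel_measurable borel" for i
  proof -
    have "(\<lambda>R :: real^'d^'d. R $ i) \<in> borel \<rightarrow>\<^sub>M borel"
      by (intro borel_measurable_continuous_onI continuous_intros)
    from measurable_compose[OF this borel_measurable_indicator[of "cball (b i) \<rho>"]] show ?thesis by simp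
  qed
  then have F: "F \<in> borel_measurable borel"
    unfolding F_def using measurable_compose[OF x] by (intro borel_measurable_times_ennreal borel_measurable_prod_ennreal) auto
  have "(\<integral>\<^sup>+R. refreshes W V js H (m, C + weighted_gram (coef js) R) * indicator (cball (\<chi> j. b j) \<rho>) R \<partial>lborel)
    \<le> (\<integral>\<^sup>+R. F R \<partial>lborel)"
  proof (rule nn_integral_mono)
    fix R :: "real^'d^'d"
    show "refreshes W V js H (m, C + weighted_gram (coef js) R) * indicator (cball (\<chi> j. b j) \<rho>) R \<le> F R"
    proof (cases "R \<in> cball (\<chi> j. b j) \<rho>")
      case True
      have "R $ i \<in> cball (b i) \<rho>" for i
        using dist_vec_nth_le[of "\<chi> j. b j" i R] True by simp
      then have "(\<Prod>i\<in>UNIV. indicator (cball (b i) \<rho>) (R $ i)) = (1::ennreal)" by (intro prod.neutral) simp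
      then show ?thesis unfolding F_def indicator_simps(1)[OF True] by simp
    qed simp
  qed
  also have "\<dots> = (\<integral>\<^sup>+r. F (\<chi> i. r i) \<partial>PiM UNIV (\<lambda>_. lborel))" by (rule nn_integral_lborel_vec[OF F])
  also have "\<dots> \<le> lower_steps (schedule W V js) H (m, C)"
    using refreshes_le[where W = W and V = V and \<sigma> = \<sigma> and b = b and \<rho> = \<rho>, OF W V V\<sigma> H comp m js(1), of C]
    unfolding js(2) F_def weighted_gram_def box_weight_def by simp
  finally show ?thesis .
qed

end

section \<open>The minorizing measure\<close>

lemma PiM_box_weight_nonzero:
  fixes W :: "'i \<Rightarrow> 'a::euclidean_space set"
  assumes "finite J" "\<And>i. i \<in> J \<Longrightarrow> W i \<in> sets borel" "\<And>i. i \<in> J \<Longrightarrow> emeasure lborel (W i) \<noteq> 0"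
  shows "(\<integral>\<^sup>+y. box_weight W J y \<partial>PiM J (\<lambda>_. lborel)) \<noteq> 0"
proof -
  interpret product_sigma_finite "\<lambda>_::'i. lborel :: 'a measure" ..
  have "(\<integral>\<^sup>+y. box_weight W J y \<partial>PiM J (\<lambda>_. lborel)) = (\<Prod>i\<in>J. \<integral>\<^sup>+t. indicator (W i) t \<partial>lborel)"
    unfolding box_weight_def using assms by (intro product_nn_integral_prod) auto
  also have "\<dots> = (\<Prod>i\<in>J. emeasure lborel (W i))"
    using assms by (intro prod.cong) auto
  finally show ?thesis using assms by simp
qed

lemma emeasure_ball_nonzero:
  fixes a :: "'a::euclidean_space"
  assumes "r > 0"
  shows "emeasure lborel (ball a r) \<noteq> 0" "emeasure lborel (cball a r) \<noteq> 0"
proof -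
  have u: "unit_ball_vol (real DIM('a)) \<noteq> 0" using unit_ball_vol_pos[of "real DIM('a)"] by (metis of_nat_0_le_iff less_irrefl)
  show "emeasure lborel (ball a r) \<noteq> 0" "emeasure lborel (cball a r) \<noteq> 0"
    using assms u by (auto simp: emeasure_ball emeasure_cball ennreal_eq_0_iff mult_le_0_iff not_le intro!: unit_ball_vol_pos)
qed

context cma_es begin

text \<open>The first ingredient of the nontriviality of \<nu>: constants are multiplied by the
  volume of a product of sets of positive measure.\<close>

lemma refresh_const_nonzero:
  assumes W: "\<And>i. i \<in> I \<Longrightarrow> W i \<in> sets borel" "\<And>i. i \<in> I \<Longrightarrow> emeasure lborel (W i) \<noteq> 0"
    and V: "\<And>i. i \<in> I \<Longrightarrow> V i \<in> sets borel" "\<And>i. i \<in> I \<Longrightarrow> emeasure lborel (V i) \<noteq> 0"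
    and k: "k \<noteq> 0"
  shows "\<exists>k'. k' \<noteq> 0 \<and> refresh W V (\<lambda>_. k) = (\<lambda>_. k')"
proof -
  interpret LI: sigma_finite_measure "L I" by (rule sigma_finite_L) simp
  have bW: "box_weight W I' \<in> borel_measurable (L I')" by (rule measurable_box_weight_L[OF W(1)]) simp
  have bV: "box_weight V I \<in> borel_measurable (L I)" by (rule measurable_box_weight_L[OF V(1)])
  have m: "(\<lambda>p. box_weight W I' (fst p) * box_weight V I (snd p)) \<in> borel_measurable (L I' \<Otimes>\<^sub>M L I)"
    using W V by (intro borel_measurable_times_ennreal measurable_compose[OF measurable_fst measurable_box_weight_L]
        measurable_compose[OF measurable_snd measurable_box_weight_L]) auto
  have "(\<integral>\<^sup>+p. box_weight W I' (fst p) * box_weight V I (snd p) \<partial>(L I' \<Otimes>\<^sub>M L I)) =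
      (\<integral>\<^sup>+y. (\<integral>\<^sup>+y'. box_weight W I' y * box_weight V I y' \<partial>L I) \<partial>L I')"
    using LI.nn_integral_fst[OF m] by simp
  also have "\<dots> = (\<integral>\<^sup>+y. box_weight W I' y \<partial>L I') * (\<integral>\<^sup>+y'. box_weight V I y' \<partial>L I)"
    by (simp only: nn_integral_cmult[OF bV] nn_integral_multc[OF bW])
  also have "\<dots> \<noteq> 0"
    using PiM_box_weight_nonzero[of I' W] PiM_box_weight_nonzero[of I V] W V by auto
  finally have "(\<integral>\<^sup>+p. box_weight W I' (fst p) * box_weight V I (snd p) \<partial>(L I' \<Otimes>\<^sub>M L I)) \<noteq> 0" .
  moreover have "refresh W V (\<lambda>_. k) = (\<lambda>_. k * (\<integral>\<^sup>+p. box_weight W I' (fst p) * box_weight V I (snd p) \<partial>(L I' \<Otimes>\<^sub>M L I)))"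
    unfolding refresh_def by (rule ext, rule nn_integral_cmult[OF m])
  ultimately show ?thesis
    using k by (intro exI[of _ "k * (\<integral>\<^sup>+p. box_weight W I' (fst p) * box_weight V I (snd p) \<partial>(L I' \<Otimes>\<^sub>M L I))"] conjI)
      (simp_all only: mult_eq_0_iff de_Morgan_disj not_False_eq_True simp_thms)
qed

lemma refreshes_const_nonzero:
  assumes W: "\<And>j i. i \<in> I \<Longrightarrow> W j i \<in> sets borel" "\<And>j i. i \<in> I \<Longrightarrow> emeasure lborel (W j i) \<noteq> 0"
    and V: "\<And>i. i \<in> I \<Longrightarrow> V i \<in> sets borel" "\<And>i. i \<in> I \<Longrightarrow> emeasure lborel (V i) \<noteq> 0"
  shows "\<exists>k. k \<noteq> 0 \<and> refreshes W V js (\<lambda>_. 1) = (\<lambda>_. k)"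
proof (induction js)
  case Nil
  show ?case by (intro exI[of _ 1]) auto
next
  case (Cons j js)
  then obtain k where "k \<noteq> 0" "refreshes W V js (\<lambda>_. 1) = (\<lambda>_. k)" by blast
  then show ?case using refresh_const_nonzero[where k = k and W = "W j" and V = V, OF W V] by simp
qed

text \<open>Monotone convergence; it makes \<nu> countably additive.\<close>

lemma refresh_suminf:
  assumes "\<And>i. i \<in> I \<Longrightarrow> W i \<in> sets borel" "\<And>i. i \<in> I \<Longrightarrow> V i \<in> sets borel"
    and "\<And>n. H n \<in> borel_measurable borel"
  shows "refresh W V (\<lambda>x. \<Sum>n. H n x) = (\<lambda>x. \<Sum>n::nat. refresh W V (H n) x)"
proof
  fix x
  show "refresh W V (\<lambda>x. \<Sum>n. H n x) x = (\<Sum>n. refresh W V (H n) x)"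
    unfolding refresh_def ennreal_suminf_multc[symmetric]
    using measurable_refresh_integrand[where x = "\<lambda>_. x" and p = "\<lambda>p. p",
        OF assms measurable_const measurable_ident[unfolded id_def]]
    by (intro nn_integral_suminf) auto
qed

lemma refreshes_suminf:
  assumes "\<And>j i. i \<in> I \<Longrightarrow> W j i \<in> sets borel" "\<And>i. i \<in> I \<Longrightarrow> V i \<in> sets borel"
    and "\<And>n. H n \<in> borel_measurable borel"
  shows "refreshes W V js (\<lambda>x. \<Sum>n. H n x) = (\<lambda>x. \<Sum>n::nat. refreshes W V js (H n) x)"
proof (induction js)
  case (Cons j js)
  then show ?case
    using refresh_suminf[of "W j" V "\<lambda>n. refreshes W V js (H n)"] measurable_refreshes[OF assms(1,2,3)] assms(1,2)
    by simp
qed simp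

text \<open>The integral of \<open>H\<close> against the minorizing measure before normalization. No
  initial state occurs: the first iteration contributes only the mean \<open>avg y\<close>, and the
  covariance starts from the Gram matrix alone.\<close>

definition minorant :: "('d \<Rightarrow> nat \<Rightarrow> (real^'d) set) \<Rightarrow> (nat \<Rightarrow> (real^'d) set) \<Rightarrow> 'd list \<Rightarrow> real^'d^'d \<Rightarrow> real \<Rightarrow>
    ('d state \<Rightarrow> ennreal) \<Rightarrow> ennreal" where
  "minorant W V js B r H = (\<integral>\<^sup>+y. (\<integral>\<^sup>+R. refreshes W V js H (avg y, weighted_gram (coef js) R) * indicator (cball B r) R \<partial>lborel) *
     box_weight V I y \<partial>L I)"

lemma measurable_minorant_integrand:
  assumes W: "\<And>j i. i \<in> I \<Longrightarrow> W j i \<in> sets borel" and V: "\<And>i. i \<in> I \<Longrightarrow> V i \<in> sets borel"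
    and H: "H \<in> borel_measurable borel"
  shows "(\<lambda>R. refreshes W V js H (avg y, weighted_gram (coef js) R) * indicator (cball B r) R) \<in> borel_measurable lborel"
    and "(\<lambda>y. (\<integral>\<^sup>+R. refreshes W V js H (avg y, weighted_gram (coef js) R) * indicator (cball B r) R \<partial>lborel) *
     box_weight V I y) \<in> borel_measurable (L I)"
proof -
  have [measurable]: "refreshes W V js H \<in> borel_measurable borel" by (rule measurable_refreshes[OF W V H])
  have avg: "avg \<in> L I \<rightarrow>\<^sub>M borel"
    using mu_subset(1) by (intro measurable_avg measurable_component_L) auto
  have "(\<lambda>p. (avg (fst p), weighted_gram (coef js) (snd p))) \<in> L I \<Otimes>\<^sub>M lborel \<rightarrow>\<^sub>M borel"
    unfolding borel_prod[symmetric] using measurable_compose[OF measurable_fst avg] by measurable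
  moreover have "(\<lambda>p. indicator (cball B r) (snd p) :: ennreal) \<in> borel_measurable (L I \<Otimes>\<^sub>M lborel)"
    by (rule measurable_compose[OF measurable_snd borel_measurable_indicator]) simp
  ultimately have "(\<lambda>(y, R). refreshes W V js H (avg y, weighted_gram (coef js) R) * indicator (cball B r) R) \<in>
      borel_measurable (L I \<Otimes>\<^sub>M lborel)"
    unfolding split_beta' by (intro borel_measurable_times_ennreal) (auto intro: measurable_compose)
  then have [measurable]: "(\<lambda>y. \<integral>\<^sup>+R. refreshes W V js H (avg y, weighted_gram (coef js) R) * indicator (cball B r) R \<partial>lborel) \<in>
      borel_measurable (L I)" by (intro lborel.borel_measurable_nn_integral)
  have [measurable]: "box_weight V I \<in> borel_measurable (L I)" using V by (rule measurable_box_weight_L)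
  show "(\<lambda>y. (\<integral>\<^sup>+R. refreshes W V js H (avg y, weighted_gram (coef js) R) * indicator (cball B r) R \<partial>lborel) *
     box_weight V I y) \<in> borel_measurable (L I)" by measurable
  have "(\<lambda>R. (avg y, weighted_gram (coef js) R)) \<in> borel \<rightarrow>\<^sub>M borel"
    unfolding borel_prod[symmetric] by measurable
  moreover have "(indicator (cball B r) :: _ \<Rightarrow> ennreal) \<in> borel_measurable borel"
    by (rule borel_measurable_indicator) simp
  ultimately show "(\<lambda>R. refreshes W V js H (avg y, weighted_gram (coef js) R) * indicator (cball B r) R) \<in> borel_measurable lborel"
    by (intro borel_measurable_times_ennreal) (auto intro: measurable_compose)
qed

lemma minorant_suminf:
  assumes W: "\<And>j i. i \<in> I \<Longrightarrow> W j i \<in> sets borel" and V: "\<And>i. i \<in> I \<Longrightarrow> V i \<in> sets borel"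
    and H: "\<And>n. H n \<in> borel_measurable borel"
  shows "minorant W V js B r (\<lambda>x. \<Sum>n. H n x) = (\<Sum>n::nat. minorant W V js B r (H n))"
proof -
  note m = measurable_minorant_integrand[where W = W and V = V, OF W V H]
  have inner: "(\<integral>\<^sup>+R. refreshes W V js (\<lambda>x. \<Sum>n. H n x) (avg y, weighted_gram (coef js) R) * indicator (cball B r) R \<partial>lborel) =
      (\<Sum>n. \<integral>\<^sup>+R. refreshes W V js (H n) (avg y, weighted_gram (coef js) R) * indicator (cball B r) R \<partial>lborel)" for y
  proof -
    have "refreshes W V js (\<lambda>x. \<Sum>n. H n x) z = (\<Sum>n. refreshes W V js (H n) z)" for z
      using refreshes_suminf[where W = W and V = V and H = H, OF W V H] by (rule fun_cong)
    then have "(\<integral>\<^sup>+R. refreshes W V js (\<lambda>x. \<Sum>n. H n x) (avg y, weighted_gram (coef js) R) * indicator (cball B r) R \<partial>lborel) =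
      (\<integral>\<^sup>+R. (\<Sum>n. refreshes W V js (H n) (avg y, weighted_gram (coef js) R) * indicator (cball B r) R) \<partial>lborel)"
      by (intro nn_integral_cong) (simp only: ennreal_suminf_multc)
    also note nn_integral_suminf[OF m(1)]
    finally show ?thesis .
  qed
  have "minorant W V js B r (\<lambda>x. \<Sum>n. H n x) = (\<integral>\<^sup>+y. (\<Sum>n. (\<integral>\<^sup>+R. refreshes W V js (H n) (avg y, weighted_gram (coef js) R) * indicator (cball B r) R \<partial>lborel) *
     box_weight V I y) \<partial>L I)"
    unfolding minorant_def by (intro nn_integral_cong) (simp only: inner ennreal_suminf_multc)
  also have "\<dots> = (\<Sum>n. minorant W V js B r (H n))"
    unfolding minorant_def by (rule nn_integral_suminf[OF m(2)])
  finally show ?thesis .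
qed

lemma minorant_1_nonzero:
  assumes W: "\<And>j i. i \<in> I \<Longrightarrow> W j i \<in> sets borel" "\<And>j i. i \<in> I \<Longrightarrow> emeasure lborel (W j i) \<noteq> 0"
    and V: "\<And>i. i \<in> I \<Longrightarrow> V i \<in> sets borel" "\<And>i. i \<in> I \<Longrightarrow> emeasure lborel (V i) \<noteq> 0"
    and r: "r > 0"
  shows "minorant W V js B r (\<lambda>_. 1) \<noteq> 0"
proof -
  obtain k where k: "k \<noteq> 0" "refreshes W V js (\<lambda>_. 1) = (\<lambda>_. k)"
    using refreshes_const_nonzero[where W = W and V = V and js = js, OF W V] by blast
  have bw: "box_weight V I \<in> borel_measurable (L I)" using V(1) by (rule measurable_box_weight_L)
  have "minorant W V js B r (\<lambda>_. 1) = (\<integral>\<^sup>+y. (k * emeasure lborel (cball B r)) * box_weight V I y \<partial>L I)"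
  proof -
    have "(\<integral>\<^sup>+R. k * indicator (cball B r) R \<partial>lborel) = k * emeasure lborel (cball B r)"
      by (rule nn_integral_cmult_indicator) simp
    then show ?thesis unfolding minorant_def k by simp
  qed
  also have "\<dots> = (k * emeasure lborel (cball B r)) * (\<integral>\<^sup>+y. box_weight V I y \<partial>L I)"
    by (rule nn_integral_cmult[OF bw])
  finally have "minorant W V js B r (\<lambda>_. 1) = (k * emeasure lborel (cball B r)) * (\<integral>\<^sup>+y. box_weight V I y \<partial>L I)" .
  moreover have "emeasure lborel (cball B r) \<noteq> 0" using r by (rule emeasure_ball_nonzero)
  ultimately show ?thesis
    using k PiM_box_weight_nonzero[of I V] V by simp
qed

text \<open>The covariance \<open>E\<close> after the first iteration is small and positive
  semidefinite, hence a sum of outer squares of vectors of norm at most \<open>e\<close>. These may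
  depend on \<open>x\<close> and \<open>y\<close>; the domination is uniform in them and puts
  \<open>E\<close> back next to the Gram matrix.\<close>

lemma minorant_le:
  assumes W: "\<And>j i. i \<in> I \<Longrightarrow> W j i \<in> sets borel" and V: "\<And>i. i \<in> I \<Longrightarrow> V i \<in> sets borel"
    and V\<sigma>: "\<And>i. i \<in> I \<Longrightarrow> V i \<subseteq> cball 0 \<sigma>"
    and H: "H \<in> borel_measurable borel" and comp: "\<And>j. compatible (W j) V \<sigma> (b j) \<rho>"
    and js: "distinct js" "set js = UNIV"
    and dom: "gram_dominated (coef js) (\<chi> j. b j) (UNIV :: 'd set) r e r' M" and r: "r \<le> \<rho>" and e: "e > 0" "\<sigma> + (2 * \<sigma>)\<^sup>2 \<le> e\<^sup>2"
    and x: "x \<in> full_space" "norm (fst x) \<le> \<sigma>" "norm (snd x) \<le> \<sigma>"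
  shows "minorant W V js (\<chi> j. b j) r' H \<le> ennreal M * lower_steps (V # schedule W V js) H x"
proof -
  define H' where "H' = lower_steps (schedule W V js) H"
  have H': "H' \<in> borel_measurable borel"
    unfolding H'_def using W V H set_schedule by (intro measurable_lower_steps) blast+
  have [measurable]: "refreshes W V js H \<in> borel_measurable borel" by (rule measurable_refreshes[OF W V H])
  have "minorant W V js (\<chi> j. b j) r' H \<le> (\<integral>\<^sup>+y. ennreal M * (H' (upd x y) * box_weight V I y) \<partial>L I)"
    unfolding minorant_def
  proof (rule nn_integral_mono)
    fix y
    show "(\<integral>\<^sup>+R. refreshes W V js H (avg y, weighted_gram (coef js) R) * indicator (cball (\<chi> j. b j) r') R \<partial>lborel) *
     box_weight V I y \<le> ennreal M * (H' (upd x y) * box_weight V I y)"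
    proof (cases "\<forall>i\<in>I. y i \<in> V i")
      case True
      then have y: "norm (y i) \<le> \<sigma>" if "i \<in> I" for i using V\<sigma>[OF that] that by fastforce
      have y\<mu>: "norm (y i) \<le> \<sigma>" if "i \<in> {1..mu}" for i using y that mu_subset(1) by blast
      define E where "E = snd (upd x y)"
      have "norm E \<le> \<sigma> + (2 * \<sigma>)\<^sup>2" unfolding E_def by (rule norm_snd_upd_le[OF x(2) y\<mu> x(3)])
      then have nE: "norm E \<le> e\<^sup>2" using e by linarith
      have "pos_semidef E"
        using upd_full[OF x(1), of y] unfolding E_def full_space_def by (auto intro: sym_pos_def_imp_pos_semidef)
      then obtain v where v: "E = (\<Sum>i\<in>UNIV. outer_square (v i))" "\<And>i::'d. (norm (v i))\<^sup>2 \<le> norm E"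
        using pos_semidef_eq_sum_outer_square by blast
      have ve: "norm (v i) \<le> e" for i
        by (rule power2_le_imp_le[OF order_trans[OF v(2) nE]]) (use e in simp)
      have h: "(\<lambda>S. refreshes W V js H (avg y, S)) \<in> borel_measurable borel"
      proof -
        have "(\<lambda>S. (avg y, S)) \<in> borel \<rightarrow>\<^sub>M (borel :: 'd state measure)"
          unfolding borel_prod[symmetric] by measurable
        then show ?thesis by (rule measurable_compose) measurable
      qed
      have "(\<integral>\<^sup>+R. refreshes W V js H (avg y, weighted_gram (coef js) R) * indicator (cball (\<chi> j. b j) r') R \<partial>lborel)
        \<le> ennreal M * (\<integral>\<^sup>+R. refreshes W V js H (avg y, weighted_gram (coef js) R + (\<Sum>i\<in>UNIV. outer_square (v i))) * indicator (cball (\<chi> j. b j) r) R \<partial>lborel)"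
        using dom[unfolded gram_dominated_def, rule_format, of v "\<lambda>S. refreshes W V js H (avg y, S)"] ve h by simp
      also have "\<dots> \<le> ennreal M * (\<integral>\<^sup>+R. refreshes W V js H (avg y, E + weighted_gram (coef js) R) * indicator (cball (\<chi> j. b j) \<rho>) R \<partial>lborel)"
        unfolding v(1)[symmetric] using r
        by (intro mult_left_mono nn_integral_mono) (auto simp: add.commute split: split_indicator)
      also have "\<dots> \<le> ennreal M * H' (avg y, E)"
        unfolding H'_def
        by (intro mult_left_mono refreshes_gram_le[OF W V V\<sigma> H comp norm_avg_le[OF y] js]) auto
      also have "(avg y, E) = upd x y" by (auto simp: E_def fst_upd intro: prod_eqI)
      finally show ?thesis by (simp add: mult.assoc[symmetric] mult_right_mono)
    next
      case False
      then have "box_weight V I y = 0" using box_weight_eq_0[of I _ y V] by blast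
      then show ?thesis by simp
    qed
  qed
  also have "\<dots> = ennreal M * lower_step V H' x"
  proof -
    have "(\<lambda>y. H' (upd x y) * box_weight V I y) \<in> borel_measurable (L I)"
      using measurable_compose[OF measurable_upd_PiM H'] measurable_box_weight_L[OF V]
      by (intro borel_measurable_times_ennreal) (auto cong: measurable_cong_sets simp: sets_PiM_lborel)
    then show ?thesis unfolding lower_step_def by (rule nn_integral_cmult)
  qed
  finally show ?thesis by (simp add: H'_def)
qed

lemma sum_tail_w: "(\<Sum>i\<in>{1..mu} - {1}. w i) = 1 - w 1" "w 1 \<le> 1"
proof -
  show "(\<Sum>i\<in>{1..mu} - {1}. w i) = 1 - w 1" using w_sum sum_split_first[of w] by simp
  moreover have "(\<Sum>i\<in>{1..mu} - {1}. w i) \<ge> 0" using w_pos by (intro sum_nonneg) (auto intro: less_imp_le)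
  ultimately show "w 1 \<le> 1" by linarith
qed

lemma norm_tail_le:
  assumes "\<And>i. i \<in> {1..mu} - {1} \<Longrightarrow> norm (y i) \<le> s"
  shows "norm (tail y) \<le> (1 - w 1) * s"
proof -
  have "norm (tail y) \<le> (\<Sum>i\<in>{1..mu} - {1}. w i * s)"
    unfolding tail_def
    by (rule sum_norm_le) (use assms w_pos in \<open>auto simp: abs_of_pos intro!: mult_left_mono less_imp_le\<close>)
  also have "\<dots> = (1 - w 1) * s" by (simp only: sum_distrib_right[symmetric] sum_tail_w)
  finally show ?thesis .
qed

lemma tail_diff: "tail y - tail y' = tail (\<lambda>i. y i - y' i)"
  by (simp add: tail_def sum_subtractf[symmetric] scaleR_diff_right)

text \<open>For zero mean, zero second candidates and \<open>y = a\<close>, the vertex is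
  \<open>- (1 / (1 - c + w 1)) *\<^sub>R tail a\<close>, so the centre of the offsets is chosen to
  place candidate 1 at \<open>a 1\<close>. Deviations are divided by
  \<open>1 - c + w 1 \<ge> 1 - c\<close>, hence the factor \<open>1 - c\<close> in the small radii
  and in the bound on \<sigma>; they add up to at most
  \<open>\<eta> / 4 + \<eta> / 2\<close>.\<close>

lemma compatible_balls:
  assumes \<eta>: "\<eta> > 0" and \<sigma>: "0 \<le> \<sigma>" "\<sigma> \<le> (1 - c) * \<eta> / 8" and V: "\<And>i. i \<in> I \<Longrightarrow> V i \<subseteq> cball 0 \<sigma>"
  shows "compatible (\<lambda>i. ball (a i) (if i = 1 then \<eta> else (1 - c) * \<eta> / 4)) V \<sigma>
    (a 1 + (1 / (1 - c + w 1)) *\<^sub>R tail a) (\<eta> / 4)"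
  unfolding compatible_def
proof (intro allI impI)
  fix m r :: "real^'d" and y y' :: "nat \<Rightarrow> real^'d"
  assume m: "norm m \<le> \<sigma>" and y: "\<forall>i\<in>I'. y i \<in> ball (a i) (if i = 1 then \<eta> else (1 - c) * \<eta> / 4)"
    and y': "\<forall>i\<in>I. y' i \<in> V i" and r: "r \<in> cball (a 1 + (1 / (1 - c + w 1)) *\<^sub>R tail a) (\<eta> / 4)"
  let ?A = "1 - c + w 1"
  have A: "?A > 0" "?A \<ge> 1 - c" using c w1 by auto
  define d where "d = (1 - c) *\<^sub>R m + avg y' + (tail a - tail y)"
  have "norm (tail a - tail y) \<le> (1 - w 1) * ((1 - c) * \<eta> / 4)"
    unfolding tail_diff
  proof (rule norm_tail_le)
    fix i assume "i \<in> {1..mu} - {1}"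
    then have "i \<in> I'" "i \<noteq> 1" using mu_subset(1) by auto
    then have "y i \<in> ball (a i) ((1 - c) * \<eta> / 4)" using y by auto
    then show "norm (a i - y i) \<le> (1 - c) * \<eta> / 4" by (simp add: dist_norm)
  qed
  also have "\<dots> \<le> 1 * ((1 - c) * \<eta> / 4)"
    using w1 c \<eta> by (intro mult_right_mono) auto
  finally have t: "norm (tail a - tail y) \<le> (1 - c) * \<eta> / 4" by simp
  have "norm ((1 - c) *\<^sub>R m) \<le> 1 * \<sigma>" using c m by (simp only: norm_scaleR) (intro mult_mono; simp)
  moreover have "norm (avg y') \<le> \<sigma>" using y' V by (intro norm_avg_le) fastforce
  ultimately have "norm d \<le> \<sigma> + \<sigma> + (1 - c) * \<eta> / 4"
    unfolding d_def using t by (intro norm_triangle_le add_mono) auto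
  also have "\<dots> \<le> (1 - c) * \<eta> / 2" using \<sigma> by linarith
  also have "\<dots> = (1 - c) * (\<eta> / 2)" by simp
  also have "\<dots> \<le> ?A * (\<eta> / 2)" using A \<eta> by (intro mult_right_mono) auto
  finally have d: "norm ((1 / ?A) *\<^sub>R d) \<le> \<eta> / 2" using A by (simp add: field_simps)
  have eq: "r + center m y y' - a 1 = (r - (a 1 + (1 / ?A) *\<^sub>R tail a)) + (1 / ?A) *\<^sub>R d"
    unfolding center_def d_def by (simp add: scaleR_right_distrib scaleR_diff_right)
  have "norm (r - (a 1 + (1 / ?A) *\<^sub>R tail a)) \<le> \<eta> / 4" using r by (simp add: dist_norm norm_minus_commute)
  then have "norm (r + center m y y' - a 1) \<le> \<eta> / 4 + \<eta> / 2"
    unfolding eq using d by (intro norm_triangle_le add_mono)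
  then have "norm (r + center m y y' - a 1) < \<eta>" using \<eta> by linarith
  then show "r + center m y y' \<in> ball (a 1) (if 1 = (1::nat) then \<eta> else (1 - c) * \<eta> / 4)"
    by (simp add: dist_norm norm_minus_commute)
qed

text \<open>If all \<open>a j i\<close> were the basis vector \<open>axis j 1\<close>, the rows
  would be multiples of the basis with common factor \<open>s \<ge> 1\<close>. Each true row errs by
  at most \<open>s / (2 d)\<close>, so the d errors together cost at most half of the lower
  bound.\<close>

lemma centers_coercive:
  fixes a :: "'d \<Rightarrow> nat \<Rightarrow> real^'d"
  assumes "\<And>j i. i \<in> I \<Longrightarrow> norm (a j i - axis j 1) \<le> 1 / (2 * real CARD('d))"
  shows "1 / 2 * norm \<alpha> \<le> norm (transpose (\<chi> j. a j 1 + (1 / (1 - c + w 1)) *\<^sub>R tail (a j)) *v \<alpha>)"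
proof -
  let ?A = "1 - c + w 1"
  define \<epsilon> where "\<epsilon> = 1 / (2 * real CARD('d))"
  define s where "s = 1 + (1 - w 1) / ?A"
  have A: "?A > 0" using c w1 by auto
  have s: "s \<ge> 1" using A sum_tail_w by (simp add: s_def)
  define b where "b j = a j 1 + (1 / ?A) *\<^sub>R tail (a j)" for j
  have bd: "norm (b j - s *\<^sub>R axis j 1) \<le> s * \<epsilon>" for j
  proof -
    have tc: "tail (\<lambda>_. axis j 1) = (1 - w 1) *\<^sub>R axis j 1"
      unfolding tail_def scaleR_left.sum[symmetric] sum_tail_w ..
    have "b j - s *\<^sub>R axis j 1 = (a j 1 - axis j 1) + (1 / ?A) *\<^sub>R (tail (a j) - tail (\<lambda>_. axis j 1))"
    proof -
      define q where "q = (1 - w 1) / ?A"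
      have "(1 / ?A) *\<^sub>R ((1 - w 1) *\<^sub>R axis j (1::real)) = q *\<^sub>R axis j 1" by (simp add: q_def)
      then show ?thesis
        unfolding tc b_def s_def q_def[symmetric] scaleR_diff_right by (simp only: scaleR_left_distrib scaleR_one) simp
    qed
    moreover have "norm (a j 1 - axis j 1) \<le> \<epsilon>" using assms[OF mu_subset(3)] by (simp add: \<epsilon>_def)
    moreover have "norm (tail (a j) - tail (\<lambda>_. axis j 1)) \<le> (1 - w 1) * \<epsilon>"
      unfolding tail_diff using assms mu_subset(1) by (intro norm_tail_le) (auto simp: \<epsilon>_def)
    then have "norm ((1 / ?A) *\<^sub>R (tail (a j) - tail (\<lambda>_. axis j 1))) \<le> (1 - w 1) * \<epsilon> / ?A"
      using A by (simp add: divide_right_mono)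
    ultimately have "norm (b j - s *\<^sub>R axis j 1) \<le> \<epsilon> + (1 - w 1) * \<epsilon> / ?A"
      using norm_triangle_mono by metis
    then show ?thesis by (simp add: s_def algebra_simps)
  qed
  have "(\<Sum>j\<in>UNIV. \<alpha> $ j *\<^sub>R axis j (1::real)) = \<alpha>"
    by (simp add: basis_expansion[symmetric] scalar_mult_eq_scaleR[symmetric]) (simp add: basis_expansion)
  then have sa: "s *\<^sub>R \<alpha> = (\<Sum>j\<in>UNIV. \<alpha> $ j *\<^sub>R (s *\<^sub>R axis j 1))"
    using scaleR_sum_right[of s "\<lambda>j. \<alpha> $ j *\<^sub>R axis j (1::real)" UNIV] by (simp add: mult.commute)
  define Y where "Y = (\<Sum>j\<in>UNIV. \<alpha> $ j *\<^sub>R (b j - s *\<^sub>R axis j 1))"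
  have eq: "(\<Sum>j\<in>UNIV. \<alpha> $ j *\<^sub>R b j) = s *\<^sub>R \<alpha> + Y"
    unfolding Y_def sa sum.distrib[symmetric] by (simp add: scaleR_diff_right)
  have "norm Y \<le> (\<Sum>j\<in>(UNIV::'d set). norm \<alpha> * (s * \<epsilon>))"
    unfolding Y_def
  proof (rule sum_norm_le)
    fix j
    have "\<bar>\<alpha> $ j\<bar> * norm (b j - s *\<^sub>R axis j 1) \<le> norm \<alpha> * (s * \<epsilon>)"
      by (intro mult_mono component_le_norm_cart bd) auto
    then show "norm (\<alpha> $ j *\<^sub>R (b j - s *\<^sub>R axis j 1)) \<le> norm \<alpha> * (s * \<epsilon>)" by simp
  qed
  also have "\<dots> = s * norm \<alpha> / 2" by (simp add: \<epsilon>_def)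
  finally have Y: "norm Y \<le> s * norm \<alpha> / 2" .
  have "norm (s *\<^sub>R \<alpha>) = s * norm \<alpha>" using s by simp
  then have "s * norm \<alpha> - s * norm \<alpha> / 2 \<le> norm (\<Sum>j\<in>UNIV. \<alpha> $ j *\<^sub>R b j)"
    using norm_diff_ineq[of "s *\<^sub>R \<alpha>" Y] Y unfolding eq by linarith
  moreover have "1 * norm \<alpha> \<le> s * norm \<alpha>" using s by (intro mult_right_mono) auto
  ultimately have "1 / 2 * norm \<alpha> \<le> norm (\<Sum>j\<in>UNIV. \<alpha> $ j *\<^sub>R b j)" by linarith
  then show ?thesis unfolding transpose_mult_vector by (simp add: b_def)
qed

lemma ordered_sets_balls:
  assumes "\<And>i j x y. i \<in> I \<Longrightarrow> j \<in> I \<Longrightarrow> i < j \<Longrightarrow> x \<in> ball (a i) \<eta> \<Longrightarrow> y \<in> ball (a j) \<eta> \<Longrightarrow> f (xstar + x) < f (xstar + y)"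
    and "\<And>i. i \<in> I \<Longrightarrow> r i \<le> \<eta>"
  shows "ordered_sets (\<lambda>i. ball (a i) (r i))"
  unfolding ordered_sets_def
proof (intro conjI ballI impI)
  fix i j x y assume ij: "i \<in> I" "j \<in> I" "i < j" and "x \<in> ball (a i) (r i)" "y \<in> ball (a j) (r j)"
  then have "x \<in> ball (a i) \<eta>" "y \<in> ball (a j) \<eta>" using assms(2)[of i] assms(2)[of j] by auto
  then show "f (xstar + x) < f (xstar + y)" using assms(1)[OF ij] by blast
qed auto

end

section \<open>Consequences of the uniform minorization\<close>

context cma_es begin

lemma normalize'_in: "normalize' x \<in> X"
  using measurable_space[OF measurable_normalize', of x] by simp

text \<open>The constant is only locally uniform, but \<nu> and the exponent are the same at every
  state. The common \<nu> gives irreducibility and aperiodicity, the local uniformity small sets and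
  the continuous component.\<close>

definition minorizing :: "nat \<Rightarrow> 'd state measure \<Rightarrow> bool" where
  "minorizing N \<nu> \<longleftrightarrow> nontrivial_measure_on X \<nu> \<and>
     (\<forall>x\<in>X. \<exists>T \<delta>. open T \<and> x \<in> T \<and> \<delta> > 0 \<and>
        (\<forall>y\<in>T \<inter> X. \<forall>A\<in>sets (borel_on X). ennreal \<delta> * emeasure \<nu> A \<le> emeasure (kernel_pow X P N y) A))"

text \<open>The constants form a chain. The balls \<open>W\<close> near the basis vectors fix \<eta>
  and the centres \<open>b\<close>; these determine the absorption threshold \<open>e\<close>, which
  limits \<sigma>, the size of the rescaled initial state and of the candidates in \<open>V\<close>.
  The same \<open>V\<close> serves the first iteration and the second half of each double step, so
  that the mean stays below \<sigma> throughout.\<close>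

lemma minorization: "\<exists>N \<nu>. minorizing (Suc N) \<nu>"
proof -
  define \<epsilon>0 where "\<epsilon>0 = 1 / (2 * real CARD('d))"
  have \<epsilon>0: "\<epsilon>0 > 0" by (simp add: \<epsilon>0_def)
  have "\<exists>a \<eta>. \<eta> > 0 \<and> (\<forall>i\<in>I. a i \<in> ball (axis j 1) \<epsilon>0) \<and> (\<forall>i\<in>I. \<forall>k\<in>I. i < k \<longrightarrow>
      (\<forall>x\<in>ball (a i) \<eta>. \<forall>y\<in>ball (a k) \<eta>. f (xstar + x) < f (xstar + y)))" for j :: 'd
    using ordered_balls_exist[OF \<epsilon>0, of "axis j 1"] by metis
  then obtain a \<eta>' where a: "\<And>j. \<eta>' j > 0" "\<And>j i. i \<in> I \<Longrightarrow> a j i \<in> ball (axis j 1) \<epsilon>0"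
    "\<And>j i k x y. i \<in> I \<Longrightarrow> k \<in> I \<Longrightarrow> i < k \<Longrightarrow> x \<in> ball (a j i) (\<eta>' j) \<Longrightarrow> y \<in> ball (a j k) (\<eta>' j) \<Longrightarrow>
      f (xstar + x) < f (xstar + y)"
    by metis
  define \<eta> where "\<eta> = Min (range \<eta>')"
  have \<eta>: "\<eta> > 0" "\<eta> \<le> \<eta>' j" for j using a(1) by (auto simp: \<eta>_def)
  \<comment> \<open>Only candidate 1 varies by the full radius; the smaller radius of the others
    limits the motion of the vertex.\<close>
  define W where "W j i = ball (a j i) (if i = 1 then \<eta> else (1 - c) * \<eta> / 4)" for j i
  have \<eta>4: "0 < (1 - c) * \<eta> / 4" "(1 - c) * \<eta> / 4 \<le> \<eta>"
  proof -
    show "0 < (1 - c) * \<eta> / 4" using c \<eta>(1) by simp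
    have "(1 - c) * \<eta> \<le> 1 * \<eta>" using c \<eta>(1) by (intro mult_right_mono) auto
    then show "(1 - c) * \<eta> / 4 \<le> \<eta>" using \<eta>(1) by linarith
  qed
  have W_ord: "ordered_sets (W j)" for j
    unfolding W_def
  proof (rule ordered_sets_balls[where \<eta> = "\<eta>' j"])
    show "(if i = 1 then \<eta> else (1 - c) * \<eta> / 4) \<le> \<eta>' j" for i
      using \<eta>(2)[of j] \<eta>4(2) by auto
  qed (rule a(3))
  have W: "W j i \<in> sets borel" "emeasure lborel (W j i) \<noteq> 0" for j i
    unfolding W_def using \<eta>(1) \<eta>4(1) by (auto intro!: emeasure_ball_nonzero)
  define b where "b j = a j 1 + (1 / (1 - c + w 1)) *\<^sub>R tail (a j)" for j
  have coer: "1 / 2 * norm \<alpha> \<le> norm (transpose (\<chi> j. b j) *v \<alpha>)" for \<alpha>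
    unfolding b_def
  proof (rule centers_coercive)
    fix j i assume "i \<in> I"
    then show "norm (a j i - axis j 1) \<le> 1 / (2 * real CARD('d))"
      using a(2)[of i j] by (simp add: \<epsilon>0_def dist_norm norm_minus_commute)
  qed
  obtain js :: "'d list" where js: "set js = UNIV" "distinct js"
    using finite_distinct_list[of "UNIV :: 'd set"] by auto
  \<comment> \<open>\<open>1 / 4\<close> is \<open>l / 2\<close> for the coercivity constant
    \<open>l = 1 / 2\<close>, and \<open>\<eta> / 4\<close> is the radius of admissible
    offsets.\<close>
  define r where "r = min (\<eta> / 4) (1 / 4)"
  have r: "0 < r" "r \<le> 1 / 2 / 2" "r \<le> \<eta> / 4" using \<eta>(1) by (auto simp: r_def)
  have cp: "coef js j > 0" for j by (rule coef_pos) (simp add: js)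
  obtain e r' M where e: "e > 0" "r' > 0" "M \<ge> 0" "gram_dominated (coef js) (\<chi> j. b j) (UNIV :: 'd set) r e r' M"
    using absorb_sum_outer_square[where \<omega> = "coef js" and I = "UNIV :: 'd set" and B = "\<chi> j. b j" and l = "1 / 2",
        OF finite cp _ coer r(1,2)] by auto
  \<comment> \<open>The 5 comes from
    \<open>\<sigma> + (2 * \<sigma>)\<^sup>2 \<le> 5 * \<sigma>\<close> for \<sigma> \<le> 1, the
    bound on the covariance after the first iteration.\<close>
  define \<sigma> where "\<sigma> = min (min 1 ((1 - c) * \<eta> / 8)) (e\<^sup>2 / 5)"
  have \<sigma>: "\<sigma> > 0" "\<sigma> \<le> 1" "\<sigma> \<le> (1 - c) * \<eta> / 8" "\<sigma> \<le> e\<^sup>2 / 5"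
    using c \<eta>(1) e(1) by (auto simp: \<sigma>_def)
  have \<sigma>e: "\<sigma> + (2 * \<sigma>)\<^sup>2 \<le> e\<^sup>2"
  proof -
    have "\<sigma> * \<sigma> \<le> \<sigma> * 1" using \<sigma> by (intro mult_left_mono) auto
    then have "\<sigma> + (2 * \<sigma>)\<^sup>2 \<le> 5 * \<sigma>" by (simp add: power2_eq_square)
    then show ?thesis using \<sigma>(4) by linarith
  qed
  obtain a0 \<eta>0 where a0: "\<eta>0 > 0" "\<And>i. i \<in> I \<Longrightarrow> a0 i \<in> ball 0 (\<sigma> / 2)"
    "\<And>i k x y. i \<in> I \<Longrightarrow> k \<in> I \<Longrightarrow> i < k \<Longrightarrow> x \<in> ball (a0 i) \<eta>0 \<Longrightarrow> y \<in> ball (a0 k) \<eta>0 \<Longrightarrow> f (xstar + x) < f (xstar + y)"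
    using ordered_balls_exist[of "\<sigma> / 2" 0] \<sigma>(1) by (metis half_gt_zero)
  define V where "V i = ball (a0 i) (min \<eta>0 (\<sigma> / 2))" for i
  have V_ord: "ordered_sets V"
    unfolding V_def by (rule ordered_sets_balls[where \<eta> = \<eta>0, OF a0(3)]) auto
  have V: "V i \<in> sets borel" "emeasure lborel (V i) \<noteq> 0" for i
    unfolding V_def using a0(1) \<sigma>(1) by (auto intro!: emeasure_ball_nonzero)
  have V\<sigma>: "V i \<subseteq> cball 0 \<sigma>" if "i \<in> I" for i
  proof
    fix y assume "y \<in> V i"
    then have "norm (y - a0 i) \<le> \<sigma> / 2" by (simp add: V_def dist_norm norm_minus_commute)
    moreover have "norm (a0 i) \<le> \<sigma> / 2" using a0(2)[OF that] by simp
    ultimately show "y \<in> cball 0 \<sigma>" using norm_triangle_sub[of y "a0 i"] by simp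
  qed
  have comp: "compatible (W j) V \<sigma> (b j) (\<eta> / 4)" for j
    unfolding W_def b_def using \<eta>(1) \<sigma> V\<sigma> by (intro compatible_balls) auto
  define Ws where "Ws = V # schedule W V js"
  have Ws: "ordered_sets U" if "U \<in> set Ws" for U
    using that set_schedule[of U W V js] W_ord V_ord by (auto simp: Ws_def)
  \<comment> \<open>Events of the normalized space are tested on full states through
    \<open>normalize'\<close>, so \<nu> is the normalized image of the measure behind
    \<open>minorant\<close>.\<close>
  define g where "g A x = (indicator A (normalize' x) :: ennreal)" for A :: "'d state set" and x
  have gm: "g A \<in> borel_measurable borel" if "A \<in> sets (borel_on X)" for A
    unfolding g_def using measurable_compose[OF measurable_normalize' borel_measurable_indicator[OF that]] .
  define \<mu> where "\<mu> A = minorant W V js (\<chi> j. b j) r' (g A)" for A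
  define \<nu> where "\<nu> = measure_of X (sets (borel_on X)) \<mu>"
  have sets\<nu>: "sets \<nu> = sets (borel_on X)"
    unfolding \<nu>_def using sets.sets_measure_of_eq[of "borel_on X"] by simp
  have em: "emeasure \<nu> A = \<mu> A" if A: "A \<in> sets (borel_on X)" for A
  proof (rule emeasure_measure_of[OF \<nu>_def])
    show "sets (borel_on X) \<subseteq> Pow X" using sets.space_closed[of "borel_on X"] by simp
    show "A \<in> sets \<nu>" using A sets\<nu> by simp
    have "g {} = (\<lambda>x. \<Sum>n::nat. 0)" by (rule ext) (simp add: g_def)
    then have "\<mu> {} = (\<Sum>n::nat. minorant W V js (\<chi> j. b j) r' (\<lambda>_. 0))"
      unfolding \<mu>_def using minorant_suminf[where H = "\<lambda>_ _. 0" and W = W and V = V, OF W(1) V(1)] by simp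
    moreover have "refreshes W V js (\<lambda>_. 0) = (\<lambda>_. 0)"
      by (induction js) (auto simp: refresh_def)
    then have "minorant W V js (\<chi> j. b j) r' (\<lambda>_. 0) = 0" by (simp add: minorant_def)
    ultimately show "positive (sets \<nu>) \<mu>" by (simp add: positive_def)
    show "countably_additive (sets \<nu>) \<mu>"
    proof (rule countably_additiveI)
      fix F :: "nat \<Rightarrow> 'd state set"
      assume F: "range F \<subseteq> sets \<nu>" "disjoint_family F"
      have "g (\<Union>n. F n) = (\<lambda>x. \<Sum>n. g (F n) x)"
        unfolding g_def by (rule ext) (rule suminf_indicator[OF F(2), symmetric])
      then show "(\<Sum>n. \<mu> (F n)) = \<mu> (\<Union>n. F n)"
        unfolding \<mu>_def using F(1) sets\<nu>
        by (simp add: minorant_suminf[where W = W and V = V and H = "\<lambda>n. g (F n)", OF W(1) V(1) gm])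
    qed
  qed
  have "g X = (\<lambda>_. 1)"
    by (rule ext) (simp add: g_def normalize'_in)
  then have "\<mu> X \<noteq> 0"
    unfolding \<mu>_def using minorant_1_nonzero[where W = W and V = V, OF W V e(2)] by simp
  moreover have "X \<in> sets (borel_on X)" using sets.top[of "borel_on X"] by simp
  ultimately have nt: "nontrivial_measure_on X \<nu>"
    unfolding nontrivial_measure_on_def using sets\<nu> em by (simp add: zero_less_iff_neq_zero)
  have "\<exists>T \<delta>. open T \<and> x0 \<in> T \<and> \<delta> > 0 \<and>
        (\<forall>y\<in>T \<inter> X. \<forall>A\<in>sets (borel_on X). ennreal \<delta> * emeasure \<nu> A \<le> emeasure (kernel_pow X P (length Ws) y) A)"
    if x0: "x0 \<in> X" for x0
  proof -
    have "sym_pos_def (snd x0)" using x0 by (auto simp: normalized_space_def)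
    then obtain \<alpha> where \<alpha>: "\<alpha> > 0" "\<And>v. \<alpha> * (norm v)\<^sup>2 \<le> v \<bullet> (snd x0 *v v)"
      using pos_def_coercive[of "snd x0"] by (auto simp: sym_pos_def_def)
    \<comment> \<open>Radius 1 bounds the norms by \<open>R\<close>; radius
      \<open>\<alpha> / 2\<close> preserves half of the coercivity of the covariance.\<close>
    define T where "T = ball x0 (min 1 (\<alpha> / 2))"
    define R where "R = norm x0 + 1"
    \<comment> \<open>With \<open>t \<le> 1\<close> the single condition
      \<open>t * R \<le> \<sigma>\<close> covers both the mean, scaled by \<open>t\<close>, and the
      covariance, scaled by \<open>t\<^sup>2\<close>.\<close>
    define t where "t = min 1 (\<sigma> / R)"
    have R: "R > 0" by (simp add: R_def add_nonneg_pos)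
    have t: "t > 0" "t \<le> 1" "t * R \<le> \<sigma>"
    proof -
      show "t > 0" "t \<le> 1" using \<sigma>(1) R by (auto simp: t_def)
      have "t * R \<le> \<sigma> / R * R" using R by (intro mult_right_mono) (auto simp: t_def)
      then show "t * R \<le> \<sigma>" using R by simp
    qed
    obtain M2 where M2: "M2 \<ge> 0" "\<forall>x\<in>bounded_states \<sigma> (t\<^sup>2 * (\<alpha> / 2)). \<forall>h\<in>borel_measurable borel.
        lower_steps Ws h x \<le> ennreal M2 * (K ^^ length Ws) h x"
      using lower_steps_le_K_pow[where a = "t\<^sup>2 * (\<alpha> / 2)" and Ws = Ws, OF Ws \<sigma>(1)] t(1) \<alpha>(1) by fastforce
    \<comment> \<open>\<open>M\<close> comes from absorbing the initial covariance and
      \<open>M2\<close> from the passage to the true kernel; the 1 protects the quotient if their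
      product is 0.\<close>
    show ?thesis
    proof (intro exI[of _ T] exI[of _ "1 / (M * M2 + 1)"] conjI ballI)
      show "open T" "x0 \<in> T" using \<alpha> by (auto simp: T_def)
      have MM: "M * M2 + 1 > 0" using e(3) M2(1) by (simp add: add_nonneg_pos)
      then show "1 / (M * M2 + 1) > 0" by simp
      fix y A assume y: "y \<in> T \<inter> X" and A: "A \<in> sets (borel_on X)"
      have yf: "y \<in> full_space" using y normalized_space_subset_full by auto
      have ny: "norm y \<le> R"
        using y norm_triangle_sub[of y x0] by (auto simp: T_def R_def dist_norm norm_minus_commute)
      have n1: "norm (fst y) \<le> R" and n2: "norm (snd y) \<le> R"
        using ny norm_fst_le[of "fst y" "snd y"] norm_snd_le[of "snd y" "fst y"] by auto
      define x where "x = rescale t y"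
      have xf: "x \<in> full_space" using rescale_full[OF yf t(1)] by (simp add: x_def)
      have nx: "norm (fst x) \<le> \<sigma>" "norm (snd x) \<le> \<sigma>"
      proof -
        have "norm (fst x) \<le> t * R" using n1 t by (simp add: x_def rescale_def mult_left_mono)
        then show "norm (fst x) \<le> \<sigma>" using t by linarith
        have "t\<^sup>2 * norm (snd y) \<le> t * R"
          using n2 t by (intro mult_mono) (auto simp: power2_eq_square mult_left_le_one_le)
        then show "norm (snd x) \<le> \<sigma>" using t by (simp add: x_def rescale_def)
      qed
      have "norm (snd y - snd x0) \<le> \<alpha> / 2"
      proof -
        have "dist (snd x0) (snd y) \<le> dist x0 y" by (rule dist_snd_le)
        then show ?thesis using y by (auto simp: T_def dist_norm norm_minus_commute)
      qed
      then have "\<alpha> / 2 * (norm v)\<^sup>2 \<le> v \<bullet> (snd y *v v)" for v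
        using pos_def_perturb[of \<alpha> "snd x0" "snd y" "\<alpha> / 2" v] \<alpha>(2) by simp
      then have "t\<^sup>2 * (\<alpha> / 2) * (norm v)\<^sup>2 \<le> v \<bullet> (snd x *v v)" for v
        using mult_left_mono[of "\<alpha> / 2 * (norm v)\<^sup>2" "v \<bullet> (snd y *v v)" "t\<^sup>2"]
        by (simp add: x_def rescale_def scaleR_matrix_vector_assoc[symmetric] mult.assoc)
      then have bs: "x \<in> bounded_states \<sigma> (t\<^sup>2 * (\<alpha> / 2))"
        using xf nx by (auto simp: bounded_states_def)
      have nrm: "normalize x = y"
        using normalize_rescale[OF yf t(1)] normalize_id[of y] y by (simp add: x_def)
      have sets_k: "sets (kernel_pow X P (length Ws) y) = sets (borel_on X)"
        using kernel_pow_subprob[of y "length Ws"] y by (simp add: space_subprob_algebra)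
      have "\<mu> A \<le> ennreal M * lower_steps Ws (g A) x"
        unfolding \<mu>_def Ws_def
        by (rule minorant_le[where W = W and V = V and b = b and \<rho> = "\<eta> / 4" and \<sigma> = \<sigma>,
              OF W(1) V(1) V\<sigma> gm[OF A] comp js(2,1) e(4) r(3) e(1) \<sigma>e xf nx])
      also have "\<dots> \<le> ennreal M * (ennreal M2 * (K ^^ length Ws) (g A) x)"
        using M2(2) bs gm[OF A] by (intro mult_left_mono) auto
      also have "(K ^^ length Ws) (g A) x = emeasure (kernel_pow X P (length Ws) y) A"
        using nn_integral_kernel_pow[OF xf borel_measurable_indicator[OF A], of "length Ws"] A sets_k
        by (simp add: nrm g_def[abs_def])
      finally have "emeasure \<nu> A \<le> ennreal (M * M2) * emeasure (kernel_pow X P (length Ws) y) A"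
        using em[OF A] e(3) M2(1) by (simp add: ennreal_mult mult.assoc)
      also have "\<dots> \<le> ennreal (M * M2 + 1) * emeasure (kernel_pow X P (length Ws) y) A"
        by (intro mult_right_mono ennreal_leI) auto
      finally have "ennreal (1 / (M * M2 + 1)) * emeasure \<nu> A \<le>
          ennreal (1 / (M * M2 + 1)) * (ennreal (M * M2 + 1) * emeasure (kernel_pow X P (length Ws) y) A)"
        by (intro mult_left_mono) auto
      also have "\<dots> = ennreal (1 / (M * M2 + 1) * (M * M2 + 1)) * emeasure (kernel_pow X P (length Ws) y) A"
        using MM by (subst ennreal_mult) (auto simp: mult.assoc)
      also have "\<dots> = emeasure (kernel_pow X P (length Ws) y) A" using MM by simp
      finally show "ennreal (1 / (M * M2 + 1)) * emeasure \<nu> A \<le> emeasure (kernel_pow X P (length Ws) y) A" .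
    qed
  qed
  then have "minorizing (Suc (length (schedule W V js))) \<nu>"
    using nt by (simp add: minorizing_def Ws_def)
  then show ?thesis by blast
qed

lemma kernel_pow_prob:
  assumes "x \<in> X"
  shows "emeasure (kernel_pow X P n x) X = 1"
proof -
  have xf: "x \<in> full_space" "normalize x = x"
    using assms normalized_space_subset_full normalize_id[OF assms] by auto
  have sets_k: "sets (kernel_pow X P n x) = sets (borel_on X)"
    using kernel_pow_subprob[OF assms, of n] by (simp add: space_subprob_algebra)
  have X: "X \<in> sets (borel_on X)" using sets.top[of "borel_on X"] by simp
  interpret N: prob_space noise by (rule prob_space_noise)
  have K1: "(K ^^ n) (\<lambda>_. 1) = (\<lambda>_. 1)"
    by (induction n) (auto simp: K_def N.emeasure_space_1)
  have "(\<lambda>x. indicator X (normalize' x) :: ennreal) = (\<lambda>_. 1)"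
    by (rule ext) (simp add: normalize'_in)
  then show ?thesis
    using nn_integral_kernel_pow[OF xf(1) borel_measurable_indicator[OF X], of n] X sets_k
    by (simp add: xf(2) K1)
qed

lemma sets_kernel_pow: "x \<in> X \<Longrightarrow> sets (kernel_pow X P n x) = sets (borel_on X)"
  using kernel_pow_subprob[of x n] by (simp add: space_subprob_algebra)

lemma emeasure_kernel_pow_le_1: "x \<in> X \<Longrightarrow> emeasure (kernel_pow X P n x) A \<le> 1"
  using kernel_pow_prob[of x n] emeasure_space[of "kernel_pow X P n x" A] sets_kernel_pow[of x n]
  by (simp add: sets_eq_imp_space_eq)

text \<open>The minorization at time \<open>Suc N\<close> is one term of the sum over positive
  times.\<close>

lemma minorizing_irreducibility:
  assumes "minorizing (Suc N) \<nu>"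
  shows "irreducibility_measure X P \<nu>"
  unfolding irreducibility_measure_def
proof (intro conjI ballI impI)
  show "nontrivial_measure_on X \<nu>" using assms by (simp add: minorizing_def)
  fix A x assume A: "A \<in> sets (borel_on X)" "emeasure \<nu> A > 0" and x: "x \<in> X"
  obtain \<delta> where \<delta>: "\<delta> > 0" "ennreal \<delta> * emeasure \<nu> A \<le> emeasure (kernel_pow X P (Suc N) x) A"
    using assms x A(1) unfolding minorizing_def by blast
  have "0 < ennreal \<delta> * emeasure \<nu> A" using \<delta>(1) A(2) by (simp add: ennreal_zero_less_mult_iff)
  also note \<delta>(2)
  also have "emeasure (kernel_pow X P (Suc N) x) A \<le> (\<Sum>k. emeasure (kernel_pow X P (Suc k) x) A)"
    using sum_le_suminf[of "\<lambda>k. emeasure (kernel_pow X P (Suc k) x) A" "{N}"] by (simp del: kernel_pow.simps)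
  finally show "(\<Sum>k. emeasure (kernel_pow X P (Suc k) x) A) > 0" .
qed

lemma minorizing_small_set:
  assumes min: "minorizing N \<nu>" and S: "compact S" "S \<subseteq> X"
  shows "small_set X P S"
proof -
  have "\<forall>x\<in>X. \<exists>T \<delta>. open T \<and> x \<in> T \<and> \<delta> > 0 \<and>
        (\<forall>y\<in>T \<inter> X. \<forall>A\<in>sets (borel_on X). ennreal \<delta> * emeasure \<nu> A \<le> emeasure (kernel_pow X P N y) A)"
    using min by (simp add: minorizing_def)
  then obtain T \<delta> where T: "\<And>x. x \<in> X \<Longrightarrow> open (T x)" "\<And>x. x \<in> X \<Longrightarrow> x \<in> T x" "\<And>x. x \<in> X \<Longrightarrow> \<delta> x > 0"
    "\<And>x y A. x \<in> X \<Longrightarrow> y \<in> T x \<inter> X \<Longrightarrow> A \<in> sets (borel_on X) \<Longrightarrow>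
      ennreal (\<delta> x) * emeasure \<nu> A \<le> emeasure (kernel_pow X P N y) A"
    by metis
  have "S \<subseteq> (\<Union>x\<in>S. T x)" using T(2) S(2) by auto
  then obtain F where F: "F \<subseteq> S" "finite F" "S \<subseteq> (\<Union>x\<in>F. T x)"
    using compactE_image[OF S(1), of S T] T(1) S(2) by blast
  \<comment> \<open>The element 1 covers the empty compact set, whose subcover may be empty.\<close>
  define d where "d = Min (insert 1 (\<delta> ` F))"
  have d: "d > 0" using F S(2) T(3) by (subst d_def, subst Min_gr_iff) auto
  have dF: "d \<le> \<delta> x" if "x \<in> F" for x using F(2) that by (auto simp: d_def)
  show ?thesis
    unfolding small_set_def
  proof (intro conjI exI[of _ N] exI[of _ "scale_measure (ennreal d) \<nu>"] ballI)
    show "S \<in> sets (borel_on X)"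
      using S borel_compact[OF S(1)] by (auto simp: sets_restrict_space image_iff intro!: bexI[of _ S])
    show "nontrivial_measure_on X (scale_measure (ennreal d) \<nu>)"
      using min d by (auto simp: minorizing_def nontrivial_measure_on_def ennreal_zero_less_mult_iff)
    fix y A assume y: "y \<in> S" and A: "A \<in> sets (borel_on X)"
    obtain x where x: "x \<in> F" "y \<in> T x" using F(3) y by auto
    have "emeasure (scale_measure (ennreal d) \<nu>) A = ennreal d * emeasure \<nu> A" by simp
    also have "\<dots> \<le> ennreal (\<delta> x) * emeasure \<nu> A"
      using dF[OF x(1)] by (intro mult_right_mono ennreal_leI) auto
    also have "\<dots> \<le> emeasure (kernel_pow X P N y) A"
      using x y F(1) S(2) A by (intro T(4)) auto
    finally show "emeasure (scale_measure (ennreal d) \<nu>) A \<le> emeasure (kernel_pow X P N y) A" .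
  qed
qed

text \<open>The supremum of all locally valid minorization constants is lower semicontinuous.\<close>

lemma minorizing_T_chain:
  assumes min: "minorizing N \<nu>"
  shows "T_chain X P"
proof -
  define Q where "Q = {(T, \<delta>::ennreal). open T \<and>
      (\<forall>y\<in>T \<inter> X. \<forall>A\<in>sets (borel_on X). \<delta> * emeasure \<nu> A \<le> emeasure (kernel_pow X P N y) A)}"
  define g where "g x = (SUP (T, \<delta>)\<in>{(T, \<delta>)\<in>Q. x \<in> T}. \<delta>)" for x
  define \<tau> where "\<tau> x = scale_measure (g x) \<nu>" for x
  have sets\<nu>: "sets \<nu> = sets (borel_on X)" and \<nu>X: "emeasure \<nu> X > 0"
    using min by (auto simp: minorizing_def nontrivial_measure_on_def)
  have em: "emeasure (\<tau> x) A = (SUP (T, \<delta>)\<in>{(T, \<delta>)\<in>Q. x \<in> T}. \<delta> * emeasure \<nu> A)" for x A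
  proof -
    have "emeasure (\<tau> x) A = (SUP p\<in>{(T, \<delta>)\<in>Q. x \<in> T}. snd p) * emeasure \<nu> A"
      by (simp add: \<tau>_def g_def split_beta')
    also have "\<dots> = (SUP p\<in>{(T, \<delta>)\<in>Q. x \<in> T}. snd p * emeasure \<nu> A)"
      by (rule SUP_mult_right_ennreal)
    finally show ?thesis by (simp add: split_beta')
  qed
  have less_iff: "s < emeasure (\<tau> x) A \<longleftrightarrow> (\<exists>(T, \<delta>)\<in>Q. x \<in> T \<and> s < \<delta> * emeasure \<nu> A)" for s x A
    unfolding em less_SUP_iff by auto
  have le: "emeasure (\<tau> x) A \<le> emeasure (kernel_pow X P N x) A" if "x \<in> X" "A \<in> sets (borel_on X)" for x A
    unfolding em using that by (intro SUP_least) (auto simp: Q_def)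
  have opn: "openin (top_of_set X) {x\<in>X. s < emeasure (\<tau> x) A}" for s A
  proof -
    have "{x\<in>X. s < emeasure (\<tau> x) A} = X \<inter> (\<Union>(T, \<delta>)\<in>{(T, \<delta>)\<in>Q. s < \<delta> * emeasure \<nu> A}. T)"
      using less_iff by auto
    moreover have "open (\<Union>(T, \<delta>)\<in>{(T, \<delta>)\<in>Q. s < \<delta> * emeasure \<nu> A}. T)"
      by (intro open_UN) (auto simp: Q_def)
    ultimately show ?thesis by auto
  qed
  have pos: "emeasure (\<tau> x) X > 0" if x: "x \<in> X" for x
  proof -
    obtain T \<delta> where T: "open T" "x \<in> T" "\<delta> > 0"
      "\<forall>y\<in>T \<inter> X. \<forall>A\<in>sets (borel_on X). ennreal \<delta> * emeasure \<nu> A \<le> emeasure (kernel_pow X P N y) A"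
      using min x unfolding minorizing_def by blast
    then have "(T, ennreal \<delta>) \<in> Q" by (simp add: Q_def)
    moreover have "0 < ennreal \<delta> * emeasure \<nu> X" using T(3) \<nu>X by (simp add: ennreal_zero_less_mult_iff)
    ultimately show ?thesis using less_iff T(2) by blast
  qed
  have sub: "substochastic_kernel X \<tau>"
    unfolding substochastic_kernel_def
  proof (rule measurable_subprob_algebra)
    fix x assume "x \<in> space (borel_on X)"
    then have x: "x \<in> X" by simp
    show "sets (\<tau> x) = sets (borel_on X)" by (simp add: \<tau>_def sets\<nu>)
    have X: "X \<in> sets (borel_on X)" using sets.top[of "borel_on X"] by simp
    have "emeasure (\<tau> x) X \<le> 1" using le[OF x X] kernel_pow_prob[OF x, of N] by simp
    moreover have "space (\<tau> x) = X"
      using sets_eq_imp_space_eq[OF sets\<nu>] by (simp add: \<tau>_def space_scale_measure)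
    moreover have "X \<noteq> {}" using x by auto
    ultimately show "subprob_space (\<tau> x)" by (intro subprob_spaceI) auto
  next
    fix A assume "A \<in> sets (borel_on X)"
    show "(\<lambda>x. emeasure (\<tau> x) A) \<in> borel_measurable (borel_on X)"
    proof (rule borel_measurableI_greater)
      fix s
      obtain O' where "open O'" "{x\<in>X. s < emeasure (\<tau> x) A} = X \<inter> O'"
        using opn[of s A] unfolding openin_open by blast
      then show "{x \<in> space (borel_on X). s < emeasure (\<tau> x) A} \<in> sets (borel_on X)"
        by (auto simp: sets_restrict_space)
    qed
  qed
  show ?thesis
    unfolding T_chain_def
  proof (intro exI[of _ "return_pmf N"] exI[of _ \<tau>] conjI ballI)
    fix x A assume x: "x \<in> X" and A: "A \<in> sets (borel_on X)"
    have "emeasure (kernel_pow X P N x) A = (\<Sum>k\<in>{N}. ennreal (pmf (return_pmf N) k) * emeasure (kernel_pow X P k x) A)"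
      by simp
    also have "\<dots> \<le> sampled_kernel X P (return_pmf N) x A"
      unfolding sampled_kernel_def by (rule sum_le_suminf) auto
    finally show "emeasure (\<tau> x) A \<le> sampled_kernel X P (return_pmf N) x A"
      using le[OF x A] by simp
  next
    fix A show "lsc_on X (\<lambda>x. emeasure (\<tau> x) A)" unfolding lsc_on_def using opn by blast
  qed (use sub pos in auto)
qed

text \<open>If the chain is almost surely in one class at time \<open>k\<close>, a further step
  moves almost all of the mass to the next class.\<close>

lemma kernel_pow_cycle:
  assumes cyc: "cycle X P n D" and i: "i < n" and x: "x \<in> D i"
  shows "emeasure (kernel_pow X P k x) (D ((i + k) mod n)) = 1"
proof -
  have D: "\<And>i. i < n \<Longrightarrow> D i \<in> sets (borel_on X)" "n \<ge> 1"
    "\<And>i x. i < n \<Longrightarrow> x \<in> D i \<Longrightarrow> emeasure (P x) (D ((i + 1) mod n)) = 1"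
    using cyc by (auto simp: cycle_def)
  have DX: "D i \<subseteq> X" if "i < n" for i using sets.sets_into_space[OF D(1)[OF that]] by simp
  have xX: "x \<in> X" using DX[OF i] x by auto
  show ?thesis
  proof (induction k)
    case 0
    then show ?case using i x D(1)[OF i] by simp
  next
    case (Suc k)
    let ?j = "(i + k) mod n" and ?j' = "(i + Suc k) mod n"
    have j: "?j < n" "?j' < n" using D(2) by auto
    have jj: "?j' = (?j + 1) mod n" by (simp add: mod_Suc_eq)
    have PM: "P \<in> kernel_pow X P k x \<rightarrow>\<^sub>M subprob_algebra (borel_on X)"
      using P_subprob by (simp cong: measurable_cong_sets add: sets_kernel_pow[OF xX])
    have "1 = (\<integral>\<^sup>+y. indicator (D ?j) y \<partial>kernel_pow X P k x)"
      using Suc D(1)[OF j(1)] by (simp add: sets_kernel_pow[OF xX])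
    also have "\<dots> \<le> (\<integral>\<^sup>+y. emeasure (P y) (D ?j') \<partial>kernel_pow X P k x)"
      using D(3)[OF j(1)] unfolding jj by (intro nn_integral_mono) (auto split: split_indicator)
    also have "\<dots> = emeasure (kernel_pow X P (Suc k) x) (D ?j')"
    proof -
      have "space (kernel_pow X P k x) \<noteq> {}"
        using xX sets_eq_imp_space_eq[OF sets_kernel_pow[OF xX, of k]] by auto
      then show ?thesis using emeasure_bind[OF _ PM D(1)[OF j(2)]] by simp
    qed
    finally show ?case using emeasure_kernel_pow_le_1[OF xX, of "Suc k" "D ?j'"] by simp
  qed
qed

text \<open>Some class \<open>D i\<close> is charged by \<nu>, hence reached with positive
  probability at time \<open>Suc N\<close> from every state, in whatever class it lies. In a cycle
  the class at that time is determined by the starting class, so all nonempty classes are congruent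
  modulo \<open>n\<close>.\<close>

lemma minorizing_aperiodic:
  assumes min: "minorizing (Suc N) \<nu>"
  shows "aperiodic X P"
  unfolding aperiodic_def
proof (intro conjI allI impI exI[of _ "\<lambda>_. X"])
  have X: "X \<in> sets (borel_on X)" using sets.top[of "borel_on X"] by simp
  have "emeasure (P x) X = 1" if "x \<in> X" for x
  proof -
    have "P x \<in> space (prob_algebra (borel_on X))"
      using markov_kernel_P that unfolding markov_kernel_def by (auto dest: measurable_space)
    then have "prob_space (P x)" "sets (P x) = sets (borel_on X)" by (auto simp: space_prob_algebra)
    then show ?thesis
      using prob_space.emeasure_space_1[of "P x"] sets_eq_imp_space_eq[of "P x" "borel_on X"] by simp
  qed
  then show "cycle X P 1 (\<lambda>_. X)"
    using X by (auto simp: cycle_def disjoint_family_on_def)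
  fix n D assume cyc: "cycle X P n D"
  have D: "\<And>i. i < n \<Longrightarrow> D i \<in> sets (borel_on X)" "n \<ge> 1" "disjoint_family_on D {..<n}"
    "\<And>i x. i < n \<Longrightarrow> x \<in> D i \<Longrightarrow> emeasure (P x) (D ((i + 1) mod n)) = 1"
    "\<And>\<phi>. irreducibility_measure X P \<phi> \<Longrightarrow> emeasure \<phi> (X - (\<Union>i<n. D i)) = 0"
    using cyc by (auto simp: cycle_def)
  have sets\<nu>: "sets \<nu> = sets (borel_on X)" and \<nu>X: "emeasure \<nu> X > 0"
    using min by (auto simp: minorizing_def nontrivial_measure_on_def)
  have "\<exists>i<n. emeasure \<nu> (D i) > 0"
  proof (rule ccontr)
    assume "\<not> ?thesis"
    then have "D i \<in> null_sets \<nu>" if "i < n" for i using D(1)[OF that] sets\<nu> that by auto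
    then have "(\<Union>i<n. D i) \<in> null_sets \<nu>" by (intro null_sets.finite_UN) auto
    moreover have "X - (\<Union>i<n. D i) \<in> null_sets \<nu>"
      using D(5)[OF minorizing_irreducibility[OF min]] D(1) X sets\<nu> by (intro null_setsI) auto
    ultimately have "(\<Union>i<n. D i) \<union> (X - (\<Union>i<n. D i)) \<in> null_sets \<nu>" by (rule null_sets.Un)
    then have "X \<in> null_sets \<nu>"
      by (rule null_sets_subset) (use X sets\<nu> in auto)
    then show False using \<nu>X by auto
  qed
  then obtain i where i: "i < n" "emeasure \<nu> (D i) > 0" by blast
  have hit: "(j + Suc N) mod n = i" if j: "j < n" and x: "x \<in> D j" for j x
  proof (rule ccontr)
    assume ne: "(j + Suc N) mod n \<noteq> i"
    let ?k = "(j + Suc N) mod n" and ?Q = "kernel_pow X P (Suc N) x"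
    have k: "?k < n" using D(2) by simp
    have xX: "x \<in> X" using sets.sets_into_space[OF D(1)[OF j]] x by auto
    have disj: "D ?k \<inter> D i = {}" using D(3) k i(1) ne by (auto simp: disjoint_family_on_def)
    obtain \<delta> where \<delta>: "\<delta> > 0" "ennreal \<delta> * emeasure \<nu> (D i) \<le> emeasure ?Q (D i)"
      using min xX D(1)[OF i(1)] unfolding minorizing_def by blast
    have "0 < ennreal \<delta> * emeasure \<nu> (D i)" using \<delta>(1) i(2) by (simp add: ennreal_zero_less_mult_iff)
    then have pos: "0 < emeasure ?Q (D i)" using \<delta>(2) by (rule less_le_trans)
    have "emeasure ?Q (D ?k \<union> D i) = emeasure ?Q (D ?k) + emeasure ?Q (D i)"
      using disj D(1)[OF k] D(1)[OF i(1)] by (intro plus_emeasure[symmetric]) (simp_all only: sets_kernel_pow[OF xX])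
    then have "1 + emeasure ?Q (D i) \<le> 1 + 0"
      using kernel_pow_cycle[OF cyc j x, of "Suc N"] emeasure_kernel_pow_le_1[OF xX, of "Suc N" "D ?k \<union> D i"] by simp
    then have "emeasure ?Q (D i) \<le> 0" by (rule ennreal_add_left_cancel_le[THEN iffD1, THEN disjE]) auto
    then show False using pos by simp
  qed
  obtain x where x: "x \<in> D i" using i(2) by (cases "D i = {}") auto
  have "emeasure (P x) (D ((i + 1) mod n)) = 1" by (rule D(4)[OF i(1) x])
  then obtain y where y: "y \<in> D ((i + 1) mod n)" by (cases "D ((i + 1) mod n) = {}") auto
  \<comment> \<open>Comparing the starting classes \<open>i\<close> and \<open>i + 1\<close> at the
    same time \<open>Suc N\<close> forces them to coincide modulo \<open>n\<close>.\<close>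
  have 1: "(i + Suc N) mod n = i" by (rule hit[OF i(1) x])
  have "((i + 1) mod n + Suc N) mod n = i" by (rule hit[OF _ y]) (use D(2) in simp)
  then have "(i + 1 + Suc N) mod n = i" by (simp only: mod_add_left_eq)
  moreover have "i + 1 + Suc N = i + Suc N + 1" by simp
  ultimately have "((i + Suc N) mod n + 1) mod n = i" by (simp only: mod_add_left_eq)
  then have "(i + 1) mod n = i" by (simp only: 1)
  then show "n \<le> 1" using i(1) by (cases "i + 1 = n") auto
qed

end

theorem theorem3p5:
  fixes f :: "real^'d \<Rightarrow> real"
    and xstar :: "real^'d"
    and lam mu :: nat
    and w :: "nat \<Rightarrow> real"
    and c :: real
  assumes "continuous_on UNIV f"
    and "scaling_invariant f xstar"
    and "negligible_level_sets f"
    and "lam \<ge> 2"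
    and "mu \<in> {1..lam}"
    and "\<forall>i\<in>{1..mu}. \<forall>j\<in>{1..mu}. i \<le> j \<longrightarrow> w j \<le> w i"
    and "\<forall>i\<in>{1..mu}. w i > 0"
    and "(\<Sum>i=1..mu. w i) = 1"
    and "0 < c" and "c < 1"
  defines "X \<equiv> (normalized_space :: ((real^'d) \<times> (real^'d^'d)) set)"
    and "P \<equiv> normalized_kernel f xstar lam mu w c"
  shows "(\<forall>(M :: 'w measure) m C U. cma_es_run M f lam mu w c m C U \<longrightarrow>
            homogeneous_markov_chain M X P (\<lambda>k \<omega>. normalized_state xstar (m k \<omega>) (C k \<omega>)))
       \<and> markov_kernel X P
       \<and> phi_irreducible X P
       \<and> aperiodic X P
       \<and> T_chain X P
       \<and> (\<forall>K. compact K \<and> K \<subseteq> X \<longrightarrow> small_set X P K)"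
proof -
  interpret cma_es f xstar lam mu w c
    using assms by unfold_locales auto
  obtain N \<nu> where min: "minorizing (Suc N) \<nu>" using minorization by blast
  show ?thesis
    unfolding X_def P_def phi_irreducible_def
    using homogeneous_chain markov_kernel_P minorizing_irreducibility[OF min] minorizing_aperiodic[OF min]
      minorizing_T_chain[OF min] minorizing_small_set[OF min] by blast
qed

end
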